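(* Let $T\ge2$, $0<\delta_0\le 1/2$, $\delta\in(0,\delta_0)$, $M>0$, and let $(y_0,y_1)\in H^1_0(0,1)\times L^2(0,1)$ be given. The cost $J$ reaches its minimum over $\mathcal G_{\mathrm{ad}}$; that is, there exists $\gamma\in\mathcal G_{\mathrm{ad}}$ with $J(\gamma)=\inf_{\mathcal G_{\mathrm{ad}}}J$.
   Context: $\Omega=(0,1)$, $Q_T=\Omega\times(0,T)$, $\mathbf W=L^2(\Omega)\times H^{-1}(\Omega)$. For $(\varphi_0,\varphi_1)\in\mathbf W$, the corresponding $\varphi\in C([0,T];L^2(\Omega))\cap C^1([0,T];H^{-1}(\Omega))$ denotes the (transposition) solution of $\varphi_{tt}-\varphi_{xx}=0$ in $Q_T$, $\varphi=0$ on $\{0,1\}\times(0,T)$, $(\varphi,\varphi_t)(\cdot,0)=(\varphi_0,\varphi_1)$. Admissible curves: $\mathcal G_{\mathrm{ad}}=\{\gamma\in W^{1,\infty}(0,T):\ \|\gamma'\|_{L^\infty(0,T)}\le M,\ \delta_0\le\gamma\le1-\delta_0\}$. For such $\gamma$, $q_\gamma=\{(x,t)\in Q_T:\ |x-\gamma(t)|<\delta_0\}$. Cut-off: $\chi:\mathbb R\to[0,1]$ is a fixed even $C^1$ function with $\chi=1$ on $[-\delta_0+\delta,\delta_0-\delta]$, $\chi=0$ outside $(-\delta_0,\delta_0)$, and $\chi\in(0,1)$ elsewhere; $\chi_\gamma(x,t)=\chi(x-\gamma(t))$. Cost: for fixed $(y_0,y_1)$ and $\gamma$, let $$\mathcal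 J^\star_\gamma(\varphi_0,\varphi_1)=\frac12\iint_{q_\gamma}\varphi^2\chi_\gamma-\langle\varphi_1,y_0\rangle_{H^{-1}(\Omega),H^1_0(\Omega)}+\langle\varphi_0,y_1\rangle_{L^2(\Omega)},\qquad(\varphi_0,\varphi_1)\in\mathbf W.$$ For $T\ge2$ this functional has a unique minimizer over $\mathbf W$; with $\varphi$ the solution of the wave equation associated to that minimizer, $J(\gamma)=\iint_{q_\gamma}\varphi^2\chi_\gamma$. (Equivalently, $J(\gamma)=\|v\|^2_{L^2(q_\gamma;\chi_\gamma)}$ where $v=\varphi|_{q_\gamma}$ is the null control of minimal weighted $L^2$-norm for the initial datum $(y_0,y_1)$.) *)

theory Defs
  imports "HOL-Analysis.Analysis"
begin

text \<open>Elements of function spaces are represented by functions that matter only up to null sets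
  inside the domain; Borel measurable representatives always exist.\<close>

definition L2 :: "real set \<Rightarrow> (real \<Rightarrow> real) set" where
  "L2 S = {f. set_borel_measurable lborel S f \<and> set_integrable lborel S (\<lambda>x. (f x)\<^sup>2)}"

definition L2_norm :: "real set \<Rightarrow> (real \<Rightarrow> real) \<Rightarrow> real" where
  "L2_norm S f = sqrt (LINT x:S|lborel. (f x)\<^sup>2)"

definition Linf :: "real set \<Rightarrow> (real \<Rightarrow> real) set" where
  "Linf S = {f. set_borel_measurable lborel S f \<and> (\<exists>C. AE x\<in>S in lborel. \<bar>f x\<bar> \<le> C)}"

text \<open>\<open>C\<^sup>1\<close> functions with compact support in \<open>(a,b)\<close>.\<close>

definition C1c :: "real \<Rightarrow> real \<Rightarrow> (real \<Rightarrow> real) set" where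
  "C1c a b = {\<psi>. \<psi> C1_differentiable_on UNIV \<and>
     (\<exists>c d. a < c \<and> d < b \<and> (\<forall>x. x \<notin> {c..d} \<longrightarrow> \<psi> x = 0))}"

definition has_weak_deriv :: "real \<Rightarrow> real \<Rightarrow> (real \<Rightarrow> real) \<Rightarrow> (real \<Rightarrow> real) \<Rightarrow> bool" where
  "has_weak_deriv a b v g \<longleftrightarrow> (\<forall>\<psi>\<in>C1c a b.
     (LINT x:{a<..<b}|lborel. v x * deriv \<psi> x) = - (LINT x:{a<..<b}|lborel. g x * \<psi> x))"

abbreviation Omega :: "real set" where
  "Omega \<equiv> {0<..<1}"

definition H1 :: "(real \<Rightarrow> real) set" where
  "H1 = {v \<in> L2 Omega. \<exists>g\<in>L2 Omega. has_weak_deriv 0 1 v g}"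

definition weak_deriv :: "(real \<Rightarrow> real) \<Rightarrow> real \<Rightarrow> real" where
  "weak_deriv v = (SOME g. g \<in> L2 Omega \<and> has_weak_deriv 0 1 v g)"

text \<open>\<open>H\<^sup>1\<^sub>0\<close> is the closure of \<open>C\<^sup>1\<^sub>c\<close> in \<open>H\<^sup>1\<close>.\<close>

definition H10 :: "(real \<Rightarrow> real) set" where
  "H10 = {v \<in> H1. \<exists>\<psi> :: nat \<Rightarrow> real \<Rightarrow> real. (\<forall>n. \<psi> n \<in> C1c 0 1) \<and>
     (\<lambda>n. L2_norm Omega (\<lambda>x. \<psi> n x - v x)) \<longlonglongrightarrow> 0 \<and>
     (\<lambda>n. L2_norm Omega (\<lambda>x. deriv (\<psi> n) x - weak_deriv v x)) \<longlonglongrightarrow> 0}"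

text \<open>By the Poincare inequality this is equivalent to the full \<open>H\<^sup>1\<close> norm on \<open>H\<^sup>1\<^sub>0\<close>.\<close>

definition H10_norm :: "(real \<Rightarrow> real) \<Rightarrow> real" where
  "H10_norm v = L2_norm Omega (weak_deriv v)"

text \<open>The dual of \<open>H\<^sup>1\<^sub>0\<close>; the values of a functional outside \<open>H\<^sup>1\<^sub>0\<close> are irrelevant. The duality
  bracket is function application.\<close>

definition Hm1 :: "((real \<Rightarrow> real) \<Rightarrow> real) set" where
  "Hm1 = {L. (\<forall>u\<in>H10. \<forall>v\<in>H10. \<forall>a b. L (\<lambda>x. a * u x + b * v x) = a * L u + b * L v) \<and>
     (\<exists>C. \<forall>v\<in>H10. \<bar>L v\<bar> \<le> C * H10_norm v)}"

definition Hm1_norm :: "((real \<Rightarrow> real) \<Rightarrow> real) \<Rightarrow> real" where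
  "Hm1_norm L = (SUP v\<in>{v \<in> H10. H10_norm v \<le> 1}. \<bar>L v\<bar>)"

definition L2_inner :: "(real \<Rightarrow> real) \<Rightarrow> (real \<Rightarrow> real) \<Rightarrow> real" where
  "L2_inner f v = (LINT x:Omega|lborel. f x * v x)"

definition W :: "((real \<Rightarrow> real) \<times> ((real \<Rightarrow> real) \<Rightarrow> real)) set" where
  "W = L2 Omega \<times> Hm1"

text \<open>Functions on the space-time cylinder take their arguments in the order \<open>(x, t)\<close>.\<close>

definition Q :: "real \<Rightarrow> (real \<times> real) set" where
  "Q T = Omega \<times> {0<..<T}"

definition C0_L2 :: "real \<Rightarrow> (real \<times> real \<Rightarrow> real) \<Rightarrow> bool" where
  "C0_L2 T \<phi> \<longleftrightarrow> set_borel_measurable lborel (Q T) \<phi> \<and>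
     (\<forall>t\<in>{0..T}. (\<lambda>x. \<phi> (x, t)) \<in> L2 Omega \<and>
        ((\<lambda>s. L2_norm Omega (\<lambda>x. \<phi> (x, s) - \<phi> (x, t))) \<longlongrightarrow> 0) (at t within {0..T}))"

text \<open>\<open>C1_Hm1 T \<phi> \<phi>'\<close>: the curve \<open>t \<mapsto> \<phi>(\<cdot>,t)\<close>, with \<open>L\<^sup>2\<close> embedded in \<open>H\<^sup>-\<^sup>1\<close> through the
  \<open>L\<^sup>2\<close> inner product, is continuously differentiable into \<open>H\<^sup>-\<^sup>1\<close> with derivative \<open>\<phi>'\<close>.\<close>

definition C1_Hm1 ::
  "real \<Rightarrow> (real \<times> real \<Rightarrow> real) \<Rightarrow> (real \<Rightarrow> (real \<Rightarrow> real) \<Rightarrow> real) \<Rightarrow> bool" where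
  "C1_Hm1 T \<phi> \<phi>' \<longleftrightarrow> (\<forall>t\<in>{0..T}. \<phi>' t \<in> Hm1 \<and>
     ((\<lambda>s. Hm1_norm (\<lambda>v. \<phi>' s v - \<phi>' t v)) \<longlongrightarrow> 0) (at t within {0..T}) \<and>
     ((\<lambda>s. Hm1_norm (\<lambda>v.
         (L2_inner (\<lambda>x. \<phi> (x, s)) v - L2_inner (\<lambda>x. \<phi> (x, t)) v) / (s - t) - \<phi>' t v))
       \<longlongrightarrow> 0) (at t within {0..T}))"

text \<open>\<open>w\<close> is a classical (\<open>C\<^sup>2\<close> up to the boundary) solution of the backward problem
  \<open>w\<^sub>t\<^sub>t - w\<^sub>x\<^sub>x = f\<close>, \<open>w = 0\<close> at \<open>x = 0, 1\<close>, \<open>w = w\<^sub>t = 0\<close> at \<open>t = T\<close>.\<close>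

definition adjoint_solution ::
  "real \<Rightarrow> (real \<times> real \<Rightarrow> real) \<Rightarrow> (real \<times> real \<Rightarrow> real) \<Rightarrow> (real \<times> real \<Rightarrow> real) \<Rightarrow> bool" where
  "adjoint_solution T f w w\<^sub>t \<longleftrightarrow> (\<exists>w\<^sub>x w\<^sub>x\<^sub>x w\<^sub>x\<^sub>t w\<^sub>t\<^sub>t.
     (\<forall>g\<in>{w, w\<^sub>x, w\<^sub>t, w\<^sub>x\<^sub>x, w\<^sub>x\<^sub>t, w\<^sub>t\<^sub>t}. continuous_on ({0..1} \<times> {0..T}) g) \<and>
     (\<forall>x\<in>{0..1}. \<forall>t\<in>{0..T}.
        ((\<lambda>z. w (z, t)) has_real_derivative w\<^sub>x (x, t)) (at x within {0..1}) \<and>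
        ((\<lambda>s. w (x, s)) has_real_derivative w\<^sub>t (x, t)) (at t within {0..T}) \<and>
        ((\<lambda>z. w\<^sub>x (z, t)) has_real_derivative w\<^sub>x\<^sub>x (x, t)) (at x within {0..1}) \<and>
        ((\<lambda>s. w\<^sub>x (x, s)) has_real_derivative w\<^sub>x\<^sub>t (x, t)) (at t within {0..T}) \<and>
        ((\<lambda>z. w\<^sub>t (z, t)) has_real_derivative w\<^sub>x\<^sub>t (x, t)) (at x within {0..1}) \<and>
        ((\<lambda>s. w\<^sub>t (x, s)) has_real_derivative w\<^sub>t\<^sub>t (x, t)) (at t within {0..T}) \<and>
        w\<^sub>t\<^sub>t (x, t) - w\<^sub>x\<^sub>x (x, t) = f (x, t)) \<and>
     (\<forall>t\<in>{0..T}. w (0, t) = 0 \<and> w (1, t) = 0) \<and>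
     (\<forall>x\<in>{0..1}. w (x, T) = 0 \<and> w\<^sub>t (x, T) = 0))"

text \<open>Solution by transposition of \<open>\<phi>\<^sub>t\<^sub>t - \<phi>\<^sub>x\<^sub>x = 0\<close> with homogeneous Dirichlet conditions. The last
  clause is what two integrations by parts in each variable give for smooth \<open>\<phi>\<close>.\<close>

definition is_wave_solution ::
  "real \<Rightarrow> (real \<Rightarrow> real) \<times> ((real \<Rightarrow> real) \<Rightarrow> real) \<Rightarrow> (real \<times> real \<Rightarrow> real) \<Rightarrow> bool" where
  "is_wave_solution T = (\<lambda>(\<phi>\<^sub>0, \<phi>\<^sub>1) \<phi>.
     C0_L2 T \<phi> \<and>
     (AE x\<in>Omega in lborel. \<phi> (x, 0) = \<phi>\<^sub>0 x) \<and>
     (\<exists>\<phi>'. C1_Hm1 T \<phi> \<phi>' \<and> (\<forall>v\<in>H10. \<phi>' 0 v = \<phi>\<^sub>1 v)) \<and>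
     (\<forall>f w w\<^sub>t. adjoint_solution T f w w\<^sub>t \<longrightarrow>
        (LINT p:Q T|lborel. \<phi> p * f p) =
          \<phi>\<^sub>1 (\<lambda>x. w (x, 0)) - L2_inner \<phi>\<^sub>0 (\<lambda>x. w\<^sub>t (x, 0))))"

text \<open>The solution is unique up to null sets; this picks a representative.\<close>

definition wave_solution ::
  "real \<Rightarrow> (real \<Rightarrow> real) \<times> ((real \<Rightarrow> real) \<Rightarrow> real) \<Rightarrow> real \<times> real \<Rightarrow> real" where
  "wave_solution T p = (SOME \<phi>. is_wave_solution T p \<phi>)"

definition G_ad :: "real \<Rightarrow> real \<Rightarrow> real \<Rightarrow> (real \<Rightarrow> real) set" where
  "G_ad T \<delta>\<^sub>0 M = {\<gamma> \<in> Linf {0<..<T}.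
     (\<exists>g\<in>Linf {0<..<T}. has_weak_deriv 0 T \<gamma> g \<and> (AE t\<in>{0<..<T} in lborel. \<bar>g t\<bar> \<le> M)) \<and>
     (AE t\<in>{0<..<T} in lborel. \<delta>\<^sub>0 \<le> \<gamma> t \<and> \<gamma> t \<le> 1 - \<delta>\<^sub>0)}"

definition tube :: "real \<Rightarrow> real \<Rightarrow> (real \<Rightarrow> real) \<Rightarrow> (real \<times> real) set" where
  "tube T \<delta>\<^sub>0 \<gamma> = {(x, t) \<in> Q T. \<bar>x - \<gamma> t\<bar> < \<delta>\<^sub>0}"

definition is_cutoff :: "real \<Rightarrow> real \<Rightarrow> (real \<Rightarrow> real) \<Rightarrow> bool" where
  "is_cutoff \<delta>\<^sub>0 \<delta> chi \<longleftrightarrow>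
     chi C1_differentiable_on UNIV \<and> (\<forall>s. chi (- s) = chi s) \<and> (\<forall>s. chi s \<in> {0..1}) \<and>
     (\<forall>s\<in>{- \<delta>\<^sub>0 + \<delta>..\<delta>\<^sub>0 - \<delta>}. chi s = 1) \<and>
     (\<forall>s. s \<notin> {- \<delta>\<^sub>0<..<\<delta>\<^sub>0} \<longrightarrow> chi s = 0) \<and>
     (\<forall>s\<in>{- \<delta>\<^sub>0<..<\<delta>\<^sub>0} - {- \<delta>\<^sub>0 + \<delta>..\<delta>\<^sub>0 - \<delta>}. chi s \<in> {0<..<1})"

definition weighted_energy ::
  "real \<Rightarrow> real \<Rightarrow> (real \<Rightarrow> real) \<Rightarrow> (real \<Rightarrow> real) \<Rightarrow> (real \<times> real \<Rightarrow> real) \<Rightarrow> real" where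
  "weighted_energy T \<delta>\<^sub>0 chi \<gamma> \<phi> =
     (LINT (x, t):tube T \<delta>\<^sub>0 \<gamma>|lborel. (\<phi> (x, t))\<^sup>2 * chi (x - \<gamma> t))"

definition J_star ::
  "real \<Rightarrow> real \<Rightarrow> (real \<Rightarrow> real) \<Rightarrow> (real \<Rightarrow> real) \<Rightarrow> (real \<Rightarrow> real) \<Rightarrow> (real \<Rightarrow> real)
    \<Rightarrow> (real \<Rightarrow> real) \<times> ((real \<Rightarrow> real) \<Rightarrow> real) \<Rightarrow> real" where
  "J_star T \<delta>\<^sub>0 chi y\<^sub>0 y\<^sub>1 \<gamma> = (\<lambda>(\<phi>\<^sub>0, \<phi>\<^sub>1).
     1 / 2 * weighted_energy T \<delta>\<^sub>0 chi \<gamma> (wave_solution T (\<phi>\<^sub>0, \<phi>\<^sub>1)) - \<phi>\<^sub>1 y\<^sub>0 + L2_inner \<phi>\<^sub>0 y\<^sub>1)"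

text \<open>The minimizer is unique as an element of \<open>L\<^sup>2 \<times> H\<^sup>-\<^sup>1\<close>; \<open>arg_min\<close> picks a representative, and
  the value of \<open>J\<close> does not depend on it.\<close>

definition J ::
  "real \<Rightarrow> real \<Rightarrow> (real \<Rightarrow> real) \<Rightarrow> (real \<Rightarrow> real) \<Rightarrow> (real \<Rightarrow> real) \<Rightarrow> (real \<Rightarrow> real) \<Rightarrow> real" where
  "J T \<delta>\<^sub>0 chi y\<^sub>0 y\<^sub>1 \<gamma> = weighted_energy T \<delta>\<^sub>0 chi \<gamma>
     (wave_solution T (arg_min (J_star T \<delta>\<^sub>0 chi y\<^sub>0 y\<^sub>1 \<gamma>) (\<lambda>p. p \<in> W)))"

end

theory Submission
  imports Defs "HOL-Complex_Analysis.Great_Picard"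
begin

text \<open>By d'Alembert's formula the solution is \<open>\<phi>(x,t) = p(t + x) - p(t - x)\<close> with \<open>p\<close> square
  integrable of period 2, unique up to a constant, and \<open>W\<close> corresponds exactly to such profiles.
  For fixed \<open>\<gamma>\<close> the functional is \<open>E\<^sub>\<gamma>(p) / 2 - \<ell>(p)\<close> with \<open>E\<^sub>\<gamma>\<close> quadratic and \<open>\<ell>\<close> linear;
  it has a minimizer because \<open>E\<^sub>\<gamma>\<close> controls the variance of \<open>p\<close> (observability), and completing
  the square gives \<open>J(\<gamma>) = max\<^sub>p (2 \<ell>(p) - E\<^sub>\<gamma>(p))\<close>. Each \<open>E\<^sub>\<gamma>(p)\<close> is continuous in \<open>\<gamma>\<close>
  under uniform convergence, so \<open>J\<close> is lower semicontinuous, while the admissible curves, being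
  uniformly Lipschitz and bounded, are compact by Arzela-Ascoli.\<close>

subsection \<open>Square integrable functions\<close>

text \<open>The form J = max (2 l - E) is what makes the direct method short: the supremum runs over
  profiles that do not depend on the curve, so lower semicontinuity needs only continuity of each
  E(p) in the curve, and minimizers of different curves are never compared. The form comes from the
  Euler-Lagrange equation: E(p) = l(p) at the minimizer, so J is -2 times the minimal value. The
  obstacle is that \<open>wave_solution\<close> and \<open>arg_min\<close> pick unknown
  representatives. Hence transposition solutions must be unique up to null sets, which is read off
  their sine coefficients, and any two minimizers must have the same observed part, which completing
  the square yields. Constants are invisible to p(t + x) - p(t - x), and l annihilates them as well,
  so all estimates on p are modulo constants. In the coordinates u = t + x, v = t - x the energy
  integrates (p u - p v)^2; this controls the oscillation of p near t + c t and t - c t, and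
  overlapping windows chain these local controls together. The derivative bound of the curves passes
  to the limit in dual form, as an inequality against test functions.\<close>

definition sq_int :: "'a measure \<Rightarrow> ('a \<Rightarrow> real) set" where
  "sq_int M = {f \<in> borel_measurable M. integrable M (\<lambda>x. (f x)\<^sup>2)}"

definition l2n :: "'a measure \<Rightarrow> ('a \<Rightarrow> real) \<Rightarrow> real" where
  "l2n M f = sqrt (\<integral>x. (f x)\<^sup>2 \<partial>M)"

lemma sq_int_measurable [measurable_dest]: "f \<in> sq_int M \<Longrightarrow> f \<in> borel_measurable M"
  by (simp add: sq_int_def)

lemma sq_int_integrable: "f \<in> sq_int M \<Longrightarrow> integrable M (\<lambda>x. (f x)\<^sup>2)"
  by (simp add: sq_int_def)

lemma l2n_nonneg [simp]: "0 \<le> l2n M f"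
  by (simp add: l2n_def)

lemma l2n_power2: "(l2n M f)\<^sup>2 = (\<integral>x. (f x)\<^sup>2 \<partial>M)"
  by (simp add: l2n_def)

lemma l2n_zero [simp]: "l2n M (\<lambda>x. 0) = 0"
  by (simp add: l2n_def)

lemma l2n_cong_AE:
  assumes "f \<in> borel_measurable M" "g \<in> borel_measurable M" "AE x in M. f x = g x"
  shows "l2n M f = l2n M g"
  unfolding l2n_def using assms by (intro arg_cong[where f=sqrt] integral_cong_AE) auto

lemma l2n_minus_commute: "l2n M (\<lambda>x. f x - g x) = l2n M (\<lambda>x. g x - f x)"
  by (simp add: l2n_def power2_commute)

lemma l2n_uminus: "l2n M (\<lambda>x. - f x) = l2n M f"
  by (simp add: l2n_def)

lemma l2n_cmult: "l2n M (\<lambda>x. c * f x) = \<bar>c\<bar> * l2n M f"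
  by (simp add: l2n_def power_mult_distrib real_sqrt_mult)

lemma integrable_mult_sq_int:
  assumes f: "f \<in> sq_int M" and g: "g \<in> sq_int M"
  shows "integrable M (\<lambda>x. f x * g x)"
proof (rule Bochner_Integration.integrable_bound)
  show "integrable M (\<lambda>x. (f x)\<^sup>2 + (g x)\<^sup>2)"
    using f g by (simp add: sq_int_integrable)
  show "(\<lambda>x. f x * g x) \<in> borel_measurable M"
    using f g by measurable
  show "AE x in M. norm (f x * g x) \<le> norm ((f x)\<^sup>2 + (g x)\<^sup>2)"
  proof (rule AE_I2)
    fix x
    have "2 * \<bar>f x\<bar> * \<bar>g x\<bar> \<le> (f x)\<^sup>2 + (g x)\<^sup>2"
      using sum_squares_bound[of "\<bar>f x\<bar>" "\<bar>g x\<bar>"] by simp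
    moreover have "0 \<le> \<bar>f x\<bar> * \<bar>g x\<bar>" by simp
    ultimately have "\<bar>f x\<bar> * \<bar>g x\<bar> \<le> (f x)\<^sup>2 + (g x)\<^sup>2" by linarith
    then show "norm (f x * g x) \<le> norm ((f x)\<^sup>2 + (g x)\<^sup>2)"
      by (simp add: abs_mult)
  qed
qed

lemma sq_int_lincomb:
  assumes f: "f \<in> sq_int M" and g: "g \<in> sq_int M"
  shows "(\<lambda>x. a * f x + b * g x) \<in> sq_int M"
proof -
  have "(\<lambda>x. (a * f x + b * g x)\<^sup>2) = (\<lambda>x. a\<^sup>2 * (f x)\<^sup>2 + b\<^sup>2 * (g x)\<^sup>2 + (2 * a * b) * (f x * g x))"
    by (auto simp: power2_eq_square algebra_simps)
  then have "integrable M (\<lambda>x. (a * f x + b * g x)\<^sup>2)"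
    using f g integrable_mult_sq_int[OF f g] by (simp add: sq_int_integrable)
  moreover have "(\<lambda>x. a * f x + b * g x) \<in> borel_measurable M"
    using f g by measurable
  ultimately show ?thesis by (simp add: sq_int_def)
qed

lemma sq_int_zero [simp]: "(\<lambda>x. 0) \<in> sq_int M"
  by (simp add: sq_int_def)

lemma sq_int_cmult: "f \<in> sq_int M \<Longrightarrow> (\<lambda>x. c * f x) \<in> sq_int M"
  using sq_int_lincomb[of f M f c 0] by simp

lemma sq_int_add: "f \<in> sq_int M \<Longrightarrow> g \<in> sq_int M \<Longrightarrow> (\<lambda>x. f x + g x) \<in> sq_int M"
  using sq_int_lincomb[of f M g 1 1] by simp

lemma sq_int_uminus: "f \<in> sq_int M \<Longrightarrow> (\<lambda>x. - f x) \<in> sq_int M"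
  using sq_int_cmult[of f M "-1"] by simp

lemma sq_int_diff: "f \<in> sq_int M \<Longrightarrow> g \<in> sq_int M \<Longrightarrow> (\<lambda>x. f x - g x) \<in> sq_int M"
  using sq_int_lincomb[of f M g 1 "-1"] by simp

lemma sq_int_bound:
  assumes "f \<in> sq_int M" "g \<in> borel_measurable M" "AE x in M. \<bar>g x\<bar> \<le> \<bar>f x\<bar>"
  shows "g \<in> sq_int M"
proof -
  have "integrable M (\<lambda>x. (g x)\<^sup>2)"
  proof (rule Bochner_Integration.integrable_bound[OF sq_int_integrable[OF assms(1)]])
    show "AE x in M. norm ((g x)\<^sup>2) \<le> norm ((f x)\<^sup>2)"
      using assms(3) by eventually_elim (simp add: abs_le_square_iff)
  qed (use assms in measurable)
  then show ?thesis using assms by (simp add: sq_int_def)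
qed

lemma sq_int_mult_bounded:
  assumes "f \<in> sq_int M" "g \<in> borel_measurable M" "\<And>x. x \<in> space M \<Longrightarrow> \<bar>g x\<bar> \<le> B"
  shows "(\<lambda>x. g x * f x) \<in> sq_int M"
  using sq_int_cmult[OF assms(1), of B]
proof (rule sq_int_bound)
  show "(\<lambda>x. g x * f x) \<in> borel_measurable M" using assms by measurable
  show "AE x in M. \<bar>g x * f x\<bar> \<le> \<bar>B * f x\<bar>"
  proof (rule AE_I2)
    fix x assume "x \<in> space M"
    then have "\<bar>g x\<bar> \<le> \<bar>B\<bar>" using assms(3)[of x] by linarith
    then show "\<bar>g x * f x\<bar> \<le> \<bar>B * f x\<bar>"
      by (simp add: abs_mult mult_right_mono)
  qed
qed

lemma sq_int_bounded:
  assumes "finite_measure M" "f \<in> borel_measurable M" "\<And>x. x \<in> space M \<Longrightarrow> \<bar>f x\<bar> \<le> B"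
  shows "f \<in> sq_int M"
proof -
  interpret finite_measure M by fact
  have "(\<lambda>x. f x * 1) \<in> sq_int M"
    by (rule sq_int_mult_bounded[where B=B]) (use assms in \<open>auto simp: sq_int_def\<close>)
  then show ?thesis by simp
qed

lemma sq_int_imp_integrable:
  assumes "finite_measure M" "f \<in> sq_int M"
  shows "integrable M f"
proof -
  interpret finite_measure M by fact
  have "(\<lambda>x. 1) \<in> sq_int M" by (simp add: sq_int_def)
  from integrable_mult_sq_int[OF assms(2) this] show ?thesis by simp
qed

text \<open>The discriminant condition in square-root form. It serves both Cauchy-Schwarz, with
  \<open>C\<close> a squared norm, and near-minimality in the Riesz argument, with \<open>C\<close>
  the defect from the infimum.\<close>

lemma quadratic_nonneg_discriminant:
  fixes A B C :: real
  assumes "\<And>s. 0 \<le> A * s\<^sup>2 + 2 * B * s + C" "0 \<le> A" "0 \<le> C"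
  shows "\<bar>B\<bar> \<le> sqrt A * sqrt C"
proof (cases "A = 0")
  case True
  have "B = 0"
  proof (rule ccontr)
    assume "B \<noteq> 0"
    \<comment> \<open>With \<open>A = 0\<close> the polynomial is affine; at this point it has the
      value -1.\<close>
    with assms(1)[of "- (C + 1) / (2 * B)"] True show False by (simp add: field_simps)
  qed
  then show ?thesis using True by simp
next
  case False
  then have A: "A > 0" using assms(2) by simp
  \<comment> \<open>The vertex of the parabola is the point where nonnegativity says most.\<close>
  have "0 \<le> A * (A * (- B / A)\<^sup>2 + 2 * B * (- B / A) + C)"
    using assms(1)[of "- B / A"] A by simp
  also have "\<dots> = A * C - B\<^sup>2"
    using A by (simp add: power2_eq_square field_simps)
  finally have "B\<^sup>2 \<le> A * C" by simp
  then have "sqrt (B\<^sup>2) \<le> sqrt (A * C)" by (rule real_sqrt_le_mono)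
  then show ?thesis by (simp add: real_sqrt_mult)
qed

lemma l2n_expand:
  assumes f: "f \<in> sq_int M" and g: "g \<in> sq_int M"
  shows "(l2n M (\<lambda>x. a * f x + b * g x))\<^sup>2
     = a\<^sup>2 * (l2n M f)\<^sup>2 + 2 * a * b * (\<integral>x. f x * g x \<partial>M) + b\<^sup>2 * (l2n M g)\<^sup>2"
proof -
  have *: "(\<lambda>x. (a * f x + b * g x)\<^sup>2) = (\<lambda>x. a\<^sup>2 * (f x)\<^sup>2 + (2 * a * b) * (f x * g x) + b\<^sup>2 * (g x)\<^sup>2)"
    by (auto simp: power2_eq_square algebra_simps)
  show ?thesis
    unfolding l2n_power2 *
    using sq_int_integrable[OF f] sq_int_integrable[OF g] integrable_mult_sq_int[OF f g]
    by simp
qed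

lemma l2n_Cauchy_Schwarz:
  assumes f: "f \<in> sq_int M" and g: "g \<in> sq_int M"
  shows "\<bar>\<integral>x. f x * g x \<partial>M\<bar> \<le> l2n M f * l2n M g"
proof -
  have "0 \<le> (l2n M f)\<^sup>2 * s\<^sup>2 + 2 * (\<integral>x. f x * g x \<partial>M) * s + (l2n M g)\<^sup>2" for s
    using l2n_expand[OF f g, of s 1] zero_le_power2[of "l2n M (\<lambda>x. s * f x + 1 * g x)"]
    by (simp add: mult_ac)
  from quadratic_nonneg_discriminant[OF this] show ?thesis by simp
qed

lemma l2n_triangle:
  assumes f: "f \<in> sq_int M" and g: "g \<in> sq_int M"
  shows "l2n M (\<lambda>x. f x + g x) \<le> l2n M f + l2n M g"
proof (rule power2_le_imp_le)
  have "(l2n M (\<lambda>x. f x + g x))\<^sup>2 = (l2n M f)\<^sup>2 + 2 * (\<integral>x. f x * g x \<partial>M) + (l2n M g)\<^sup>2"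
    using l2n_expand[OF f g, of 1 1] by simp
  also have "\<dots> \<le> (l2n M f + l2n M g)\<^sup>2"
    using l2n_Cauchy_Schwarz[OF f g] by (simp add: power2_sum)
  finally show "(l2n M (\<lambda>x. f x + g x))\<^sup>2 \<le> (l2n M f + l2n M g)\<^sup>2" .
qed simp

lemma l2n_triangle_diff:
  assumes "f \<in> sq_int M" and "g \<in> sq_int M"
  shows "l2n M (\<lambda>x. f x - g x) \<le> l2n M f + l2n M g"
  using l2n_triangle[OF assms(1) sq_int_uminus[OF assms(2)]] by (simp add: l2n_uminus)

lemma l2n_triangle3:
  assumes "f \<in> sq_int M" and "g \<in> sq_int M" and "h \<in> sq_int M"
  shows "l2n M (\<lambda>x. f x - h x) \<le> l2n M (\<lambda>x. f x - g x) + l2n M (\<lambda>x. g x - h x)"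
  using l2n_triangle[OF sq_int_diff[OF assms(1,2)] sq_int_diff[OF assms(2,3)]] by simp

lemma l2n_reverse_triangle:
  assumes f: "f \<in> sq_int M" and g: "g \<in> sq_int M"
  shows "\<bar>l2n M f - l2n M g\<bar> \<le> l2n M (\<lambda>x. f x - g x)"
  using l2n_triangle[OF sq_int_diff[OF f g] g] l2n_triangle[OF sq_int_diff[OF g f] f]
  by (simp add: l2n_minus_commute[of M g f])

lemma l2n_mono:
  assumes "g \<in> sq_int M" "f \<in> borel_measurable M" "AE x in M. \<bar>f x\<bar> \<le> \<bar>g x\<bar>"
  shows "l2n M f \<le> l2n M g"
proof -
  have "f \<in> sq_int M" by (rule sq_int_bound[OF assms])
  then show ?thesis
    unfolding l2n_def using assms(3)
    by (intro real_sqrt_le_mono integral_mono_AE sq_int_integrable assms(1))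
      (auto simp: abs_le_square_iff)
qed

lemma l2n_mult_bounded:
  assumes "f \<in> sq_int M" "g \<in> borel_measurable M" "\<And>x. x \<in> space M \<Longrightarrow> \<bar>g x\<bar> \<le> B"
    and "0 \<le> B"
  shows "l2n M (\<lambda>x. g x * f x) \<le> B * l2n M f"
proof -
  have "l2n M (\<lambda>x. g x * f x) \<le> l2n M (\<lambda>x. B * f x)"
    by (rule l2n_mono) (use assms in \<open>auto intro!: sq_int_cmult AE_I2 simp: abs_mult mult_right_mono\<close>)
  then show ?thesis using assms(4) by (simp add: l2n_cmult)
qed

lemma l2n_le_bound:
  assumes M: "finite_measure M" and "f \<in> borel_measurable M" "\<And>x. x \<in> space M \<Longrightarrow> \<bar>f x\<bar> \<le> B"
    and "0 \<le> B"
  shows "l2n M f \<le> B * sqrt (measure M (space M))"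
proof -
  interpret finite_measure M by fact
  have "(\<lambda>x. 1) \<in> sq_int M" by (simp add: sq_int_def)
  from l2n_mult_bounded[OF this assms(2-4)] show ?thesis by (simp add: l2n_def)
qed

lemma l2n_eq_0_imp_AE:
  assumes "f \<in> sq_int M" "l2n M f = 0"
  shows "AE x in M. f x = 0"
proof -
  have "(\<integral>x. (f x)\<^sup>2 \<partial>M) = 0" using assms(2) by (simp add: l2n_def)
  then have "AE x in M. (f x)\<^sup>2 = 0"
    using sq_int_integrable[OF assms(1)] by (subst (asm) integral_nonneg_eq_0_iff_AE) auto
  then show ?thesis by simp
qed

lemma integral_mult_tendsto:
  assumes "\<And>n. f n \<in> sq_int M" "f' \<in> sq_int M" "g \<in> sq_int M"
    and "(\<lambda>n. l2n M (\<lambda>x. f n x - f' x)) \<longlonglongrightarrow> 0"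
  shows "(\<lambda>n. \<integral>x. f n x * g x \<partial>M) \<longlonglongrightarrow> (\<integral>x. f' x * g x \<partial>M)"
proof (rule Lim_null[THEN iffD2], rule Lim_null_comparison)
  show "(\<lambda>n. l2n M (\<lambda>x. f n x - f' x) * l2n M g) \<longlonglongrightarrow> 0"
    using tendsto_mult_right[OF assms(4), of "l2n M g"] by simp
  show "\<forall>\<^sub>F n in sequentially. norm ((\<integral>x. f n x * g x \<partial>M) - (\<integral>x. f' x * g x \<partial>M))
      \<le> l2n M (\<lambda>x. f n x - f' x) * l2n M g"
  proof (rule always_eventually, rule allI)
    fix n
    have "(\<integral>x. f n x * g x \<partial>M) - (\<integral>x. f' x * g x \<partial>M) = (\<integral>x. (f n x - f' x) * g x \<partial>M)"
      using assms(1)[of n] assms(2,3)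
      by (subst Bochner_Integration.integral_diff[symmetric])
        (auto intro!: integrable_mult_sq_int simp: algebra_simps)
    then show "norm ((\<integral>x. f n x * g x \<partial>M) - (\<integral>x. f' x * g x \<partial>M))
      \<le> l2n M (\<lambda>x. f n x - f' x) * l2n M g"
      using l2n_Cauchy_Schwarz[OF sq_int_diff[OF assms(1)[of n] assms(2)] assms(3)] by simp
  qed
qed

lemma l2n_tendsto:
  assumes "\<And>n. f n \<in> sq_int M" "f' \<in> sq_int M"
    and "(\<lambda>n. l2n M (\<lambda>x. f n x - f' x)) \<longlonglongrightarrow> 0"
  shows "(\<lambda>n. l2n M (f n)) \<longlonglongrightarrow> l2n M f'"
proof (rule Lim_null[THEN iffD2], rule Lim_null_comparison[OF _ assms(3)])
  show "\<forall>\<^sub>F n in sequentially. norm (l2n M (f n) - l2n M f') \<le> l2n M (\<lambda>x. f n x - f' x)"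
    using l2n_reverse_triangle[OF assms(1,2)] by simp
qed

text \<open>Domination is asked of the differences \<open>f n - f'\<close>. For truncations of a
  function this is immediate, since they differ from it by at most its own absolute value.\<close>

lemma l2n_dominated:
  assumes g: "g \<in> sq_int M" and f: "\<And>n. f n \<in> borel_measurable M" and f': "f' \<in> borel_measurable M"
    and lim: "AE x in M. (\<lambda>n. f n x) \<longlonglongrightarrow> f' x"
    and bnd: "\<And>n. AE x in M. \<bar>f n x - f' x\<bar> \<le> \<bar>g x\<bar>"
  shows "(\<lambda>n. l2n M (\<lambda>x. f n x - f' x)) \<longlonglongrightarrow> 0"
proof -
  have "(\<lambda>n. \<integral>x. (f n x - f' x)\<^sup>2 \<partial>M) \<longlonglongrightarrow> (\<integral>x. 0 \<partial>M)"
  proof (rule integral_dominated_convergence)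
    show "integrable M (\<lambda>x. (g x)\<^sup>2)" by (rule sq_int_integrable[OF g])
    show "AE x in M. (\<lambda>n. (f n x - f' x)\<^sup>2) \<longlonglongrightarrow> 0"
      using lim
    proof eventually_elim
      case (elim x)
      then have "(\<lambda>n. (f n x - f' x)\<^sup>2) \<longlonglongrightarrow> (f' x - f' x)\<^sup>2" by (intro tendsto_intros)
      then show ?case by simp
    qed
    show "AE x in M. norm ((f n x - f' x)\<^sup>2) \<le> (g x)\<^sup>2" for n
      using bnd[of n] by eventually_elim (simp add: abs_le_square_iff)
  qed (use f f' in measurable)
  then have "(\<lambda>n. sqrt (\<integral>x. (f n x - f' x)\<^sup>2 \<partial>M)) \<longlonglongrightarrow> sqrt 0"
    by (intro tendsto_real_sqrt) simp
  then show ?thesis by (simp add: l2n_def)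
qed

lemma ennreal_l2n_power2:
  assumes "f \<in> sq_int M"
  shows "ennreal ((l2n M f)\<^sup>2) = (\<integral>\<^sup>+x. ennreal ((f x)\<^sup>2) \<partial>M)"
  unfolding l2n_power2 using sq_int_integrable[OF assms] by (simp add: nn_integral_eq_integral)

lemma sq_int_nn_integral:
  assumes "f \<in> borel_measurable M" "(\<integral>\<^sup>+x. ennreal ((f x)\<^sup>2) \<partial>M) \<le> ennreal (c\<^sup>2)" "0 \<le> c"
  shows "f \<in> sq_int M" "l2n M f \<le> c"
proof -
  show s: "f \<in> sq_int M"
    unfolding sq_int_def using assms order.strict_trans1[OF assms(2), of top]
    by (auto simp: integrable_iff_bounded)
  have "ennreal ((l2n M f)\<^sup>2) \<le> ennreal (c\<^sup>2)"
    using ennreal_l2n_power2[OF s] assms(2) by simp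
  then have "(l2n M f)\<^sup>2 \<le> c\<^sup>2" by simp
  then show "l2n M f \<le> c" using assms(3) by (rule power2_le_imp_le)
qed

text \<open>Riesz-Fischer. Along a subsequence with increments at most (1/2)^k in norm,
  Cauchy-Schwarz against 1 makes the increments summable in the mean, so the subsequence converges
  almost everywhere; Fatou's lemma then gives convergence in norm.\<close>

theorem sq_int_complete:
  fixes F :: "nat \<Rightarrow> 'a \<Rightarrow> real"
  assumes M: "finite_measure M" and F: "\<And>n. F n \<in> sq_int M"
    and Cauchy: "\<And>e. 0 < e \<Longrightarrow> \<exists>N. \<forall>m\<ge>N. \<forall>n\<ge>N. l2n M (\<lambda>x. F m x - F n x) < e"
  shows "\<exists>f\<in>sq_int M. (\<lambda>n. l2n M (\<lambda>x. F n x - f x)) \<longlonglongrightarrow> 0"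
proof -
  interpret finite_measure M by fact
  have [measurable]: "F n \<in> borel_measurable M" for n using F by (simp add: sq_int_def)
  have "\<exists>N. \<forall>m\<ge>N. \<forall>n\<ge>N. l2n M (\<lambda>x. F m x - F n x) < (1/2)^k" for k :: nat
    by (rule Cauchy) simp
  then obtain N where N: "\<And>k m n. N k \<le> m \<Longrightarrow> N k \<le> n \<Longrightarrow> l2n M (\<lambda>x. F m x - F n x) < (1/2)^k"
    by metis
  \<comment> \<open>Summing the thresholds makes the chosen indices monotone and at least
    \<open>N k\<close>.\<close>
  define r where "r k = (\<Sum>i\<le>k. N i) + k" for k
  have rN: "N k \<le> r k" for k unfolding r_def by (simp add: member_le_sum trans_le_add1)
  have rS: "r k \<le> r (Suc k)" for k unfolding r_def by simp
  define d where "d k x = \<bar>F (r (Suc k)) x - F (r k) x\<bar>" for k x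
  have d: "l2n M (d k) \<le> (1/2)^k" for k
    using N[of k "r (Suc k)" "r k"] rN[of k] rS[of k] by (simp add: d_def l2n_def)
  have [measurable]: "d k \<in> borel_measurable M" for k unfolding d_def by measurable
  have dsq: "d k \<in> sq_int M" for k
    by (rule sq_int_bound[OF sq_int_diff[OF F[of "r (Suc k)"] F[of "r k"]]]) (auto simp: d_def)
  define c where "c = sqrt (measure M (space M))"
  have one: "(\<lambda>x. 1) \<in> sq_int M" by (simp add: sq_int_def)
  have "(\<integral>\<^sup>+x. ennreal (d k x) \<partial>M) \<le> ennreal (c * (1/2)^k)" for k
  proof -
    have "(\<integral>x. d k x \<partial>M) \<le> l2n M (d k) * c"
      using l2n_Cauchy_Schwarz[OF dsq one, of k] by (simp add: c_def l2n_def)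
    also have "\<dots> \<le> c * (1/2)^k"
      using mult_right_mono[OF d, of c k] by (simp add: c_def mult.commute)
    finally have "(\<integral>x. d k x \<partial>M) \<le> c * (1/2)^k" .
    moreover have "(\<integral>\<^sup>+x. ennreal (d k x) \<partial>M) = ennreal (\<integral>x. d k x \<partial>M)"
      by (rule nn_integral_eq_integral[OF sq_int_imp_integrable[OF M dsq]]) (simp add: d_def)
    ultimately show ?thesis by (simp add: ennreal_leI)
  qed
  then have "(\<Sum>k. \<integral>\<^sup>+x. ennreal (d k x) \<partial>M) \<le> (\<Sum>k. ennreal (c * (1/2)^k))"
    by (intro suminf_le) auto
  also have "\<dots> < top"
  proof -
    have "(\<Sum>k. ennreal (c * (1/2)^k)) = ennreal (\<Sum>k. c * (1/2)^k)"
      by (intro suminf_ennreal2) (auto simp: c_def intro!: summable_mult summable_geometric)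
    then show ?thesis by simp
  qed
  finally have "(\<integral>\<^sup>+x. (\<Sum>k. ennreal (d k x)) \<partial>M) < top"
    by (subst nn_integral_suminf) auto
  then have "AE x in M. (\<Sum>k. ennreal (d k x)) \<noteq> \<infinity>"
    by (intro nn_integral_noteq_infinite) auto
  then have conv: "AE x in M. convergent (\<lambda>k. F (r k) x)"
  proof eventually_elim
    case (elim x)
    have "summable (\<lambda>k. d k x)"
      using elim by (intro summable_suminf_not_top) (auto simp: d_def)
    then have "summable (\<lambda>k. F (r (Suc k)) x - F (r k) x)"
      unfolding d_def by (rule summable_rabs_cancel)
    then have "convergent (\<lambda>n. \<Sum>k<n. F (r (Suc k)) x - F (r k) x)"
      by (simp add: summable_iff_convergent)
    then have "convergent (\<lambda>n. F (r n) x - F (r 0) x)"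
      by (simp add: sum_lessThan_telescope[of "\<lambda>k. F (r k) x"])
    then have "convergent (\<lambda>n. (F (r n) x - F (r 0) x) + F (r 0) x)"
      by (intro convergent_add convergent_const)
    then show ?case by simp
  qed
  define f where "f x = lim (\<lambda>k. F (r k) x)" for x
  have [measurable]: "f \<in> borel_measurable M" unfolding f_def by measurable
  have lim: "AE x in M. (\<lambda>k. F (r k) x) \<longlonglongrightarrow> f x"
    using conv by eventually_elim (simp add: f_def convergent_LIMSEQ_iff)
  \<comment> \<open>Fatou along the subsequence, with \<open>m\<close> held fixed: the bound covers
    every index past \<open>N k\<close>, so the full sequence converges.\<close>
  have close: "(\<lambda>x. F m x - f x) \<in> sq_int M \<and> l2n M (\<lambda>x. F m x - f x) \<le> (1/2)^k"
    if "N k \<le> m" for k m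
  proof -
    have "(\<integral>\<^sup>+x. ennreal ((F m x - f x)\<^sup>2) \<partial>M)
        = (\<integral>\<^sup>+x. liminf (\<lambda>j. ennreal ((F m x - F (r j) x)\<^sup>2)) \<partial>M)"
    proof (rule nn_integral_cong_AE)
      show "AE x in M. ennreal ((F m x - f x)\<^sup>2) = liminf (\<lambda>j. ennreal ((F m x - F (r j) x)\<^sup>2))"
        using lim
      proof eventually_elim
        case (elim x)
        then have "(\<lambda>j. ennreal ((F m x - F (r j) x)\<^sup>2)) \<longlonglongrightarrow> ennreal ((F m x - f x)\<^sup>2)"
          by (intro tendsto_intros tendsto_ennrealI)
        then show ?case by (intro lim_imp_Liminf[symmetric] trivial_limit_sequentially)
      qed
    qed
    also have "\<dots> \<le> liminf (\<lambda>j. \<integral>\<^sup>+x. ennreal ((F m x - F (r j) x)\<^sup>2) \<partial>M)"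
      by (intro nn_integral_liminf) auto
    also have "\<dots> \<le> ennreal (((1/2)^k)\<^sup>2)"
    proof (rule Liminf_le)
      show "\<forall>\<^sub>F j in sequentially. (\<integral>\<^sup>+x. ennreal ((F m x - F (r j) x)\<^sup>2) \<partial>M) \<le> ennreal (((1/2)^k)\<^sup>2)"
      proof (rule eventually_sequentiallyI)
        fix j assume "k \<le> j"
        have "r k \<le> r j" using lift_Suc_mono_le[of r k j] rS \<open>k \<le> j\<close> by blast
        then have "N k \<le> r j" using rN[of k] by simp
        then have "l2n M (\<lambda>x. F m x - F (r j) x) \<le> (1/2)^k"
          using N[of k m "r j"] that by simp
        then have "(l2n M (\<lambda>x. F m x - F (r j) x))\<^sup>2 \<le> ((1/2)^k)\<^sup>2" by (intro power_mono) auto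
        then show "(\<integral>\<^sup>+x. ennreal ((F m x - F (r j) x)\<^sup>2) \<partial>M) \<le> ennreal (((1/2)^k)\<^sup>2)"
          using ennreal_l2n_power2[OF sq_int_diff[OF F[of m] F[of "r j"]]]
          by (metis ennreal_leI)
      qed
    qed simp
    finally show ?thesis
      using sq_int_nn_integral[of "\<lambda>x. F m x - f x" M "(1/2)^k"] by auto
  qed
  have "f \<in> sq_int M"
    using sq_int_diff[OF F[of "N 0"] conjunct1[OF close[of 0 "N 0"]]] by simp
  moreover have "(\<lambda>n. l2n M (\<lambda>x. F n x - f x)) \<longlonglongrightarrow> 0"
  proof (rule LIMSEQ_I)
    fix e :: real assume "0 < e"
    then obtain k where "(1/2::real)^k < e"
      using real_arch_pow_inv[of e "1/2"] by auto
    then show "\<exists>no. \<forall>n\<ge>no. norm (l2n M (\<lambda>x. F n x - f x) - 0) < e"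
      using close[of k] by (intro exI[of _ "N k"]) (auto intro: le_less_trans)
  qed
  ultimately show ?thesis by blast
qed

text \<open>The graph \<open>\<Gamma>\<close> encodes a subspace together with a bounded functional on it; \<open>F\<close>
  minimizes \<open>\<parallel>f\<parallel>\<^sup>2 / 2 - k\<close>. The subspace need not be closed.\<close>

theorem riesz_minimizing_sequence:
  fixes \<Gamma> :: "(('a \<Rightarrow> real) \<times> real) set"
  assumes ne: "\<Gamma> \<noteq> {}" and sq: "\<And>f k. (f, k) \<in> \<Gamma> \<Longrightarrow> f \<in> sq_int M"
    and lin: "\<And>f k g l a b. (f, k) \<in> \<Gamma> \<Longrightarrow> (g, l) \<in> \<Gamma> \<Longrightarrow> (\<lambda>x. a * f x + b * g x, a * k + b * l) \<in> \<Gamma>"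
    and bnd: "\<And>f k. (f, k) \<in> \<Gamma> \<Longrightarrow> \<bar>k\<bar> \<le> C * l2n M f"
  shows "\<exists>F K. (\<forall>n::nat. (F n, K n) \<in> \<Gamma>) \<and>
    (\<forall>e>0. \<exists>N. \<forall>m\<ge>N. \<forall>n\<ge>N. l2n M (\<lambda>x. F m x - F n x) < e) \<and>
    (\<forall>(f, k)\<in>\<Gamma>. (\<lambda>n. \<integral>x. F n x * f x \<partial>M) \<longlonglongrightarrow> k)"
proof -
  define I where "I = (\<lambda>p. (l2n M (fst p))\<^sup>2 / 2 - snd p :: real)"
  define m where "m = (INF p\<in>\<Gamma>. I p)"
  \<comment> \<open>Completing the square: s^2 / 2 - C s is never below -C^2 / 2.\<close>
  have lower: "- (C\<^sup>2) / 2 \<le> I p" if "p \<in> \<Gamma>" for p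
  proof -
    have "snd p \<le> C * l2n M (fst p)" using bnd[of "fst p" "snd p"] that by simp
    moreover have "0 \<le> (l2n M (fst p) - C)\<^sup>2" by simp
    ultimately show ?thesis unfolding I_def by (simp add: power2_diff mult.assoc mult.commute)
  qed
  then have bdd: "bdd_below (I ` \<Gamma>)" by (rule bdd_belowI2)
  have m_le: "m \<le> I p" if "p \<in> \<Gamma>" for p
    unfolding m_def by (rule cINF_lower[OF bdd that])
  have "\<exists>p\<in>\<Gamma>. I p < m + 1 / Suc n" for n
    by (rule cINF_less_iff[OF ne bdd, THEN iffD1]) (simp add: m_def[symmetric])
  then have "\<forall>n. \<exists>p. p \<in> \<Gamma> \<and> I p < m + 1 / Suc n" by blast
  then obtain P where "\<forall>n. P n \<in> \<Gamma> \<and> I (P n) < m + 1 / Suc n"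
    by (rule choice[THEN exE])
  then have P: "\<And>n. P n \<in> \<Gamma>" "\<And>n. I (P n) < m + 1 / Suc n" by auto
  define F where "F n = fst (P n)" for n
  define K where "K n = snd (P n)" for n
  have FK: "(F n, K n) \<in> \<Gamma>" for n using P(1) by (simp add: F_def K_def)
  \<comment> \<open>\<open>F n\<close> misses the infimum by less than 1 / (n + 1), so moving it by
    \<open>s * f\<close> gives a quadratic in \<open>s\<close> that is nonnegative up to this
    defect. Its discriminant bounds the error in the Euler-Lagrange equation.\<close>
  have near: "\<bar>(\<integral>x. F n x * f x \<partial>M) - k\<bar> \<le> sqrt (2 / Suc n) * l2n M f" if fk: "(f, k) \<in> \<Gamma>" for n f k
  proof -
    note Fs = sq[OF FK[of n]] and fs = sq[OF fk]
    have "0 \<le> (l2n M f)\<^sup>2 * s\<^sup>2 + 2 * ((\<integral>x. F n x * f x \<partial>M) - k) * s + 2 / Suc n" for s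
    proof -
      have "m \<le> I (\<lambda>x. 1 * F n x + s * f x, 1 * K n + s * k)"
        by (rule m_le[OF lin[OF FK fk]])
      also have "\<dots> = I (P n) + s * ((\<integral>x. F n x * f x \<partial>M) - k) + s\<^sup>2 * (l2n M f)\<^sup>2 / 2"
        unfolding I_def fst_conv snd_conv l2n_expand[OF Fs fs]
        by (simp add: F_def K_def field_simps)
      finally have "0 \<le> 1 / Suc n + s * ((\<integral>x. F n x * f x \<partial>M) - k) + s\<^sup>2 * (l2n M f)\<^sup>2 / 2"
        using P(2)[of n] by simp
      then show ?thesis by (simp add: field_simps)
    qed
    from quadratic_nonneg_discriminant[OF this] show ?thesis by (simp add: mult.commute)
  qed
  have conv: "(\<lambda>n. \<integral>x. F n x * f x \<partial>M) \<longlonglongrightarrow> k" if fk: "(f, k) \<in> \<Gamma>" for f k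
  proof (rule Lim_null[THEN iffD2], rule Lim_null_comparison)
    show "\<forall>\<^sub>F n in sequentially. norm ((\<integral>x. F n x * f x \<partial>M) - k) \<le> sqrt (2 / Suc n) * l2n M f"
      using near[OF fk] by simp
    have "(\<lambda>n. 2 * (1 / real (Suc n))) \<longlonglongrightarrow> 2 * 0"
      by (intro tendsto_intros LIMSEQ_inverse_real_of_nat[unfolded inverse_eq_divide])
    then have "(\<lambda>n. sqrt (2 * (1 / real (Suc n)))) \<longlonglongrightarrow> sqrt 0"
      by (intro tendsto_real_sqrt) simp
    then show "(\<lambda>n. sqrt (2 / Suc n) * l2n M f) \<longlonglongrightarrow> 0"
      by (intro tendsto_mult_left_zero) simp
  qed
  \<comment> \<open>Parallelogram identity: the midpoint of two near-minimizers cannot lie below the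
    infimum, which forces them to be close.\<close>
  have par: "(l2n M (\<lambda>x. F i x - F j x))\<^sup>2 \<le> 4 * (1 / Suc i + 1 / Suc j)" for i j
  proof -
    note si = sq[OF FK[of i]] and sj = sq[OF FK[of j]]
    have "m \<le> I (\<lambda>x. (1/2) * F i x + (1/2) * F j x, (1/2) * K i + (1/2) * K j)"
      by (rule m_le[OF lin[OF FK FK]])
    moreover have "(l2n M (\<lambda>x. F i x - F j x))\<^sup>2 / 8 =
       I (P i) / 2 + I (P j) / 2 - I (\<lambda>x. (1/2) * F i x + (1/2) * F j x, (1/2) * K i + (1/2) * K j)"
    proof -
      have e1: "(l2n M (\<lambda>x. F i x - F j x))\<^sup>2
          = (l2n M (F i))\<^sup>2 - 2 * (\<integral>x. F i x * F j x \<partial>M) + (l2n M (F j))\<^sup>2"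
        using l2n_expand[OF si sj, of 1 "-1"] by simp
      have e2: "(l2n M (\<lambda>x. (1/2) * F i x + (1/2) * F j x))\<^sup>2
          = (l2n M (F i))\<^sup>2 / 4 + (\<integral>x. F i x * F j x \<partial>M) / 2 + (l2n M (F j))\<^sup>2 / 4"
        using l2n_expand[OF si sj, of "1/2" "1/2"] by (simp add: power_divide)
      show ?thesis
        unfolding I_def fst_conv snd_conv e1 e2 by (simp add: F_def K_def field_simps)
    qed
    ultimately show ?thesis using P(2)[of i] P(2)[of j] by (simp only: distrib_left)
  qed
  have Cauchy: "\<exists>N. \<forall>m\<ge>N. \<forall>n\<ge>N. l2n M (\<lambda>x. F m x - F n x) < e" if "0 < e" for e
  proof -
    obtain N where N: "8 / e\<^sup>2 < real N" using reals_Archimedean2 by blast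
    have "l2n M (\<lambda>x. F i x - F j x) < e" if "N \<le> i" "N \<le> j" for i j
    proof (rule power2_less_imp_less)
      have "1 / Suc i \<le> 1 / Suc N" "1 / Suc j \<le> 1 / Suc N" using that by (auto simp: frac_le)
      then have "4 * (1 / Suc i + 1 / Suc j) \<le> 8 / Suc N" by simp
      also have "\<dots> < e\<^sup>2"
      proof -
        have "8 < e\<^sup>2 * real N" using N \<open>0 < e\<close> by (simp add: field_simps)
        also have "\<dots> \<le> e\<^sup>2 * real (Suc N)" by (intro mult_left_mono) auto
        finally show ?thesis by (simp add: field_simps)
      qed
      finally show "(l2n M (\<lambda>x. F i x - F j x))\<^sup>2 < e\<^sup>2" using par[of i j] by linarith
    qed (use \<open>0 < e\<close> in simp)
    then show ?thesis by blast
  qed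
  show ?thesis
    using FK Cauchy conv by (intro exI[of _ F] exI[of _ K]) auto
qed

text \<open>The limit of the minimizing sequence represents the functional but may lie outside the
  subspace. Where the representing function must have a prescribed form, as in
  \<open>optimality_system\<close>, the sequence itself is used instead.\<close>

corollary riesz_representation:
  fixes \<Gamma> :: "(('a \<Rightarrow> real) \<times> real) set"
  assumes M: "finite_measure M"
    and ne: "\<Gamma> \<noteq> {}" and sq: "\<And>f k. (f, k) \<in> \<Gamma> \<Longrightarrow> f \<in> sq_int M"
    and lin: "\<And>f k g l a b. (f, k) \<in> \<Gamma> \<Longrightarrow> (g, l) \<in> \<Gamma> \<Longrightarrow> (\<lambda>x. a * f x + b * g x, a * k + b * l) \<in> \<Gamma>"
    and bnd: "\<And>f k. (f, k) \<in> \<Gamma> \<Longrightarrow> \<bar>k\<bar> \<le> C * l2n M f"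
  obtains g where "g \<in> sq_int M" "\<And>f k. (f, k) \<in> \<Gamma> \<Longrightarrow> k = (\<integral>x. g x * f x \<partial>M)"
proof -
  have "\<exists>F K. (\<forall>n::nat. (F n, K n) \<in> \<Gamma>) \<and>
      (\<forall>e>0. \<exists>N. \<forall>m\<ge>N. \<forall>n\<ge>N. l2n M (\<lambda>x. F m x - F n x) < e) \<and>
      (\<forall>(f, k)\<in>\<Gamma>. (\<lambda>n. \<integral>x. F n x * f x \<partial>M) \<longlonglongrightarrow> k)"
    by (rule riesz_minimizing_sequence[OF ne sq lin bnd])
  then obtain F K where FK: "\<And>n::nat. (F n, K n) \<in> \<Gamma>"
    and Cau: "\<And>e. e > 0 \<Longrightarrow> \<exists>N. \<forall>m\<ge>N. \<forall>n\<ge>N. l2n M (\<lambda>x. F m x - F n x) < e"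
    and conv: "\<And>f k. (f, k) \<in> \<Gamma> \<Longrightarrow> (\<lambda>n. \<integral>x. F n x * f x \<partial>M) \<longlonglongrightarrow> k"
    by blast
  obtain g where g: "g \<in> sq_int M" "(\<lambda>n. l2n M (\<lambda>x. F n x - g x)) \<longlonglongrightarrow> 0"
    using sq_int_complete[OF M sq[OF FK] Cau] by auto
  have "k = (\<integral>x. g x * f x \<partial>M)" if "(f, k) \<in> \<Gamma>" for f k
    by (rule LIMSEQ_unique[OF conv[OF that] integral_mult_tendsto[OF sq[OF FK] g(1) sq[OF that] g(2)]])
  with g(1) show ?thesis by (rule that)
qed

section \<open>Lebesgue measure restricted to a set\<close>

abbreviation lborel_on :: "'a::euclidean_space set \<Rightarrow> 'a measure" where
  "lborel_on S \<equiv> restrict_space lborel S"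

abbreviation ivl :: "real \<Rightarrow> real \<Rightarrow> real measure" where
  "ivl a b \<equiv> lborel_on {a<..<b}"

lemma space_lborel_on [simp]: "space (lborel_on S) = S"
  by (simp add: space_restrict_space)

lemma set_integral_lborel_on:
  fixes f :: "'a::euclidean_space \<Rightarrow> real"
  assumes "S \<in> sets borel"
  shows "(LINT x:S|lborel. f x) = (\<integral>x. f x \<partial>lborel_on S)"
  unfolding set_lebesgue_integral_def using assms by (subst integral_restrict_space) auto

lemma set_integrable_lborel_on:
  fixes f :: "'a::euclidean_space \<Rightarrow> real"
  assumes "S \<in> sets borel"
  shows "set_integrable lborel S f \<longleftrightarrow> integrable (lborel_on S) f"
  unfolding set_integrable_def using assms by (subst integrable_restrict_space) auto

lemma set_borel_measurable_lborel_on: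
  fixes f :: "'a::euclidean_space \<Rightarrow> real"
  assumes "S \<in> sets borel"
  shows "set_borel_measurable lborel S f \<longleftrightarrow> f \<in> borel_measurable (lborel_on S)"
  unfolding set_borel_measurable_def using assms by (subst borel_measurable_restrict_space_iff) auto

lemma AE_lborel_on:
  assumes "S \<in> sets borel"
  shows "(AE x in lborel_on S. P x) \<longleftrightarrow> (AE x in lborel. x \<in> S \<longrightarrow> P x)"
  using assms by (intro AE_restrict_space_iff) auto

lemma L2_eq_sq_int: "S \<in> sets borel \<Longrightarrow> L2 S = sq_int (lborel_on S)"
  unfolding L2_def sq_int_def
  by (auto simp: set_borel_measurable_lborel_on set_integrable_lborel_on)

lemma L2_norm_eq_l2n: "S \<in> sets borel \<Longrightarrow> L2_norm S f = l2n (lborel_on S) f"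
  unfolding L2_norm_def l2n_def by (simp add: set_integral_lborel_on)

lemma finite_measure_lborel_on:
  assumes "bounded S" "S \<in> sets borel"
  shows "finite_measure (lborel_on S)"
proof (rule finite_measureI)
  have "emeasure (lborel_on S) S = emeasure lborel S"
    using assms by (subst emeasure_restrict_space) auto
  then show "emeasure (lborel_on S) (space (lborel_on S)) \<noteq> \<infinity>"
    using emeasure_bounded_finite[OF assms(1)] by simp
qed

lemma finite_measure_ivl [simp]: "finite_measure (ivl a b)"
  by (rule finite_measure_lborel_on) auto

lemma borel_measurable_lborel_on:
  fixes f :: "'a::euclidean_space \<Rightarrow> 'b::topological_space"
  assumes "f \<in> borel_measurable borel"
  shows "f \<in> borel_measurable (lborel_on S)"
  using assms by (intro measurable_restrict_space1) simp

lemma continuous_on_measurable_lborel_on: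
  fixes f :: "'a::euclidean_space \<Rightarrow> real"
  assumes "continuous_on S f"
  shows "f \<in> borel_measurable (lborel_on S)"
proof -
  have "borel_measurable (lborel_on S) = (borel_measurable (restrict_space borel S) :: ('a \<Rightarrow> real) set)"
    by (rule measurable_cong_sets) (simp_all only: sets_restrict_space sets_lborel)
  with borel_measurable_continuous_on_restrict[OF assms] show ?thesis by (simp only:)
qed

lemma continuous_sq_int_lborel_on:
  fixes f :: "'a::euclidean_space \<Rightarrow> real"
  assumes "continuous_on K f" "compact K" "S \<subseteq> K" "S \<in> sets borel"
  shows "f \<in> sq_int (lborel_on S)"
proof -
  have "bounded (f ` K)"
    by (rule compact_imp_bounded[OF compact_continuous_image[OF assms(1,2)]])
  then obtain B where B: "\<And>x. x \<in> K \<Longrightarrow> \<bar>f x\<bar> \<le> B"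
    by (auto simp: bounded_iff)
  show ?thesis
  proof (rule sq_int_bounded[where B = B])
    show "finite_measure (lborel_on S)"
      by (rule finite_measure_lborel_on[OF bounded_subset[OF compact_imp_bounded[OF assms(2)] assms(3)] assms(4)])
    show "f \<in> borel_measurable (lborel_on S)"
      by (rule continuous_on_measurable_lborel_on[OF continuous_on_subset[OF assms(1,3)]])
  qed (use B assms(3) in auto)
qed

lemma continuous_sq_int_ivl:
  fixes f :: "real \<Rightarrow> real"
  assumes "continuous_on {a..b} f"
  shows "f \<in> sq_int (ivl a b)"
  by (rule continuous_sq_int_lborel_on[OF assms]) auto

subsection \<open>Dense subsets of \<open>L\<^sup>2\<close>\<close>

definition l2_dense :: "'a measure \<Rightarrow> ('a \<Rightarrow> real) set \<Rightarrow> bool" where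
  "l2_dense M D \<longleftrightarrow> D \<subseteq> sq_int M \<and>
     (\<forall>f\<in>sq_int M. \<forall>e>0. \<exists>d\<in>D. l2n M (\<lambda>x. f x - d x) < e)"

lemma l2_denseD:
  assumes "l2_dense M D" "f \<in> sq_int M" "0 < e"
  shows "\<exists>d\<in>D. l2n M (\<lambda>x. f x - d x) < e"
  using assms unfolding l2_dense_def by blast

lemma l2_dense_sequence:
  assumes "l2_dense M D" "f \<in> sq_int M"
  obtains d :: "nat \<Rightarrow> 'a \<Rightarrow> real" where "\<And>n. d n \<in> D" "\<And>n. d n \<in> sq_int M"
    "(\<lambda>n. l2n M (\<lambda>x. d n x - f x)) \<longlonglongrightarrow> 0"
proof -
  have "\<forall>n. \<exists>d. d \<in> D \<and> l2n M (\<lambda>x. f x - d x) < inverse (Suc n)"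
  proof
    fix n
    have "0 < inverse (real (Suc n))" by simp
    then show "\<exists>d. d \<in> D \<and> l2n M (\<lambda>x. f x - d x) < inverse (Suc n)"
      using assms unfolding l2_dense_def by blast
  qed
  then obtain d where d: "\<forall>n. d n \<in> D \<and> l2n M (\<lambda>x. f x - d n x) < inverse (Suc n)"
    by (rule choice[THEN exE])
  have "(\<lambda>n. l2n M (\<lambda>x. d n x - f x)) \<longlonglongrightarrow> 0"
  proof (rule Lim_null_comparison[OF _ LIMSEQ_inverse_real_of_nat])
    show "\<forall>\<^sub>F n in sequentially. norm (l2n M (\<lambda>x. d n x - f x)) \<le> inverse (Suc n)"
      using d by (auto simp: l2n_minus_commute[of M _ f] intro!: always_eventually less_imp_le)
  qed
  then show ?thesis using d assms(1) by (intro that[of d]) (auto simp: l2_dense_def)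
qed

lemma l2_dense_orthogonal:
  assumes "l2_dense M D" "f \<in> sq_int M" "\<And>d. d \<in> D \<Longrightarrow> (\<integral>x. f x * d x \<partial>M) = 0"
  shows "AE x in M. f x = 0"
proof -
  obtain d where d: "\<And>n. d n \<in> D" "\<And>n. d n \<in> sq_int M"
    "(\<lambda>n. l2n M (\<lambda>x. d n x - f x)) \<longlonglongrightarrow> 0"
    using l2_dense_sequence[OF assms(1,2)] by blast
  have "(\<lambda>n. \<integral>x. d n x * f x \<partial>M) \<longlonglongrightarrow> (\<integral>x. f x * f x \<partial>M)"
    by (rule integral_mult_tendsto[OF d(2) assms(2,2) d(3)])
  moreover have "(\<integral>x. d n x * f x \<partial>M) = 0" for n
    using assms(3)[OF d(1)] by (simp add: mult.commute)
  ultimately have "(\<integral>x. f x * f x \<partial>M) = 0"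
    by (simp add: LIMSEQ_const_iff)
  then have "l2n M f = 0" by (simp add: l2n_def power2_eq_square)
  then show ?thesis by (rule l2n_eq_0_imp_AE[OF assms(2)])
qed

text \<open>Reduces approximating \<open>f\<close> to approximating the members of a sequence that
  converges to \<open>f\<close>, typically its truncations.\<close>

lemma l2_approx_step:
  assumes D: "D \<subseteq> sq_int M" and f: "f \<in> sq_int M"
    and F: "\<And>n::nat. F n \<in> sq_int M" "(\<lambda>n. l2n M (\<lambda>x. F n x - f x)) \<longlonglongrightarrow> 0"
    and apx: "\<And>n e. 0 < e \<Longrightarrow> \<exists>d\<in>D. l2n M (\<lambda>x. F n x - d x) < e"
    and e: "0 < e"
  shows "\<exists>d\<in>D. l2n M (\<lambda>x. f x - d x) < e"
proof -
  have "\<forall>\<^sub>F n in sequentially. l2n M (\<lambda>x. F n x - f x) < e / 2"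
    using order_tendstoD(2)[OF F(2), of "e / 2"] e by simp
  then obtain n where n: "l2n M (\<lambda>x. F n x - f x) < e / 2"
    by (auto simp: eventually_sequentially)
  obtain d where d: "d \<in> D" "l2n M (\<lambda>x. F n x - d x) < e / 2"
    using apx[of "e / 2" n] e by auto
  have "l2n M (\<lambda>x. f x - d x) \<le> l2n M (\<lambda>x. f x - F n x) + l2n M (\<lambda>x. F n x - d x)"
    using D d(1) f F(1) by (intro l2n_triangle3) auto
  also have "\<dots> < e"
    using n d(2) l2n_minus_commute[of M f "F n"] by simp
  finally show ?thesis using d(1) by blast
qed

text \<open>Approximate \<open>f / \<eta>\<close> from \<open>D\<close> and multiply back by the
  bounded weight. The quotient need not be square integrable, so \<open>f\<close> is first cut to
  the set where the weight exceeds 1 / (n + 1); what is lost tends to 0 because \<open>f\<close>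
  vanishes with the weight.\<close>

lemma l2_dense_weighted:
  assumes D: "l2_dense M D" and eta: "\<eta> \<in> borel_measurable M" "\<And>x. x \<in> space M \<Longrightarrow> 0 \<le> \<eta> x"
    "\<And>x. x \<in> space M \<Longrightarrow> \<eta> x \<le> B"
    and f: "f \<in> sq_int M" "\<And>x. x \<in> space M \<Longrightarrow> \<eta> x = 0 \<Longrightarrow> f x = 0" and e: "0 < e"
  shows "\<exists>d\<in>D. l2n M (\<lambda>x. f x - \<eta> x * d x) < e"
proof -
  have B: "\<bar>\<eta> x\<bar> \<le> \<bar>B\<bar> + 1" if "x \<in> space M" for x using eta(2,3)[OF that] by auto
  define F where "F n x = (if \<eta> x > inverse (Suc n) then f x else 0)" for n x
  have [measurable]: "f \<in> borel_measurable M" "\<eta> \<in> borel_measurable M" using f eta by auto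
  have Fm: "F n \<in> borel_measurable M" for n unfolding F_def by measurable
  have Fs: "F n \<in> sq_int M" for n
    by (rule sq_int_bound[OF f(1) Fm]) (auto simp: F_def)
  have lim: "(\<lambda>n. l2n M (\<lambda>x. F n x - f x)) \<longlonglongrightarrow> 0"
  proof (rule l2n_dominated[OF f(1) Fm])
    show "AE x in M. (\<lambda>n. F n x) \<longlonglongrightarrow> f x"
    proof (rule AE_I2)
      fix x assume x: "x \<in> space M"
      show "(\<lambda>n. F n x) \<longlonglongrightarrow> f x"
      proof (cases "\<eta> x = 0")
        case True
        then show ?thesis using f(2)[OF x True] by (simp add: F_def)
      next
        case False
        then have "\<eta> x > 0" using eta(2)[OF x] by simp
        then have "\<forall>\<^sub>F n in sequentially. inverse (real (Suc n)) < \<eta> x"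
          using order_tendstoD(2)[OF LIMSEQ_inverse_real_of_nat] by blast
        then have "\<forall>\<^sub>F n in sequentially. F n x = f x"
          by eventually_elim (simp add: F_def)
        then show ?thesis by (rule tendsto_eventually)
      qed
    qed
  qed (auto simp: F_def)
  have "\<exists>h\<in>(\<lambda>d x. \<eta> x * d x) ` D. l2n M (\<lambda>x. f x - h x) < e"
  proof (rule l2_approx_step[OF _ f(1) Fs lim _ e])
    show "(\<lambda>d x. \<eta> x * d x) ` D \<subseteq> sq_int M"
      using D B unfolding l2_dense_def by (auto intro!: sq_int_mult_bounded)
  next
    fix n and e' :: real assume e': "0 < e'"
    let ?g = "\<lambda>x. F n x / \<eta> x"
    have g: "?g \<in> sq_int M"
    proof (rule sq_int_bound[OF sq_int_cmult[OF Fs[of n], of "Suc n"]])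
      show "?g \<in> borel_measurable M" using Fm by measurable
      show "AE x in M. \<bar>?g x\<bar> \<le> \<bar>Suc n * F n x\<bar>"
      proof (rule AE_I2)
        fix x
        show "\<bar>?g x\<bar> \<le> \<bar>Suc n * F n x\<bar>"
        proof (cases "\<eta> x > inverse (Suc n)")
          case True
          have "inverse (real (Suc n)) > 0" by simp
          then have pos: "\<eta> x > 0" using True by linarith
          then have "1 / \<eta> x \<le> Suc n" using True by (simp add: field_simps)
          then have "\<bar>f x\<bar> * (1 / \<eta> x) \<le> \<bar>f x\<bar> * Suc n" by (intro mult_left_mono) auto
          then show ?thesis using pos True by (simp add: F_def abs_mult mult.commute)
        qed (simp add: F_def)
      qed
    qed
    have "0 < e' / (\<bar>B\<bar> + 1)" using e' by (intro divide_pos_pos add_nonneg_pos) auto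
    from l2_denseD[OF D g this] obtain d where d: "d \<in> D" "l2n M (\<lambda>x. ?g x - d x) < e' / (\<bar>B\<bar> + 1)"
      by blast
    have "l2n M (\<lambda>x. F n x - \<eta> x * d x) = l2n M (\<lambda>x. \<eta> x * (?g x - d x))"
    proof -
      have "F n x - \<eta> x * d x = \<eta> x * (?g x - d x)" for x
        by (cases "\<eta> x = 0") (simp_all add: F_def right_diff_distrib)
      then show ?thesis by (simp only:)
    qed
    also have "\<dots> \<le> (\<bar>B\<bar> + 1) * l2n M (\<lambda>x. ?g x - d x)"
      using D d(1) g B eta(1) by (intro l2n_mult_bounded sq_int_diff) (auto simp: l2_dense_def)
    also have "\<dots> < e'" using d(2) by (simp add: field_simps)
    finally show "\<exists>h\<in>(\<lambda>d x. \<eta> x * d x) ` D. l2n M (\<lambda>x. F n x - h x) < e'"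
      using d(1) by auto
  qed
  then show ?thesis by auto
qed

text \<open>Truncation reduces to bounded functions. A Lebesgue measurable function is an almost
  everywhere limit of continuous ones, and clamping these to the same bound allows dominated
  convergence.\<close>

lemma l2_dense_continuous:
  "l2_dense (ivl a b) {g. continuous_on UNIV g}"
  unfolding l2_dense_def
proof (intro conjI ballI allI impI subsetI)
  fix g :: "real \<Rightarrow> real" assume "g \<in> {g. continuous_on UNIV g}"
  then show "g \<in> sq_int (ivl a b)"
    by (intro continuous_sq_int_ivl) (auto intro: continuous_on_subset)
next
  fix f and e :: real assume f: "f \<in> sq_int (ivl a b)" and e: "0 < e"
  have [measurable]: "f \<in> borel_measurable (ivl a b)" using f by measurable
  define F where "F n x = max (- real n) (min (real n) (f x))" for n x
  have Fm [measurable]: "F n \<in> borel_measurable (ivl a b)" for n unfolding F_def by measurable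
  have Fs: "F n \<in> sq_int (ivl a b)" for n
    by (rule sq_int_bound[OF f Fm]) (auto simp: F_def)
  have lim: "(\<lambda>n. l2n (ivl a b) (\<lambda>x. F n x - f x)) \<longlonglongrightarrow> 0"
  proof (rule l2n_dominated[OF f Fm])
    show "AE x in ivl a b. (\<lambda>n. F n x) \<longlonglongrightarrow> f x"
    proof (rule AE_I2)
      fix x
      obtain N :: nat where N: "\<bar>f x\<bar> \<le> real N" using real_arch_simple by blast
      have "\<forall>\<^sub>F n in sequentially. F n x = f x"
      proof (rule eventually_sequentiallyI)
        fix n assume "N \<le> n"
        then have "\<bar>f x\<bar> \<le> real n" using N by linarith
        then show "F n x = f x" by (auto simp: F_def)
      qed
      then show "(\<lambda>n. F n x) \<longlonglongrightarrow> f x" by (rule tendsto_eventually)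
    qed
  qed (auto simp: F_def)
  show "\<exists>d\<in>{g. continuous_on UNIV g}. l2n (ivl a b) (\<lambda>x. f x - d x) < e"
  proof (rule l2_approx_step[OF _ f Fs lim _ e])
    show "{g. continuous_on UNIV g} \<subseteq> sq_int (ivl a b)"
      by (auto intro!: continuous_sq_int_ivl intro: continuous_on_subset)
  next
    fix n and e' :: real assume e': "0 < e'"
    define B where "B = real n"
    define H where "H x = indicator {a<..<b} x *\<^sub>R F n x" for x
    have "H \<in> borel_measurable lborel"
      unfolding H_def using Fm[of n] by (subst (asm) borel_measurable_restrict_space_iff) auto
    then have "H \<in> borel_measurable lebesgue" by (rule measurable_completion)
    then have "H measurable_on UNIV" by (intro lebesgue_measurable_imp_measurable_on_real) auto
    then obtain N g where N: "negligible N" and g: "\<And>k. continuous_on UNIV (g k)"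
      "\<And>x. x \<notin> N \<Longrightarrow> (\<lambda>k. g k x) \<longlonglongrightarrow> H x"
      unfolding measurable_on_def by auto
    define G where "G k x = max (- B) (min B (g k x))" for k x
    have Gc: "continuous_on UNIV (G k)" for k
      unfolding G_def using g(1)[of k] by (intro continuous_intros)
    have "AE x in lebesgue. x \<notin> N"
      using N by (intro AE_not_in) (simp add: negligible_iff_null_sets)
    then have AEN: "AE x in lborel. x \<notin> N" by (simp add: AE_completion_iff)
    have HB: "max (- B) (min B (H x)) = H x" for x
      unfolding H_def F_def B_def by (auto simp: indicator_def)
    have HF: "H x = F n x" if "x \<in> {a<..<b}" for x using that by (simp add: H_def)
    have Gs: "G k \<in> sq_int (ivl a b)" for k
      using Gc[of k] by (intro continuous_sq_int_ivl) (auto intro: continuous_on_subset)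
    have "(\<lambda>k. l2n (ivl a b) (\<lambda>x. G k x - F n x)) \<longlonglongrightarrow> 0"
    proof (rule l2n_dominated)
      show "(\<lambda>x. 2 * B) \<in> sq_int (ivl a b)" by (intro continuous_sq_int_ivl continuous_intros)
      show "G k \<in> borel_measurable (ivl a b)" for k using Gs by measurable
      show "AE x in ivl a b. (\<lambda>k. G k x) \<longlonglongrightarrow> F n x"
        using AEN
      proof (subst AE_lborel_on, simp, eventually_elim, intro impI)
        fix x assume x: "x \<notin> N" "x \<in> {a<..<b}"
        have "(\<lambda>k. G k x) \<longlonglongrightarrow> max (- B) (min B (H x))"
          unfolding G_def by (intro tendsto_intros g(2) x)
        with HB[of x] have "(\<lambda>k. G k x) \<longlonglongrightarrow> H x" by (simp only:)
        with HF[OF x(2)] show "(\<lambda>k. G k x) \<longlonglongrightarrow> F n x" by (simp only:)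
      qed
      show "AE x in ivl a b. \<bar>G k x - F n x\<bar> \<le> \<bar>2 * B\<bar>" for k
        by (rule AE_I2) (auto simp: G_def F_def B_def)
    qed simp
    then have "\<forall>\<^sub>F k in sequentially. l2n (ivl a b) (\<lambda>x. G k x - F n x) < e'"
      using order_tendstoD(2) e' by blast
    then obtain k where "l2n (ivl a b) (\<lambda>x. G k x - F n x) < e'"
      by (auto simp: eventually_sequentially)
    then show "\<exists>d\<in>{g. continuous_on UNIV g}. l2n (ivl a b) (\<lambda>x. F n x - d x) < e'"
      using Gc[of k] by (auto simp: l2n_minus_commute[of _ "F n"])
  qed
qed

text \<open>\<open>r\<close> inverts \<open>s\<close>, so a continuous \<open>g\<close> equals
  \<open>g \<circ> r\<close> evaluated at \<open>s x\<close>, and Weierstrass replaces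
  \<open>g \<circ> r\<close> by a polynomial. The useful instance is
  \<open>s x = cos (pi * x)\<close>.\<close>

lemma l2_dense_poly_comp:
  fixes r s :: "real \<Rightarrow> real"
  assumes r: "continuous_on {c..d} r" and s: "continuous_on UNIV s"
    and rs: "\<And>x. x \<in> {a..b} \<Longrightarrow> s x \<in> {c..d}" "\<And>x. x \<in> {a..b} \<Longrightarrow> r (s x) = x"
  shows "l2_dense (ivl a b) (range (\<lambda>p x. poly p (s x)))"
  unfolding l2_dense_def
proof (intro conjI ballI allI impI)
  show sub: "range (\<lambda>p x. poly p (s x)) \<subseteq> sq_int (ivl a b)"
    using s by (auto intro!: continuous_sq_int_ivl continuous_intros intro: continuous_on_subset)
  fix f and e :: real assume f: "f \<in> sq_int (ivl a b)" and e: "0 < e"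
  from l2_denseD[OF l2_dense_continuous f half_gt_zero[OF e]]
  obtain g where g: "continuous_on UNIV g" "l2n (ivl a b) (\<lambda>x. f x - g x) < e / 2"
    by blast
  define m where "m = sqrt (measure (ivl a b) {a<..<b})"
  have m: "0 \<le> m" by (simp add: m_def)
  \<comment> \<open>The 1 added to \<open>m\<close> keeps the denominator positive when the interval
    is empty and makes \<open>e' * m\<close> strictly less than \<open>e / 2\<close>.\<close>
  define e' where "e' = e / (2 * (m + 1))"
  have e': "0 < e'" using e m by (simp add: e'_def)
  have "continuous_on {c..d} (\<lambda>y. g (r y))"
    using continuous_on_compose2[OF g(1) r] by simp
  then obtain q where q: "real_polynomial_function q" "\<And>y. y \<in> {c..d} \<Longrightarrow> \<bar>g (r y) - q y\<bar> < e'"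
    using Stone_Weierstrass_real_polynomial_function[of "{c..d}" "\<lambda>y. g (r y)" e'] e' by auto
  obtain A n where A: "q = (\<lambda>x. \<Sum>i\<le>n. A i * x^i)"
    using q(1) real_polynomial_function_iff_sum by auto
  define p where "p = (\<Sum>i\<le>n. monom (A i) i)"
  have p: "poly p x = q x" for x by (simp add: p_def A poly_sum poly_monom)
  have gs: "g \<in> sq_int (ivl a b)"
    using g(1) by (intro continuous_sq_int_ivl) (auto intro: continuous_on_subset)
  have ps: "(\<lambda>x. poly p (s x)) \<in> sq_int (ivl a b)" using sub by auto
  have "l2n (ivl a b) (\<lambda>x. g x - poly p (s x)) \<le> e' * m"
  proof -
    have "l2n (ivl a b) (\<lambda>x. g x - poly p (s x)) \<le> e' * sqrt (measure (ivl a b) (space (ivl a b)))"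
    proof (rule l2n_le_bound)
      show "(\<lambda>x. g x - poly p (s x)) \<in> borel_measurable (ivl a b)"
        using sq_int_diff[OF gs ps] by measurable
      show "\<bar>g x - poly p (s x)\<bar> \<le> e'" if "x \<in> space (ivl a b)" for x
        using q(2)[of "s x"] rs[of x] that by (simp add: p)
    qed (use e' in auto)
    then show ?thesis by (simp add: m_def)
  qed
  also have "e' * m < e / 2"
    using e m by (simp add: e'_def field_simps)
  finally have "l2n (ivl a b) (\<lambda>x. f x - poly p (s x)) < e"
    using l2n_triangle3[OF f gs ps] g(2) by simp
  then show "\<exists>d\<in>range (\<lambda>p x. poly p (s x)). l2n (ivl a b) (\<lambda>x. f x - d x) < e" by auto
qed

lemma l2_dense_poly: "l2_dense (ivl a b) (range poly)"
  using l2_dense_poly_comp[of a b "\<lambda>x. x" "\<lambda>x. x" a b] by auto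

subsection \<open>Test functions and primitives\<close>

lemma C1c_I:
  assumes "\<And>x. (\<psi> has_real_derivative \<psi>' x) (at x)" "continuous_on UNIV \<psi>'"
    and "a < c" "d < b" "\<And>x. x \<notin> {c..d} \<Longrightarrow> \<psi> x = 0"
  shows "\<psi> \<in> C1c a b" "deriv \<psi> = \<psi>'"
proof -
  have "\<psi> C1_differentiable_on UNIV"
    unfolding C1_differentiable_on_def using assms(1,2)
    by (intro exI[of _ \<psi>']) (auto simp: has_real_derivative_iff_has_vector_derivative)
  then show "\<psi> \<in> C1c a b" unfolding C1c_def using assms(3-5) by blast
  show "deriv \<psi> = \<psi>'" using DERIV_imp_deriv[OF assms(1)] by blast
qed

lemma C1c_D:
  assumes "\<psi> \<in> C1c a b"
  shows "(\<psi> has_real_derivative deriv \<psi> x) (at x)" "continuous_on UNIV (deriv \<psi>)"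
    "continuous_on UNIV \<psi>" "x \<le> a \<or> b \<le> x \<Longrightarrow> \<psi> x = 0"
proof -
  obtain D where D: "\<And>x. (\<psi> has_vector_derivative D x) (at x)" "continuous_on UNIV D"
    using assms unfolding C1c_def C1_differentiable_on_def by auto
  have *: "(\<psi> has_real_derivative D x) (at x)" for x
    using D(1) by (simp add: has_real_derivative_iff_has_vector_derivative)
  have "deriv \<psi> = D" using DERIV_imp_deriv[OF *] by blast
  then show "(\<psi> has_real_derivative deriv \<psi> x) (at x)" "continuous_on UNIV (deriv \<psi>)"
    using * D(2) by auto
  show "continuous_on UNIV \<psi>" using * DERIV_isCont continuous_at_imp_continuous_on by blast
  obtain c d where "a < c" "d < b" "\<And>x. x \<notin> {c..d} \<Longrightarrow> \<psi> x = 0"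
    using assms unfolding C1c_def by blast
  then show "x \<le> a \<or> b \<le> x \<Longrightarrow> \<psi> x = 0" by auto
qed

lemma C1c_sq_int: "\<psi> \<in> C1c a b \<Longrightarrow> \<psi> \<in> sq_int (ivl a b)"
  using C1c_D(3) by (intro continuous_sq_int_ivl) (auto intro: continuous_on_subset)

lemma C1c_deriv_sq_int: "\<psi> \<in> C1c a b \<Longrightarrow> deriv \<psi> \<in> sq_int (ivl a b)"
  using C1c_D(2) by (intro continuous_sq_int_ivl) (auto intro: continuous_on_subset)

text \<open>Squaring removes the corner of the positive part at 0. This is the elementary bump used
  for test functions of class C^1.\<close>

lemma DERIV_max_0_power2: "((\<lambda>x. (max 0 x)\<^sup>2) has_real_derivative 2 * max 0 x) (at x)" for x :: real
proof -
  consider "x > 0" | "x < 0" | "x = 0" by linarith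
  then show ?thesis
  proof cases
    case 1
    have "((\<lambda>x. x\<^sup>2) has_real_derivative 2 * max 0 x) (at x)"
      using 1 by (auto intro!: derivative_eq_intros)
    then show ?thesis
      by (rule has_field_derivative_transform_within_open[where S = "{0<..}"]) (use 1 in auto)
  next
    case 2
    have "((\<lambda>x. 0) has_real_derivative 2 * max 0 x) (at x)"
      using 2 by (auto intro!: derivative_eq_intros)
    then show ?thesis
      by (rule has_field_derivative_transform_within_open[where S = "{..<0}"]) (use 2 in auto)
  next
    case 3
    have "((\<lambda>y. (max 0 y)\<^sup>2 / y) \<longlongrightarrow> 0) (at (0::real))"
    proof (rule Lim_null_comparison)
      show "\<forall>\<^sub>F y in at 0. norm ((max 0 y)\<^sup>2 / y) \<le> \<bar>y::real\<bar>"
        by (rule always_eventually) (auto simp: max_def power2_eq_square)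
      show "((\<lambda>y. \<bar>y::real\<bar>) \<longlongrightarrow> 0) (at 0)"
        by (rule tendsto_rabs_zero) (rule tendsto_ident_at)
    qed
    then show ?thesis using 3 by (simp add: has_field_derivative_iff)
  qed
qed

lemma C1c_bump_poly:
  assumes "0 < \<epsilon>"
  shows "(\<lambda>x. (max 0 (x - a - \<epsilon>))\<^sup>2 * (max 0 (b - \<epsilon> - x))\<^sup>2 * poly p x) \<in> C1c a b"
proof -
  let ?A = "\<lambda>x. (max 0 (x - a - \<epsilon>))\<^sup>2" and ?B = "\<lambda>x. (max 0 (b - \<epsilon> - x))\<^sup>2"
  have A: "(?A has_real_derivative 2 * max 0 (x - a - \<epsilon>) * 1) (at x)" for x
    by (rule DERIV_chain2[OF DERIV_max_0_power2]) (auto intro!: derivative_eq_intros)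
  have B: "(?B has_real_derivative 2 * max 0 (b - \<epsilon> - x) * (-1)) (at x)" for x
    by (rule DERIV_chain2[OF DERIV_max_0_power2]) (auto intro!: derivative_eq_intros)
  show ?thesis
  proof (rule C1c_I(1))
    show "((\<lambda>x. ?A x * ?B x * poly p x) has_real_derivative
      ((2 * max 0 (x - a - \<epsilon>) * 1) * ?B x + (2 * max 0 (b - \<epsilon> - x) * (-1)) * ?A x) * poly p x
      + poly (pderiv p) x * (?A x * ?B x)) (at x)" for x
      by (rule DERIV_mult[OF DERIV_mult[OF A B] poly_DERIV])
    show "continuous_on UNIV (\<lambda>x. ((2 * max 0 (x - a - \<epsilon>) * 1) * ?B x
      + (2 * max 0 (b - \<epsilon> - x) * (-1)) * ?A x) * poly p x + poly (pderiv p) x * (?A x * ?B x))"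
      by (intro continuous_intros)
    show "a < a + \<epsilon>" "b - \<epsilon> < b" using assms by auto
  qed auto
qed

text \<open>Polynomials are dense, and multiplying them by a bump supported in
  [a + 1/(n+1), b - 1/(n+1)] makes them test functions; \<open>l2_dense_weighted\<close> says which
  functions this product still reaches.\<close>

lemma l2_dense_C1c: "l2_dense (ivl a b) (C1c a b)"
  unfolding l2_dense_def
proof (intro conjI ballI allI impI)
  show sub: "C1c a b \<subseteq> sq_int (ivl a b)" using C1c_sq_int by blast
  fix f and e :: real assume f: "f \<in> sq_int (ivl a b)" and e: "0 < e"
  have [measurable]: "f \<in> borel_measurable (ivl a b)" using f by measurable
  define \<epsilon> where "\<epsilon> n = inverse (real (Suc n))" for n
  define \<eta> where "\<eta> n x = (max 0 (x - a - \<epsilon> n))\<^sup>2 * (max 0 (b - \<epsilon> n - x))\<^sup>2" for n x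
  have \<epsilon>: "0 < \<epsilon> n" for n by (simp add: \<epsilon>_def)
  have \<eta>c: "continuous_on {a<..<b} (\<eta> n)" for n unfolding \<eta>_def by (intro continuous_intros)
  have \<eta>m [measurable]: "\<eta> n \<in> borel_measurable (ivl a b)" for n
    by (rule continuous_on_measurable_lborel_on[OF \<eta>c])
  define F where "F n x = (if \<eta> n x = 0 then 0 else f x)" for n x
  have Fm: "F n \<in> borel_measurable (ivl a b)" for n
    unfolding F_def by measurable
  have Fs: "F n \<in> sq_int (ivl a b)" for n
    by (rule sq_int_bound[OF f Fm]) (auto simp: F_def)
  have lim: "(\<lambda>n. l2n (ivl a b) (\<lambda>x. F n x - f x)) \<longlonglongrightarrow> 0"
  proof (rule l2n_dominated[OF f Fm])
    show "AE x in ivl a b. (\<lambda>n. F n x) \<longlonglongrightarrow> f x"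
    proof (rule AE_I2)
      fix x assume "x \<in> space (ivl a b)"
      then have "0 < min (x - a) (b - x)" by simp
      then have "\<forall>\<^sub>F n in sequentially. \<epsilon> n < min (x - a) (b - x)"
        unfolding \<epsilon>_def using order_tendstoD(2)[OF LIMSEQ_inverse_real_of_nat] by blast
      then have "\<forall>\<^sub>F n in sequentially. F n x = f x"
        by eventually_elim (simp add: F_def \<eta>_def)
      then show "(\<lambda>n. F n x) \<longlonglongrightarrow> f x" by (rule tendsto_eventually)
    qed
  qed (auto simp: F_def)
  show "\<exists>d\<in>C1c a b. l2n (ivl a b) (\<lambda>x. f x - d x) < e"
  proof (rule l2_approx_step[OF sub f Fs lim _ e])
    fix n and e' :: real assume e': "0 < e'"
    have "\<exists>d\<in>range poly. l2n (ivl a b) (\<lambda>x. F n x - \<eta> n x * d x) < e'"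
    proof (rule l2_dense_weighted[OF l2_dense_poly \<eta>m _ _ Fs _ e'])
      show "0 \<le> \<eta> n x" for x by (simp add: \<eta>_def)
      show "\<eta> n x = 0 \<Longrightarrow> F n x = 0" for x by (simp add: F_def)
      show "\<eta> n x \<le> (b - a)\<^sup>2 * (b - a)\<^sup>2" if "x \<in> space (ivl a b)" for x
        unfolding \<eta>_def using that \<epsilon>[of n] by (intro mult_mono power_mono) auto
    qed
    then obtain p where "l2n (ivl a b) (\<lambda>x. F n x - \<eta> n x * poly p x) < e'" by blast
    moreover have "(\<lambda>x. \<eta> n x * poly p x) \<in> C1c a b"
      unfolding \<eta>_def by (rule C1c_bump_poly[OF \<epsilon>])
    ultimately show "\<exists>d\<in>C1c a b. l2n (ivl a b) (\<lambda>x. F n x - d x) < e'"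
      by (rule bexI[where x = "\<lambda>x. \<eta> n x * poly p x"])
  qed
qed

text \<open>Integrating a cut-off integrand over the whole interval defines the primitive on the
  whole line: it is 0 to the left of \<open>a\<close> and constant to the right of \<open>b\<close>.
  This also makes Fubini directly applicable.\<close>

definition primitive :: "real \<Rightarrow> real \<Rightarrow> (real \<Rightarrow> real) \<Rightarrow> real \<Rightarrow> real" where
  "primitive a b g x = (\<integral>y. (if y < x then g y else 0) \<partial>ivl a b)"

lemma ident_measurable_lborel_on: "(\<lambda>x. x) \<in> borel_measurable (lborel_on S)"
  by (rule borel_measurable_lborel_on) simp

lemma integrable_cut:
  fixes g :: "real \<Rightarrow> real"
  assumes "integrable (ivl a b) g"
  shows "integrable (ivl a b) (\<lambda>y. if y < x then g y else 0)"
proof (rule Bochner_Integration.integrable_bound[OF assms])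
  note [measurable] = ident_measurable_lborel_on
  have [measurable]: "g \<in> borel_measurable (ivl a b)" using assms by auto
  show "(\<lambda>y. if y < x then g y else 0) \<in> borel_measurable (ivl a b)" by measurable
qed auto

lemma primitive_diff:
  assumes "integrable (ivl a b) g" "integrable (ivl a b) h"
  shows "primitive a b g x - primitive a b h x = primitive a b (\<lambda>y. g y - h y) x"
  unfolding primitive_def using assms
  by (subst Bochner_Integration.integral_diff[symmetric])
     (auto intro!: integrable_cut Bochner_Integration.integral_cong)

lemma abs_primitive_le:
  assumes "g \<in> sq_int (ivl a b)"
  shows "\<bar>primitive a b g x\<bar> \<le> sqrt (measure (ivl a b) {a<..<b}) * l2n (ivl a b) g"
proof -
  note [measurable] = ident_measurable_lborel_on
  have gm [measurable]: "g \<in> borel_measurable (ivl a b)" using assms by measurable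
  let ?I = "\<lambda>y. if y < x then 1 else 0 :: real"
  have I: "?I \<in> sq_int (ivl a b)" by (rule sq_int_bounded[where B = 1]) auto
  have "primitive a b g x = (\<integral>y. ?I y * g y \<partial>ivl a b)"
    unfolding primitive_def by (intro Bochner_Integration.integral_cong) auto
  also have "\<bar>\<dots>\<bar> \<le> l2n (ivl a b) ?I * l2n (ivl a b) g"
    by (rule l2n_Cauchy_Schwarz[OF I assms])
  also have "\<dots> \<le> (1 * sqrt (measure (ivl a b) (space (ivl a b)))) * l2n (ivl a b) g"
    by (intro mult_right_mono l2n_le_bound) auto
  finally show ?thesis by simp
qed

lemma primitive_measurable:
  assumes [measurable]: "g \<in> borel_measurable (ivl a b)"
  shows "primitive a b g \<in> borel_measurable borel"
proof -
  note [measurable] = ident_measurable_lborel_on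
  interpret finite_measure "ivl a b" by simp
  show ?thesis
    unfolding primitive_def [abs_def] by (intro borel_measurable_lebesgue_integral) measurable
qed

lemma primitive_sq_int:
  assumes "g \<in> sq_int (ivl a b)"
  shows "primitive a b g \<in> sq_int (ivl a b)"
  by (rule sq_int_bounded[OF finite_measure_ivl
        borel_measurable_lborel_on[OF primitive_measurable] abs_primitive_le])
     (use assms in auto)

lemma l2n_primitive_le:
  assumes "g \<in> sq_int (ivl a b)"
  shows "l2n (ivl a b) (primitive a b g) \<le> measure (ivl a b) {a<..<b} * l2n (ivl a b) g"
proof -
  have "l2n (ivl a b) (primitive a b g) \<le> (sqrt (measure (ivl a b) {a<..<b}) * l2n (ivl a b) g) *
    sqrt (measure (ivl a b) (space (ivl a b)))"
    by (rule l2n_le_bound[OF finite_measure_ivl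
        borel_measurable_lborel_on[OF primitive_measurable] abs_primitive_le])
       (use assms in auto)
  then show ?thesis by (simp add: mult_ac)
qed

lemma primitive_deriv:
  assumes F: "\<And>x. x \<in> {a..b} \<Longrightarrow> (F has_real_derivative g x) (at x within {a..b})"
    and g: "continuous_on {a..b} g" and x: "x \<in> {a..b}"
  shows "primitive a b g x = F x - F a"
proof -
  have "(g has_integral F x - F a) {a..x}"
    using x by (intro fundamental_theorem_of_calculus)
      (auto simp flip: has_real_derivative_iff_has_vector_derivative intro!: DERIV_subset[OF F])
  then have 1: "integral {a<..<x} g = F x - F a"
    by (simp add: integral_unique flip: integral_open_interval_real)
  have "g \<in> sq_int (ivl a x)"
    using x by (intro continuous_sq_int_ivl continuous_on_subset[OF g]) auto
  then have "set_integrable lborel {a<..<x} g"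
    by (simp add: set_integrable_lborel_on sq_int_imp_integrable)
  then have "(LINT y:{a<..<x}|lborel. g y) = integral {a<..<x} g"
    by (rule set_borel_integral_eq_integral)
  moreover have "primitive a b g x = (LINT y:{a<..<x}|lborel. g y)"
    unfolding primitive_def set_lebesgue_integral_def using x
    by (subst integral_restrict_space)
      (auto intro!: Bochner_Integration.integral_cong simp: indicator_def)
  ultimately show ?thesis using 1 by simp
qed

lemma integral_eq_primitive: "(\<integral>y. g y \<partial>ivl a b) = primitive a b g b"
  unfolding primitive_def by (intro Bochner_Integration.integral_cong) auto

lemma C1c_primitive:
  assumes "\<psi> \<in> C1c a b"
  shows "x \<in> {a..b} \<Longrightarrow> primitive a b (deriv \<psi>) x = \<psi> x"
    "a \<le> b \<Longrightarrow> (\<integral>y. deriv \<psi> y \<partial>ivl a b) = 0"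
proof -
  have *: "primitive a b (deriv \<psi>) x = \<psi> x - \<psi> a" if "x \<in> {a..b}" for x
    using C1c_D(1,2)[OF assms] that
    by (intro primitive_deriv) (auto intro: DERIV_subset continuous_on_subset)
  show "x \<in> {a..b} \<Longrightarrow> primitive a b (deriv \<psi>) x = \<psi> x"
    using * C1c_D(4)[OF assms, of a] by simp
  show "a \<le> b \<Longrightarrow> (\<integral>y. deriv \<psi> y \<partial>ivl a b) = 0"
    using *[of b] C1c_D(4)[OF assms, of a] C1c_D(4)[OF assms, of b]
    by (simp add: integral_eq_primitive)
qed

text \<open>The primitive of \<open>k\<close> is constant beyond the support of \<open>k\<close>,
  with value the total integral; mean zero is exactly what makes it compactly supported.\<close>

lemma C1c_antideriv:
  assumes k: "k \<in> C1c a b" and k0: "(\<integral>y. k y \<partial>ivl a b) = 0"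
  shows "\<exists>\<psi>\<in>C1c a b. deriv \<psi> = k"
proof (cases "\<exists>x. k x \<noteq> 0")
  case True
  obtain c d where cd: "a < c" "d < b" "\<And>x. x \<notin> {c..d} \<Longrightarrow> k x = 0"
    using k unfolding C1c_def by blast
  have ord: "a < d" "a < b" using True cd by force+
  note kc = C1c_D(3)[OF k]
  define \<psi> where "\<psi> x = integral {a..x} k" for x
  have low: "\<psi> x = 0" if "x < c" for x
    unfolding \<psi>_def by (rule integral_unique[OF has_integral_is_0]) (use that cd in auto)
  have der: "(\<psi> has_real_derivative k x) (at x)" for x
  proof (cases "x < c")
    case True
    have "((\<lambda>x. 0) has_real_derivative k x) (at x)" using cd(3)[of x] True by simp
    then show ?thesis
      by (rule has_field_derivative_transform_within_open[where S = "{..<c}"])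
        (use True low in auto)
  next
    case False
    then have x: "x \<in> {a<..<x + 1}" using cd by auto
    have "(\<psi> has_real_derivative k x) (at x within {a..x + 1})"
      unfolding \<psi>_def using x
      by (intro integral_has_real_derivative continuous_on_subset[OF kc]) auto
    then show ?thesis
      using x by (simp add: at_within_Icc_at)
  qed
  have prim: "primitive a b k x = \<psi> x" if "x \<in> {a..b}" for x
  proof -
    have "primitive a b k x = \<psi> x - \<psi> a"
      by (rule primitive_deriv[OF _ _ that]) (auto intro: DERIV_subset[OF der] continuous_on_subset[OF kc])
    then show ?thesis by (simp add: \<psi>_def)
  qed
  \<comment> \<open>To the right of the support the primitive is constant, and at \<open>b\<close>
    it equals the integral of \<open>k\<close>.\<close>
  have high: "\<psi> x = 0" if "d < x" for x
  proof -
    have "\<psi> x = \<psi> b"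
    proof (rule DERIV_isconst3[where f = \<psi> and a = d and b = "max x b + 1"])
      show "(\<psi> has_real_derivative 0) (at y)" if "y \<in> {d<..<max x b + 1}" for y
        using der[of y] cd(3)[of y] that by auto
    qed (use that cd in auto)
    also have "\<psi> b = 0" using prim[of b] ord k0 by (simp add: integral_eq_primitive)
    finally show ?thesis .
  qed
  have "\<psi> x = 0" if "x \<notin> {c..d}" for x
    using that low[of x] high[of x] by (cases "x < c") auto
  from C1c_I[OF der kc cd(1,2) this] show ?thesis by blast
next
  case False
  then have "k = (\<lambda>x. 0)" by auto
  then have "deriv k = k" by simp
  then show ?thesis using k by blast
qed

text \<open>Fubini on the two triangles of the square.\<close>

lemma primitive_parts:
  assumes f: "integrable (ivl a b) f" and g: "integrable (ivl a b) g"
  shows "integrable (ivl a b) (\<lambda>x. primitive a b f x * g x)"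
    "(\<integral>x. primitive a b f x * g x \<partial>ivl a b) + (\<integral>x. f x * primitive a b g x \<partial>ivl a b)
      = (\<integral>x. f x \<partial>ivl a b) * (\<integral>x. g x \<partial>ivl a b)"
proof -
  note [measurable] = ident_measurable_lborel_on
  let ?M = "ivl a b"
  interpret M: finite_measure ?M by simp
  interpret P: pair_sigma_finite ?M ?M ..
  have [measurable]: "f \<in> borel_measurable ?M" "g \<in> borel_measurable ?M" using f g by auto
  have prod: "integrable (?M \<Otimes>\<^sub>M ?M) (\<lambda>(x, y). f x * g y)"
  proof (rule P.Fubini_integrable)
    show "integrable ?M (\<lambda>x. \<integral>y. norm (case (x, y) of (x, y) \<Rightarrow> f x * g y) \<partial>?M)"
      using f by (simp add: abs_mult)
    show "AE x in ?M. integrable ?M (\<lambda>y. case (x, y) of (x, y) \<Rightarrow> f x * g y)"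
      using g by simp
  qed measurable
  have L: "integrable (?M \<Otimes>\<^sub>M ?M) (\<lambda>(x, y). if x < y then f x * g y else 0)"
    by (rule Bochner_Integration.integrable_bound[OF prod]) auto
  have U: "integrable (?M \<Otimes>\<^sub>M ?M) (\<lambda>(x, y). if y < x then f x * g y else 0)"
    by (rule Bochner_Integration.integrable_bound[OF prod]) auto
  have fg: "(\<integral>x. (if x < y then f x * g y else 0) \<partial>?M) = primitive a b f y * g y" for y
  proof -
    have "(\<integral>x. (if x < y then f x * g y else 0) \<partial>?M) = (\<integral>x. (if x < y then f x else 0) * g y \<partial>?M)"
      by (intro Bochner_Integration.integral_cong) auto
    then show ?thesis by (simp add: primitive_def)
  qed
  have gf: "(\<integral>y. (if y < x then f x * g y else 0) \<partial>?M) = f x * primitive a b g x" for x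
  proof -
    have "(\<integral>y. (if y < x then f x * g y else 0) \<partial>?M) = (\<integral>y. f x * (if y < x then g y else 0) \<partial>?M)"
      by (intro Bochner_Integration.integral_cong) auto
    then show ?thesis by (simp add: primitive_def)
  qed
  show "integrable ?M (\<lambda>x. primitive a b f x * g x)"
    using P.integrable_snd[OF L] by (simp add: fg)
  have 1: "(\<integral>y. primitive a b f y * g y \<partial>?M) = integral\<^sup>L (?M \<Otimes>\<^sub>M ?M) (\<lambda>(x, y). if x < y then f x * g y else 0)"
    using P.integral_snd[OF L] by (simp add: fg)
  have 2: "(\<integral>x. f x * primitive a b g x \<partial>?M) = integral\<^sup>L (?M \<Otimes>\<^sub>M ?M) (\<lambda>(x, y). if y < x then f x * g y else 0)"
    using P.integral_fst[OF U] by (simp add: gf)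
  have "(\<integral>x. f x \<partial>?M) * (\<integral>x. g x \<partial>?M) = (\<integral>y. (\<integral>x. f x * g y \<partial>?M) \<partial>?M)" by simp
  also have "\<dots> = integral\<^sup>L (?M \<Otimes>\<^sub>M ?M) (\<lambda>(x, y). f x * g y)"
    by (rule P.integral_snd[OF prod])
  also have "\<dots> = integral\<^sup>L (?M \<Otimes>\<^sub>M ?M)
      (\<lambda>p. (case p of (x, y) \<Rightarrow> if x < y then f x * g y else 0) + (case p of (x, y) \<Rightarrow> if y < x then f x * g y else 0))"
  proof (rule integral_cong_AE)
    \<comment> \<open>The diagonal, which belongs to neither triangle, is a null set of the
      product.\<close>
    have "AE y in ?M. x \<noteq> y" for x
      using AE_lborel_singleton[of x] by (subst AE_lborel_on) auto
    then have "AE x in ?M. AE y in ?M. (case (x, y) of (x, y) \<Rightarrow> fst (x, y) \<noteq> snd (x, y))" by simp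
    then have "AE p in ?M \<Otimes>\<^sub>M ?M. (case p of (x, y) \<Rightarrow> fst (x, y) \<noteq> snd (x, y))"
      by (intro P.AE_pair_measure) auto
    then show "AE p in ?M \<Otimes>\<^sub>M ?M. (case p of (x, y) \<Rightarrow> f x * g y) =
       (case p of (x, y) \<Rightarrow> if x < y then f x * g y else 0) + (case p of (x, y) \<Rightarrow> if y < x then f x * g y else 0)"
      by eventually_elim auto
  qed measurable
  also have "\<dots> = integral\<^sup>L (?M \<Otimes>\<^sub>M ?M) (\<lambda>(x, y). if x < y then f x * g y else 0)
      + integral\<^sup>L (?M \<Otimes>\<^sub>M ?M) (\<lambda>(x, y). if y < x then f x * g y else 0)"
    by (rule Bochner_Integration.integral_add[OF L U])
  finally show "(\<integral>x. primitive a b f x * g x \<partial>?M) + (\<integral>x. f x * primitive a b g x \<partial>?M)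
      = (\<integral>x. f x \<partial>?M) * (\<integral>x. g x \<partial>?M)" using 1 2 by simp
qed

subsection \<open>Weak derivatives\<close>

lemma has_weak_deriv_ivl:
  "has_weak_deriv a b v g \<longleftrightarrow>
    (\<forall>\<psi>\<in>C1c a b. (\<integral>x. v x * deriv \<psi> x \<partial>ivl a b) = - (\<integral>x. g x * \<psi> x \<partial>ivl a b))"
  unfolding has_weak_deriv_def by (simp add: set_integral_lborel_on)

lemma has_weak_deriv_unique:
  assumes g: "g \<in> sq_int (ivl a b)" "has_weak_deriv a b v g"
    and h: "h \<in> sq_int (ivl a b)" "has_weak_deriv a b v h"
  shows "AE x in ivl a b. g x = h x"
proof -
  have "AE x in ivl a b. g x - h x = 0"
  proof (rule l2_dense_orthogonal[OF l2_dense_C1c sq_int_diff[OF g(1) h(1)]])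
    fix \<psi> assume \<psi>: "\<psi> \<in> C1c a b"
    have "(\<integral>x. (g x - h x) * \<psi> x \<partial>ivl a b) = (\<integral>x. g x * \<psi> x \<partial>ivl a b) - (\<integral>x. h x * \<psi> x \<partial>ivl a b)"
      using integrable_mult_sq_int[OF g(1) C1c_sq_int[OF \<psi>]] integrable_mult_sq_int[OF h(1) C1c_sq_int[OF \<psi>]]
      by (simp add: left_diff_distrib)
    also have "\<dots> = 0"
      using g(2) h(2) \<psi> unfolding has_weak_deriv_ivl by fastforce
    finally show "(\<integral>x. (g x - h x) * \<psi> x \<partial>ivl a b) = 0" .
  qed
  then show ?thesis by simp
qed

text \<open>No explicit bump is needed: if every test function had mean zero, the constant 1 would
  be orthogonal to a dense set, hence zero almost everywhere on a nonempty interval.\<close>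

lemma C1c_normalized:
  assumes "a < b"
  obtains \<theta> where "\<theta> \<in> C1c a b" "(\<integral>x. \<theta> x \<partial>ivl a b) = 1"
proof -
  have "\<exists>d\<in>C1c a b. (\<integral>x. d x \<partial>ivl a b) \<noteq> 0"
  proof (rule ccontr)
    assume "\<not> ?thesis"
    then have "(\<integral>x. 1 * d x \<partial>ivl a b) = 0" if "d \<in> C1c a b" for d using that by simp
    then have "AE x in ivl a b. (1::real) = 0"
      by (intro l2_dense_orthogonal[OF l2_dense_C1c]) (auto intro!: continuous_sq_int_ivl)
    then have "AE x in lborel. x \<notin> {a<..<b}" by (simp add: AE_lborel_on)
    then have "{a<..<b} \<in> null_sets lborel" by (subst (asm) AE_iff_null_sets[symmetric]) auto
    then show False using assms by (simp add: null_sets_def)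
  qed
  then obtain d where d: "d \<in> C1c a b" "(\<integral>x. d x \<partial>ivl a b) \<noteq> 0" by blast
  let ?c = "1 / (\<integral>x. d x \<partial>ivl a b)"
  obtain l r where lr: "a < l" "r < b" "\<And>x. x \<notin> {l..r} \<Longrightarrow> d x = 0"
    using d(1) unfolding C1c_def by blast
  have "(\<lambda>x. ?c * d x) \<in> C1c a b"
  proof (rule C1c_I(1)[OF _ _ lr(1,2)])
    show "((\<lambda>x. ?c * d x) has_real_derivative ?c * deriv d x) (at x)" for x
      by (rule DERIV_cmult[OF C1c_D(1)[OF d(1)]])
    show "continuous_on UNIV (\<lambda>x. ?c * deriv d x)"
      by (rule continuous_on_mult_left[OF C1c_D(2)[OF d(1)]])
  qed (use lr in auto)
  moreover have "(\<integral>x. ?c * d x \<partial>ivl a b) = 1" using d(2) by simp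
  ultimately show ?thesis by (rule that)
qed

lemma C1c_lincomb:
  assumes f: "f \<in> C1c a b" and g: "g \<in> C1c a b"
  shows "(\<lambda>x. \<alpha> * f x + \<beta> * g x) \<in> C1c a b"
    "deriv (\<lambda>x. \<alpha> * f x + \<beta> * g x) = (\<lambda>x. \<alpha> * deriv f x + \<beta> * deriv g x)"
proof -
  obtain c d where cd: "a < c" "d < b" "\<And>x. x \<notin> {c..d} \<Longrightarrow> f x = 0"
    using f unfolding C1c_def by blast
  obtain c' d' where cd': "a < c'" "d' < b" "\<And>x. x \<notin> {c'..d'} \<Longrightarrow> g x = 0"
    using g unfolding C1c_def by blast
  have 1: "((\<lambda>x. \<alpha> * f x + \<beta> * g x) has_real_derivative \<alpha> * deriv f x + \<beta> * deriv g x) (at x)" for x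
    by (intro DERIV_add DERIV_cmult C1c_D(1)[OF f] C1c_D(1)[OF g])
  have 2: "continuous_on UNIV (\<lambda>x. \<alpha> * deriv f x + \<beta> * deriv g x)"
    by (intro continuous_intros C1c_D(2)[OF f] C1c_D(2)[OF g])
  have 3: "a < min c c'" "max d d' < b" using cd cd' by auto
  have 4: "\<alpha> * f x + \<beta> * g x = 0" if "x \<notin> {min c c'..max d d'}" for x
  proof -
    have "f x = 0" "g x = 0" using that by (auto intro!: cd(3) cd'(3))
    then show ?thesis by simp
  qed
  show "(\<lambda>x. \<alpha> * f x + \<beta> * g x) \<in> C1c a b" by (rule C1c_I(1)[OF 1 2 3 4])
  show "deriv (\<lambda>x. \<alpha> * f x + \<beta> * g x) = (\<lambda>x. \<alpha> * deriv f x + \<beta> * deriv g x)"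
    by (rule C1c_I(2)[OF 1 2 3 4])
qed

text \<open>Subtracting from a test function its mean times a normalized \<open>\<theta>\<close>
  leaves a mean-zero test function, which is a derivative of another one. Orthogonality to
  derivatives thus becomes orthogonality of \<open>h - c\<close> to all test functions, with
  \<open>c\<close> the pairing of \<open>h\<close> and \<open>\<theta>\<close>.\<close>

lemma du_Bois_Reymond:
  assumes ab: "a < b" and h: "h \<in> sq_int (ivl a b)"
    and orth: "\<And>\<psi>. \<psi> \<in> C1c a b \<Longrightarrow> (\<integral>x. h x * deriv \<psi> x \<partial>ivl a b) = 0"
  shows "\<exists>c. AE x in ivl a b. h x = c"
proof -
  obtain \<theta> where \<theta>: "\<theta> \<in> C1c a b" "(\<integral>x. \<theta> x \<partial>ivl a b) = 1" using C1c_normalized[OF ab] by blast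
  define c where "c = (\<integral>x. h x * \<theta> x \<partial>ivl a b)"
  have cs: "(\<lambda>x. c) \<in> sq_int (ivl a b)" by (intro continuous_sq_int_ivl) auto
  have "AE x in ivl a b. h x - c = 0"
  proof (rule l2_dense_orthogonal[OF l2_dense_C1c sq_int_diff[OF h cs]])
    fix k assume k: "k \<in> C1c a b"
    let ?m = "\<integral>x. k x \<partial>ivl a b"
    have ki: "integrable (ivl a b) k" and \<theta>i: "integrable (ivl a b) \<theta>"
      using C1c_sq_int[OF k] C1c_sq_int[OF \<theta>(1)] by (auto intro: sq_int_imp_integrable)
    have hk: "integrable (ivl a b) (\<lambda>x. h x * k x)" "integrable (ivl a b) (\<lambda>x. h x * \<theta> x)"
      using C1c_sq_int[OF k] C1c_sq_int[OF \<theta>(1)] h by (auto intro: integrable_mult_sq_int)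
    let ?k = "\<lambda>x. 1 * k x + (- ?m) * \<theta> x"
    have "(\<integral>x. ?k x \<partial>ivl a b) = 0" using ki \<theta>i \<theta>(2) by simp
    then obtain \<psi> where \<psi>: "\<psi> \<in> C1c a b" "deriv \<psi> = ?k"
      using C1c_antideriv[OF C1c_lincomb(1)[OF k \<theta>(1)]] by blast
    have "(\<integral>x. h x * ?k x \<partial>ivl a b) = 0" using orth[OF \<psi>(1)] \<psi>(2) by simp
    moreover have "(\<lambda>x. h x * ?k x) = (\<lambda>x. h x * k x - ?m * (h x * \<theta> x))"
      by (auto simp: algebra_simps)
    ultimately have "(\<integral>x. h x * k x \<partial>ivl a b) = ?m * c" using hk by (simp add: c_def)
    then show "(\<integral>x. (h x - c) * k x \<partial>ivl a b) = 0"
      using hk ki by (simp add: left_diff_distrib)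
  qed
  then have "AE x in ivl a b. h x = c" by simp
  then show ?thesis by blast
qed

lemma primitive_has_weak_deriv:
  assumes ab: "a \<le> b" and g: "g \<in> sq_int (ivl a b)"
  shows "has_weak_deriv a b (primitive a b g) g"
  unfolding has_weak_deriv_ivl
proof
  fix \<psi> assume \<psi>: "\<psi> \<in> C1c a b"
  have gi: "integrable (ivl a b) g" and di: "integrable (ivl a b) (deriv \<psi>)"
    using g C1c_deriv_sq_int[OF \<psi>] by (auto intro: sq_int_imp_integrable)
  have "(\<integral>x. g x * primitive a b (deriv \<psi>) x \<partial>ivl a b) = (\<integral>x. g x * \<psi> x \<partial>ivl a b)"
    using C1c_primitive(1)[OF \<psi>] by (intro Bochner_Integration.integral_cong) auto
  with primitive_parts(2)[OF gi di] C1c_primitive(2)[OF \<psi> ab]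
  show "(\<integral>x. primitive a b g x * deriv \<psi> x \<partial>ivl a b) = - (\<integral>x. g x * \<psi> x \<partial>ivl a b)" by simp
qed

lemma has_weak_deriv_cong_AE:
  assumes "u \<in> borel_measurable (ivl a b)" "v \<in> borel_measurable (ivl a b)" "AE x in ivl a b. u x = v x"
    and "g \<in> borel_measurable (ivl a b)" "h \<in> borel_measurable (ivl a b)" "AE x in ivl a b. g x = h x"
    and w: "has_weak_deriv a b u g"
  shows "has_weak_deriv a b v h"
  unfolding has_weak_deriv_ivl
proof
  fix \<psi> assume \<psi>: "\<psi> \<in> C1c a b"
  have m [measurable]: "\<psi> \<in> borel_measurable (ivl a b)" "deriv \<psi> \<in> borel_measurable (ivl a b)"
    using C1c_sq_int[OF \<psi>] C1c_deriv_sq_int[OF \<psi>] by auto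
  have "(\<integral>x. v x * deriv \<psi> x \<partial>ivl a b) = (\<integral>x. u x * deriv \<psi> x \<partial>ivl a b)"
    using assms(1-3) by (intro integral_cong_AE) auto
  moreover have "(\<integral>x. h x * \<psi> x \<partial>ivl a b) = (\<integral>x. g x * \<psi> x \<partial>ivl a b)"
    using assms(4-6) by (intro integral_cong_AE) auto
  ultimately show "(\<integral>x. v x * deriv \<psi> x \<partial>ivl a b) = - (\<integral>x. h x * \<psi> x \<partial>ivl a b)"
    using w \<psi> unfolding has_weak_deriv_ivl by simp
qed

text \<open>One-dimensional Sobolev functions are primitives: the difference
  \<open>v - primitive a b g\<close> is orthogonal to all derivatives of test functions.\<close>

lemma weak_deriv_imp_primitive:
  assumes ab: "a < b" and v: "v \<in> sq_int (ivl a b)" and g: "g \<in> sq_int (ivl a b)"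
    and w: "has_weak_deriv a b v g"
  shows "\<exists>c. AE x in ivl a b. v x = c + primitive a b g x"
proof -
  note P = primitive_sq_int[OF g]
  have "\<exists>c. AE x in ivl a b. v x - primitive a b g x = c"
  proof (rule du_Bois_Reymond[OF ab sq_int_diff[OF v P]])
    fix \<psi> assume \<psi>: "\<psi> \<in> C1c a b"
    have "(\<integral>x. (v x - primitive a b g x) * deriv \<psi> x \<partial>ivl a b)
      = (\<integral>x. v x * deriv \<psi> x \<partial>ivl a b) - (\<integral>x. primitive a b g x * deriv \<psi> x \<partial>ivl a b)"
      using integrable_mult_sq_int[OF v C1c_deriv_sq_int[OF \<psi>]] integrable_mult_sq_int[OF P C1c_deriv_sq_int[OF \<psi>]]
      by (simp add: left_diff_distrib)
    also have "\<dots> = 0"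
      using w primitive_has_weak_deriv[OF less_imp_le[OF ab] g] \<psi> unfolding has_weak_deriv_ivl by simp
    finally show "(\<integral>x. (v x - primitive a b g x) * deriv \<psi> x \<partial>ivl a b) = 0" .
  qed
  then obtain c where "AE x in ivl a b. v x - primitive a b g x = c" by blast
  then have "AE x in ivl a b. v x = c + primitive a b g x" by eventually_elim simp
  then show ?thesis by blast
qed

subsection \<open>The space \<open>H\<^sup>1\<^sub>0\<close>\<close>

lemma measure_ivl_01 [simp]: "measure (ivl 0 1) {0<..<1} = 1"
  by (simp add: measure_restrict_space)

lemma L2_Omega: "L2 Omega = sq_int (ivl 0 1)"
  by (rule L2_eq_sq_int) simp

lemma L2_norm_Omega: "L2_norm Omega f = l2n (ivl 0 1) f"
  by (rule L2_norm_eq_l2n) simp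

lemma L2_inner_ivl: "L2_inner f v = (\<integral>x. f x * v x \<partial>ivl 0 1)"
  unfolding L2_inner_def by (rule set_integral_lborel_on) simp

lemma weak_deriv_spec:
  assumes "v \<in> H1"
  shows "weak_deriv v \<in> sq_int (ivl 0 1)" "has_weak_deriv 0 1 v (weak_deriv v)"
proof -
  have "\<exists>g. g \<in> L2 Omega \<and> has_weak_deriv 0 1 v g" using assms unfolding H1_def by blast
  then have "weak_deriv v \<in> L2 Omega \<and> has_weak_deriv 0 1 v (weak_deriv v)"
    unfolding weak_deriv_def by (rule someI_ex)
  then show "weak_deriv v \<in> sq_int (ivl 0 1)" "has_weak_deriv 0 1 v (weak_deriv v)"
    by (auto simp: L2_Omega)
qed

text \<open>The two zero boundary values reappear as the vanishing mean of the derivative and the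
  absence of an additive constant. Both hold for test functions and survive the limit, since the
  primitive is bounded on L^2.\<close>

lemma H10_weak_deriv:
  assumes v: "v \<in> H10"
  shows "v \<in> sq_int (ivl 0 1)" "weak_deriv v \<in> sq_int (ivl 0 1)"
    "(\<integral>x. weak_deriv v x \<partial>ivl 0 1) = 0"
    "AE x in ivl 0 1. v x = primitive 0 1 (weak_deriv v) x"
proof -
  let ?M = "ivl 0 1"
  let ?g = "weak_deriv v"
  have H1: "v \<in> H1" using v unfolding H10_def by blast
  then show vs: "v \<in> sq_int ?M" by (simp add: H1_def L2_Omega)
  note g = weak_deriv_spec[OF H1]
  show "?g \<in> sq_int ?M" by (rule g(1))
  obtain \<psi> :: "nat \<Rightarrow> real \<Rightarrow> real" where \<psi>: "\<And>n. \<psi> n \<in> C1c 0 1"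
      "(\<lambda>n. l2n ?M (\<lambda>x. \<psi> n x - v x)) \<longlonglongrightarrow> 0"
      "(\<lambda>n. l2n ?M (\<lambda>x. deriv (\<psi> n) x - ?g x)) \<longlonglongrightarrow> 0"
    using v unfolding H10_def by (auto simp: L2_norm_Omega)
  note \<psi>s = C1c_sq_int[OF \<psi>(1)] and ds = C1c_deriv_sq_int[OF \<psi>(1)]
  have one: "(\<lambda>x. 1) \<in> sq_int ?M" by (intro continuous_sq_int_ivl) auto
  have "(\<lambda>n. \<integral>x. deriv (\<psi> n) x * 1 \<partial>?M) \<longlonglongrightarrow> (\<integral>x. ?g x * 1 \<partial>?M)"
    by (rule integral_mult_tendsto[OF ds g(1) one \<psi>(3)])
  then show "(\<integral>x. ?g x \<partial>?M) = 0"
    using C1c_primitive(2)[OF \<psi>(1)] by (simp add: LIMSEQ_const_iff)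
  note P = primitive_sq_int[OF g(1)]
  have "l2n ?M (\<lambda>x. \<psi> n x - primitive 0 1 ?g x) \<le> l2n ?M (\<lambda>x. deriv (\<psi> n) x - ?g x)" for n
  proof -
    have "l2n ?M (\<lambda>x. \<psi> n x - primitive 0 1 ?g x) = l2n ?M (primitive 0 1 (\<lambda>x. deriv (\<psi> n) x - ?g x))"
      unfolding l2n_def
      using C1c_primitive(1)[OF \<psi>(1)[of n]] sq_int_imp_integrable[OF finite_measure_ivl ds[of n]]
        sq_int_imp_integrable[OF finite_measure_ivl g(1)]
      by (intro arg_cong[where f=sqrt] Bochner_Integration.integral_cong)
        (auto simp flip: primitive_diff)
    also have "\<dots> \<le> measure ?M {0<..<1} * l2n ?M (\<lambda>x. deriv (\<psi> n) x - ?g x)"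
      by (rule l2n_primitive_le[OF sq_int_diff[OF ds g(1)]])
    finally show ?thesis by simp
  qed
  then have "l2n ?M (\<lambda>x. v x - primitive 0 1 ?g x)
      \<le> l2n ?M (\<lambda>x. \<psi> n x - v x) + l2n ?M (\<lambda>x. deriv (\<psi> n) x - ?g x)" for n
    using l2n_triangle3[OF vs \<psi>s[of n] P] by (simp add: l2n_minus_commute[of _ v] add_left_mono order_trans)
  moreover have "(\<lambda>n. l2n ?M (\<lambda>x. \<psi> n x - v x) + l2n ?M (\<lambda>x. deriv (\<psi> n) x - ?g x)) \<longlonglongrightarrow> 0 + 0"
    by (rule tendsto_add[OF \<psi>(2,3)])
  ultimately have "l2n ?M (\<lambda>x. v x - primitive 0 1 ?g x) \<le> 0 + 0"
    by (intro LIMSEQ_le_const) auto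
  then have "l2n ?M (\<lambda>x. v x - primitive 0 1 ?g x) = 0" by (simp add: antisym)
  then show "AE x in ?M. v x = primitive 0 1 ?g x"
    using l2n_eq_0_imp_AE[OF sq_int_diff[OF vs P]] by simp
qed

text \<open>With \<open>H10_weak_deriv\<close> this identifies \<open>H10\<close> with the
  primitives of mean-zero L^2 functions. The approximating test functions are primitives of
  approximations of \<open>g\<close>, whose means must first be removed.\<close>

lemma H10_I:
  assumes v: "v \<in> borel_measurable (ivl 0 1)" and g: "g \<in> sq_int (ivl 0 1)"
    and g0: "(\<integral>x. g x \<partial>ivl 0 1) = 0" and ae: "AE x in ivl 0 1. v x = primitive 0 1 g x"
  shows "v \<in> H10" "AE x in ivl 0 1. weak_deriv v x = g x"
proof -
  let ?M = "ivl 0 1"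
  note P = primitive_sq_int[OF g]
  have vs: "v \<in> sq_int ?M"
    by (rule sq_int_bound[OF P v]) (use ae in eventually_elim, auto)
  have wd: "has_weak_deriv 0 1 v g"
    by (rule has_weak_deriv_cong_AE[OF sq_int_measurable[OF P] v _ sq_int_measurable[OF g] sq_int_measurable[OF g] _ primitive_has_weak_deriv[OF _ g]])
      (use ae in \<open>auto elim: eventually_mono\<close>)
  have H1: "v \<in> H1" unfolding H1_def using vs wd g by (auto simp: L2_Omega)
  note W = weak_deriv_spec[OF H1]
  show ae_g: "AE x in ?M. weak_deriv v x = g x"
    by (rule has_weak_deriv_unique[OF W g wd])
  obtain \<theta> where \<theta>: "\<theta> \<in> C1c 0 1" "(\<integral>x. \<theta> x \<partial>?M) = 1" using C1c_normalized[OF zero_less_one] by blast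
  obtain k :: "nat \<Rightarrow> real \<Rightarrow> real" where k: "\<And>n. k n \<in> C1c 0 1" "\<And>n. k n \<in> sq_int ?M"
      "(\<lambda>n. l2n ?M (\<lambda>x. k n x - g x)) \<longlonglongrightarrow> 0"
    using l2_dense_sequence[OF l2_dense_C1c g] by blast
  note ks = k(2) and \<theta>s = C1c_sq_int[OF \<theta>(1)]
  \<comment> \<open>The means tend to the mean of \<open>g\<close>, which is 0, so correcting them
    by multiples of a fixed \<open>\<theta>\<close> does not disturb the convergence.\<close>
  define m where "m n = (\<integral>x. k n x \<partial>?M)" for n
  have one: "(\<lambda>x. 1) \<in> sq_int ?M" by (intro continuous_sq_int_ivl) auto
  have m0: "m \<longlonglongrightarrow> 0"
    using integral_mult_tendsto[OF ks g one k(3)] g0 by (simp add: m_def [abs_def])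
  have "\<exists>\<psi>\<in>C1c 0 1. deriv \<psi> = (\<lambda>x. 1 * k n x + (- m n) * \<theta> x)" for n
  proof (rule C1c_antideriv[OF C1c_lincomb(1)[OF k(1) \<theta>(1)]])
    show "(\<integral>x. 1 * k n x + (- m n) * \<theta> x \<partial>?M) = 0"
      using sq_int_imp_integrable[OF finite_measure_ivl ks] sq_int_imp_integrable[OF finite_measure_ivl \<theta>s] \<theta>(2)
      by (simp add: m_def)
  qed
  then have "\<forall>n. \<exists>\<psi>. \<psi> \<in> C1c 0 1 \<and> deriv \<psi> = (\<lambda>x. 1 * k n x + (- m n) * \<theta> x)" by blast
  then obtain \<psi> where \<psi>: "\<forall>n. \<psi> n \<in> C1c 0 1 \<and> deriv (\<psi> n) = (\<lambda>x. 1 * k n x + (- m n) * \<theta> x)"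
    by (rule choice[THEN exE])
  then have \<psi>c: "\<psi> n \<in> C1c 0 1" and \<psi>d: "deriv (\<psi> n) = (\<lambda>x. 1 * k n x + (- m n) * \<theta> x)" for n by auto
  note \<psi>s = C1c_sq_int[OF \<psi>c] and ds = C1c_deriv_sq_int[OF \<psi>c]
  have d0: "(\<lambda>n. l2n ?M (\<lambda>x. deriv (\<psi> n) x - g x)) \<longlonglongrightarrow> 0"
  proof (rule Lim_null_comparison)
    show "\<forall>\<^sub>F n in sequentially. norm (l2n ?M (\<lambda>x. deriv (\<psi> n) x - g x))
        \<le> l2n ?M (\<lambda>x. k n x - g x) + \<bar>m n\<bar> * l2n ?M \<theta>"
    proof (rule always_eventually, rule allI)
      fix n
      have "l2n ?M (\<lambda>x. (k n x - g x) + (- m n) * \<theta> x) \<le> l2n ?M (\<lambda>x. k n x - g x) + l2n ?M (\<lambda>x. (- m n) * \<theta> x)"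
        by (rule l2n_triangle[OF sq_int_diff[OF ks g] sq_int_cmult[OF \<theta>s]])
      moreover have "(\<lambda>x. deriv (\<psi> n) x - g x) = (\<lambda>x. (k n x - g x) + (- m n) * \<theta> x)"
        unfolding \<psi>d by auto
      ultimately show "norm (l2n ?M (\<lambda>x. deriv (\<psi> n) x - g x))
        \<le> l2n ?M (\<lambda>x. k n x - g x) + \<bar>m n\<bar> * l2n ?M \<theta>" by (simp only: l2n_cmult) simp
    qed
    have "(\<lambda>n. l2n ?M (\<lambda>x. k n x - g x) + \<bar>m n\<bar> * l2n ?M \<theta>) \<longlonglongrightarrow> 0 + \<bar>0\<bar> * l2n ?M \<theta>"
      by (intro tendsto_intros k(3) m0)
    then show "(\<lambda>n. l2n ?M (\<lambda>x. k n x - g x) + \<bar>m n\<bar> * l2n ?M \<theta>) \<longlonglongrightarrow> 0" by simp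
  qed
  have "l2n ?M (\<lambda>x. \<psi> n x - v x) \<le> l2n ?M (\<lambda>x. deriv (\<psi> n) x - g x)" for n
  proof -
    have "l2n ?M (\<lambda>x. \<psi> n x - v x) = l2n ?M (\<lambda>x. \<psi> n x - primitive 0 1 g x)"
    proof (rule l2n_cong_AE)
      show "AE x in ?M. \<psi> n x - v x = \<psi> n x - primitive 0 1 g x" using ae by eventually_elim simp
    qed (use sq_int_diff[OF \<psi>s vs] sq_int_diff[OF \<psi>s P] in auto)
    also have "\<dots> = l2n ?M (primitive 0 1 (\<lambda>x. deriv (\<psi> n) x - g x))"
      unfolding l2n_def
      using C1c_primitive(1)[OF \<psi>c[of n]] sq_int_imp_integrable[OF finite_measure_ivl ds[of n]]
        sq_int_imp_integrable[OF finite_measure_ivl g]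
      by (intro arg_cong[where f=sqrt] Bochner_Integration.integral_cong)
        (auto simp flip: primitive_diff)
    also have "\<dots> \<le> measure ?M {0<..<1} * l2n ?M (\<lambda>x. deriv (\<psi> n) x - g x)"
      by (rule l2n_primitive_le[OF sq_int_diff[OF ds g]])
    finally show ?thesis by simp
  qed
  then have v0: "(\<lambda>n. l2n ?M (\<lambda>x. \<psi> n x - v x)) \<longlonglongrightarrow> 0"
    by (intro Lim_null_comparison[OF _ d0]) auto
  have dW: "l2n ?M (\<lambda>x. deriv (\<psi> n) x - weak_deriv v x) = l2n ?M (\<lambda>x. deriv (\<psi> n) x - g x)" for n
  proof (rule l2n_cong_AE)
    show "AE x in ?M. deriv (\<psi> n) x - weak_deriv v x = deriv (\<psi> n) x - g x"
      using ae_g by eventually_elim simp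
  qed (use sq_int_diff[OF ds W(1)] sq_int_diff[OF ds g] in auto)
  from d0 have "(\<lambda>n. l2n ?M (\<lambda>x. deriv (\<psi> n) x - weak_deriv v x)) \<longlonglongrightarrow> 0"
    unfolding dW .
  with \<psi>c v0 have "\<exists>\<psi> :: nat \<Rightarrow> real \<Rightarrow> real. (\<forall>n. \<psi> n \<in> C1c 0 1) \<and>
     (\<lambda>n. l2n ?M (\<lambda>x. \<psi> n x - v x)) \<longlonglongrightarrow> 0 \<and>
     (\<lambda>n. l2n ?M (\<lambda>x. deriv (\<psi> n) x - weak_deriv v x)) \<longlonglongrightarrow> 0"
    by (intro exI[of _ \<psi>] conjI allI)
  with H1 show "v \<in> H10" unfolding H10_def L2_norm_Omega by blast
qed

lemma primitive_lincomb:
  assumes f: "f \<in> sq_int (ivl a b)" and g: "g \<in> sq_int (ivl a b)"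
  shows "primitive a b (\<lambda>y. \<alpha> * f y + \<beta> * g y) x = \<alpha> * primitive a b f x + \<beta> * primitive a b g x"
proof -
  note fi = integrable_cut[OF sq_int_imp_integrable[OF finite_measure_ivl f]]
    and gi = integrable_cut[OF sq_int_imp_integrable[OF finite_measure_ivl g]]
  have "primitive a b (\<lambda>y. \<alpha> * f y + \<beta> * g y) x
      = (\<integral>y. \<alpha> * (if y < x then f y else 0) + \<beta> * (if y < x then g y else 0) \<partial>ivl a b)"
    unfolding primitive_def by (intro Bochner_Integration.integral_cong) auto
  then show ?thesis using fi gi by (simp add: primitive_def)
qed

text \<open>\<open>weak_deriv\<close> is an arbitrary choice for each function, so its linearity can
  only hold almost everywhere.\<close>

lemma H10_lincomb:
  assumes u: "u \<in> H10" and v: "v \<in> H10"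
  shows "(\<lambda>x. \<alpha> * u x + \<beta> * v x) \<in> H10"
    "AE x in ivl 0 1. weak_deriv (\<lambda>x. \<alpha> * u x + \<beta> * v x) x = \<alpha> * weak_deriv u x + \<beta> * weak_deriv v x"
proof -
  note U = H10_weak_deriv[OF u] and V = H10_weak_deriv[OF v]
  have m: "(\<lambda>x. \<alpha> * u x + \<beta> * v x) \<in> borel_measurable (ivl 0 1)"
    by (rule sq_int_measurable[OF sq_int_lincomb[OF U(1) V(1)]])
  have z: "(\<integral>x. \<alpha> * weak_deriv u x + \<beta> * weak_deriv v x \<partial>ivl 0 1) = 0"
    using sq_int_imp_integrable[OF finite_measure_ivl U(2)] sq_int_imp_integrable[OF finite_measure_ivl V(2)] U(3) V(3)
    by simp
  have ae: "AE x in ivl 0 1. \<alpha> * u x + \<beta> * v x = primitive 0 1 (\<lambda>x. \<alpha> * weak_deriv u x + \<beta> * weak_deriv v x) x"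
    using U(4) V(4) by eventually_elim (simp add: primitive_lincomb[OF U(2) V(2)])
  show "(\<lambda>x. \<alpha> * u x + \<beta> * v x) \<in> H10"
    by (rule H10_I(1)[OF m sq_int_lincomb[OF U(2) V(2)] z ae])
  show "AE x in ivl 0 1. weak_deriv (\<lambda>x. \<alpha> * u x + \<beta> * v x) x = \<alpha> * weak_deriv u x + \<beta> * weak_deriv v x"
    by (rule H10_I(2)[OF m sq_int_lincomb[OF U(2) V(2)] z ae])
qed

lemma zero_in_H10: "(\<lambda>x. 0) \<in> H10" "AE x in ivl 0 1. weak_deriv (\<lambda>x. 0) x = 0"
proof -
  have "primitive 0 1 (\<lambda>x. 0) x = 0" for x by (simp add: primitive_def)
  then show "(\<lambda>x. 0) \<in> H10" "AE x in ivl 0 1. weak_deriv (\<lambda>x. 0) x = 0"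
    using H10_I[of "\<lambda>x. 0" "\<lambda>x. 0"] by auto
qed

lemma H10_norm_eq: "H10_norm v = l2n (ivl 0 1) (weak_deriv v)"
  by (simp add: H10_norm_def L2_norm_Omega)

text \<open>On \<open>H10\<close> the norm is the L^2 norm of the weak derivative, so a functional
  in \<open>Hm1\<close> is a bounded functional of the weak derivative and Riesz applies. It says
  that elements of H^-1 are distributional derivatives of L^2 functions.\<close>

theorem Hm1_representation:
  assumes L: "L \<in> Hm1"
  obtains h where "h \<in> sq_int (ivl 0 1)" "\<And>v. v \<in> H10 \<Longrightarrow> L v = (\<integral>x. h x * weak_deriv v x \<partial>ivl 0 1)"
proof -
  let ?M = "ivl 0 1"
  have lin: "L (\<lambda>x. a * u x + b * v x) = a * L u + b * L v" if "u \<in> H10" "v \<in> H10" for u v a b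
    using L that unfolding Hm1_def by blast
  obtain C where C: "\<And>v. v \<in> H10 \<Longrightarrow> \<bar>L v\<bar> \<le> C * H10_norm v"
    using L unfolding Hm1_def by blast
  \<comment> \<open>Almost everywhere equality is built in because the chosen weak derivative of a
    sum agrees with the sum of the chosen ones only up to a null set.\<close>
  define \<Gamma> where "\<Gamma> = {(f, k). f \<in> sq_int ?M \<and> (\<exists>v\<in>H10. (AE x in ?M. f x = weak_deriv v x) \<and> k = L v)}"
  obtain h where h: "h \<in> sq_int ?M" "\<And>f k. (f, k) \<in> \<Gamma> \<Longrightarrow> k = (\<integral>x. h x * f x \<partial>?M)"
  proof (rule riesz_representation[of ?M \<Gamma> C])
    have "(weak_deriv (\<lambda>x. 0), L (\<lambda>x. 0)) \<in> \<Gamma>"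
      unfolding \<Gamma>_def using H10_weak_deriv(2)[OF zero_in_H10(1)] zero_in_H10(1) by auto
    then show "\<Gamma> \<noteq> {}" by blast
    show "f \<in> sq_int ?M" if "(f, k) \<in> \<Gamma>" for f k using that by (simp add: \<Gamma>_def)
    show "(\<lambda>x. a * f x + b * g x, a * k + b * l) \<in> \<Gamma>" if fk: "(f, k) \<in> \<Gamma>" and gl: "(g, l) \<in> \<Gamma>" for f k g l a b
    proof -
      obtain u where u: "f \<in> sq_int ?M" "u \<in> H10" "AE x in ?M. f x = weak_deriv u x" "k = L u"
        using fk by (auto simp: \<Gamma>_def)
      obtain v where v: "g \<in> sq_int ?M" "v \<in> H10" "AE x in ?M. g x = weak_deriv v x" "l = L v"
        using gl by (auto simp: \<Gamma>_def)
      have "AE x in ?M. a * f x + b * g x = weak_deriv (\<lambda>x. a * u x + b * v x) x"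
        using u(3) v(3) H10_lincomb(2)[OF u(2) v(2), of a b] by eventually_elim simp
      moreover have "a * k + b * l = L (\<lambda>x. a * u x + b * v x)"
        using lin[OF u(2) v(2)] u(4) v(4) by simp
      ultimately show ?thesis
        unfolding \<Gamma>_def using sq_int_lincomb[OF u(1) v(1)] H10_lincomb(1)[OF u(2) v(2)] by blast
    qed
    show "\<bar>k\<bar> \<le> C * l2n ?M f" if fk: "(f, k) \<in> \<Gamma>" for f k
    proof -
      obtain u where u: "f \<in> sq_int ?M" "u \<in> H10" "AE x in ?M. f x = weak_deriv u x" "k = L u"
        using fk by (auto simp: \<Gamma>_def)
      have "l2n ?M f = H10_norm u"
        unfolding H10_norm_eq using u(1,3) H10_weak_deriv(2)[OF u(2)] by (intro l2n_cong_AE) auto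
      then show ?thesis using C[OF u(2)] u(4) by simp
    qed
  qed (simp, rule that)
  have "L v = (\<integral>x. h x * weak_deriv v x \<partial>?M)" if "v \<in> H10" for v
    by (rule h(2)) (use H10_weak_deriv(2)[OF that] that in \<open>auto simp: \<Gamma>_def\<close>)
  with h(1) show ?thesis by (rule that)
qed

text \<open>A real supremum can be estimated only for a nonempty set that is bounded above: the zero
  function provides the first, the assumed bound the second.\<close>

lemma Hm1_norm_bound:
  assumes "\<And>v. v \<in> H10 \<Longrightarrow> \<bar>L v\<bar> \<le> K * H10_norm v" "0 \<le> K"
  shows "0 \<le> Hm1_norm L" "Hm1_norm L \<le> K"
proof -
  have b1: "\<bar>L v\<bar> \<le> K" if "v \<in> {v \<in> H10. H10_norm v \<le> 1}" for v
  proof -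
    have "\<bar>L v\<bar> \<le> K * H10_norm v" using assms(1) that by simp
    also have "\<dots> \<le> K * 1" using that assms(2) by (intro mult_left_mono) auto
    finally show ?thesis by simp
  qed
  have "H10_norm (\<lambda>x. 0) = l2n (ivl 0 1) (\<lambda>x. 0)"
    unfolding H10_norm_eq
    by (rule l2n_cong_AE[OF sq_int_measurable[OF H10_weak_deriv(2)[OF zero_in_H10(1)]] _ zero_in_H10(2)]) simp
  then have z: "(\<lambda>x. 0) \<in> {v \<in> H10. H10_norm v \<le> 1}" using zero_in_H10(1) by simp
  show "Hm1_norm L \<le> K"
    unfolding Hm1_norm_def by (rule cSUP_least) (use z b1 in blast)+
  have "bdd_above ((\<lambda>v. \<bar>L v\<bar>) ` {v \<in> H10. H10_norm v \<le> 1})"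
    by (rule bdd_aboveI2[OF b1])
  then show "0 \<le> Hm1_norm L"
    unfolding Hm1_norm_def by (rule cSUP_upper2[OF _ z]) simp_all
qed

lemma Hm1_I:
  assumes h: "h \<in> sq_int (ivl 0 1)"
    and L: "\<And>v. v \<in> H10 \<Longrightarrow> L v = (\<integral>x. h x * weak_deriv v x \<partial>ivl 0 1)"
  shows "L \<in> Hm1" "0 \<le> Hm1_norm L" "Hm1_norm L \<le> l2n (ivl 0 1) h"
proof -
  let ?M = "ivl 0 1"
  have b: "\<bar>L v\<bar> \<le> l2n ?M h * H10_norm v" if "v \<in> H10" for v
    using l2n_Cauchy_Schwarz[OF h H10_weak_deriv(2)[OF that]] L[OF that] by (simp add: H10_norm_eq)
  have lin: "L (\<lambda>x. \<alpha> * u x + \<beta> * v x) = \<alpha> * L u + \<beta> * L v" if u: "u \<in> H10" and v: "v \<in> H10" for u v \<alpha> \<beta>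
  proof -
    note U = H10_weak_deriv(2)[OF u] and V = H10_weak_deriv(2)[OF v]
    note uv = H10_lincomb[OF u v, of \<alpha> \<beta>]
    have "L (\<lambda>x. \<alpha> * u x + \<beta> * v x) = (\<integral>x. h x * (\<alpha> * weak_deriv u x + \<beta> * weak_deriv v x) \<partial>?M)"
      unfolding L[OF uv(1)]
    proof (rule integral_cong_AE)
      show "AE x in ?M. h x * weak_deriv (\<lambda>x. \<alpha> * u x + \<beta> * v x) x = h x * (\<alpha> * weak_deriv u x + \<beta> * weak_deriv v x)"
        using uv(2) by eventually_elim simp
    qed (use h U V H10_weak_deriv(2)[OF uv(1)] in measurable)
    also have "\<dots> = (\<integral>x. \<alpha> * (h x * weak_deriv u x) + \<beta> * (h x * weak_deriv v x) \<partial>?M)"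
      by (intro Bochner_Integration.integral_cong) (auto simp: algebra_simps)
    also have "\<dots> = \<alpha> * L u + \<beta> * L v"
      using integrable_mult_sq_int[OF h U] integrable_mult_sq_int[OF h V] L[OF u] L[OF v] by simp
    finally show ?thesis .
  qed
  show "L \<in> Hm1" unfolding Hm1_def using lin b by blast
  show "0 \<le> Hm1_norm L" "Hm1_norm L \<le> l2n (ivl 0 1) h"
    using Hm1_norm_bound[OF b l2n_nonneg] by simp_all
qed

subsection \<open>Periodic functions\<close>

text \<open>Extended nonnegative values let translation, reflection and splitting be computed before
  integrability is known, which is then read off from finiteness.\<close>

definition sq_mass :: "(real \<Rightarrow> real) \<Rightarrow> real set \<Rightarrow> ennreal" where
  "sq_mass f A = (\<integral>\<^sup>+x. ennreal ((f x)\<^sup>2) * indicator A x \<partial>lborel)"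

lemma sq_int_iff_sq_mass:
  assumes f: "f \<in> borel_measurable borel" and A: "A \<in> sets borel"
  shows "f \<in> sq_int (lborel_on A) \<longleftrightarrow> sq_mass f A < \<infinity>"
proof -
  have m: "f \<in> borel_measurable (lborel_on A)" by (rule borel_measurable_lborel_on[OF f])
  have "(\<integral>\<^sup>+x. ennreal ((f x)\<^sup>2) \<partial>lborel_on A) = sq_mass f A"
    unfolding sq_mass_def using A by (subst nn_integral_restrict_space) auto
  then show ?thesis using m unfolding sq_int_def by (simp add: integrable_iff_bounded)
qed

lemma ennreal_l2n_sq_mass:
  assumes f: "f \<in> sq_int (lborel_on A)" and A: "A \<in> sets borel"
  shows "ennreal ((l2n (lborel_on A) f)\<^sup>2) = sq_mass f A"
  unfolding ennreal_l2n_power2[OF f] sq_mass_def using A by (subst nn_integral_restrict_space) auto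

lemma sq_mass_translate:
  assumes [measurable]: "f \<in> borel_measurable borel"
  shows "sq_mass (\<lambda>x. f (s + x)) {a<..<b} = sq_mass f {s + a<..<s + b}"
proof -
  have "sq_mass f {s + a<..<s + b}
      = ennreal \<bar>1\<bar> * (\<integral>\<^sup>+x. ennreal ((f (s + 1 * x))\<^sup>2) * indicator {s + a<..<s + b} (s + 1 * x) \<partial>lborel)"
    unfolding sq_mass_def by (rule nn_integral_real_affine) auto
  also have "\<dots> = sq_mass (\<lambda>x. f (s + x)) {a<..<b}"
    unfolding sq_mass_def by (simp, intro nn_integral_cong) (auto simp: indicator_def)
  finally show ?thesis by simp
qed

lemma sq_mass_reflect:
  assumes [measurable]: "f \<in> borel_measurable borel"
  shows "sq_mass (\<lambda>x. f (- x)) {a<..<b} = sq_mass f {- b<..<- a}"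
proof -
  have "sq_mass f {- b<..<- a}
      = ennreal \<bar>- 1\<bar> * (\<integral>\<^sup>+x. ennreal ((f (0 + (- 1) * x))\<^sup>2) * indicator {- b<..<- a} (0 + (- 1) * x) \<partial>lborel)"
    unfolding sq_mass_def by (rule nn_integral_real_affine) auto
  also have "\<dots> = sq_mass (\<lambda>x. f (- x)) {a<..<b}"
    unfolding sq_mass_def by (simp, intro nn_integral_cong) (auto simp: indicator_def)
  finally show ?thesis by simp
qed

lemma sq_mass_split:
  assumes [measurable]: "f \<in> borel_measurable borel" and "a \<le> c" "c \<le> b"
  shows "sq_mass f {a<..<b} = sq_mass f {a<..<c} + sq_mass f {c<..<b}"
proof -
  have "sq_mass f {a<..<b} = (\<integral>\<^sup>+x. ennreal ((f x)\<^sup>2) * indicator {a<..<c} x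
      + ennreal ((f x)\<^sup>2) * indicator {c<..<b} x \<partial>lborel)"
    unfolding sq_mass_def
  proof (rule nn_integral_cong_AE)
    show "AE x in lborel. ennreal ((f x)\<^sup>2) * indicator {a<..<b} x
      = ennreal ((f x)\<^sup>2) * indicator {a<..<c} x + ennreal ((f x)\<^sup>2) * indicator {c<..<b} x"
      using AE_lborel_singleton[of c] by eventually_elim (use assms(2,3) in \<open>auto simp: indicator_def\<close>)
  qed
  also have "\<dots> = sq_mass f {a<..<c} + sq_mass f {c<..<b}"
    unfolding sq_mass_def by (rule nn_integral_add) auto
  finally show ?thesis .
qed

text \<open>Period 2 is the travel time of a wave to the far end of the unit interval and back.
  Measurability is required on the whole line because all translates are used.\<close>

definition per_l2 :: "(real \<Rightarrow> real) set" where
  "per_l2 = {p \<in> borel_measurable borel. (\<forall>u. p (u + 2) = p u) \<and> p \<in> sq_int (ivl (-1) 1)}"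

lemma per_l2D:
  assumes "p \<in> per_l2"
  shows "p \<in> borel_measurable borel" "p (u + 2) = p u" "p \<in> sq_int (ivl (-1) 1)"
  using assms by (auto simp: per_l2_def)

lemma periodic_int:
  fixes p :: "real \<Rightarrow> real"
  assumes "\<And>u. p (u + 2) = p u"
  shows "p (2 * of_int k + u) = p u"
proof -
  have n: "p (2 * real n + u) = p u" for n u
  proof (induction n)
    case (Suc n)
    have "p (2 * real (Suc n) + u) = p ((2 * real n + u) + 2)" by (simp add: algebra_simps)
    with Suc show ?case by (simp only: assms)
  qed simp
  show ?thesis
  proof (cases "0 \<le> k")
    case True
    then show ?thesis using n[of "nat k" u] by simp
  next
    case False
    then have "p (2 * real (nat (- k)) + (2 * of_int k + u)) = p (2 * of_int k + u)" by (intro n)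
    then show ?thesis using False by simp
  qed
qed

text \<open>The window of length 2 contains an odd integer; cut there and shift the right-hand piece
  back by one period.\<close>

lemma sq_mass_period:
  assumes m: "p \<in> borel_measurable borel" and per: "\<And>u. p (u + 2) = p u"
  shows "sq_mass p {a<..<a + 2} = sq_mass p {- 1<..<1}"
proof -
  \<comment> \<open>Chosen so that 2k - 1 \<le> a < 2k + 1.\<close>
  define k where "k = \<lfloor>(a + 1) / 2\<rfloor>"
  have "of_int k \<le> (a + 1) / 2" "(a + 1) / 2 < of_int k + 1" unfolding k_def by linarith+
  then have k: "2 * of_int k - 1 \<le> a" "a < 2 * of_int k + 1" by (simp_all add: field_simps)
  have sh: "sq_mass p {2 * of_int j + c<..<2 * of_int j + d} = sq_mass p {c<..<d}" for j :: int and c d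
    using sq_mass_translate[OF m, of "2 * of_int j" c d] by (simp add: periodic_int[of p, OF per])
  have "sq_mass p {a<..<a + 2} = sq_mass p {a<..<2 * of_int k + 1} + sq_mass p {2 * of_int k + 1<..<a + 2}"
    by (rule sq_mass_split[OF m]) (use k in auto)
  also have "sq_mass p {2 * of_int k + 1<..<a + 2} = sq_mass p {2 * of_int k - 1<..<a}"
    using sh[of 1 "2 * of_int k - 1" a] by (simp add: add.commute)
  also have "sq_mass p {a<..<2 * of_int k + 1} + sq_mass p {2 * of_int k - 1<..<a}
      = sq_mass p {2 * of_int k - 1<..<2 * of_int k + 1}"
    using sq_mass_split[OF m k(1) less_imp_le[OF k(2)]] by (simp add: add.commute)
  also have "\<dots> = sq_mass p {- 1<..<1}" using sh[of k "-1" 1] by simp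
  finally show ?thesis .
qed

lemma per_l2_translate:
  assumes p: "p \<in> per_l2"
  shows "(\<lambda>u. p (s + u)) \<in> per_l2" "l2n (ivl (-1) 1) (\<lambda>u. p (s + u)) = l2n (ivl (-1) 1) p"
proof -
  note [measurable] = per_l2D(1)[OF p]
  have "sq_mass (\<lambda>u. p (s + u)) {- 1<..<1} = sq_mass p {s - 1<..<(s - 1) + 2}"
    using sq_mass_translate[OF per_l2D(1)[OF p], of s "-1" 1] by (simp add: add.commute)
  also have "\<dots> = sq_mass p {- 1<..<1}" by (rule sq_mass_period[OF per_l2D(1,2)[OF p]])
  finally have eq: "sq_mass (\<lambda>u. p (s + u)) {- 1<..<1} = sq_mass p {- 1<..<1}" .
  have m: "(\<lambda>u. p (s + u)) \<in> borel_measurable borel" by measurable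
  have sq: "(\<lambda>u. p (s + u)) \<in> sq_int (ivl (-1) 1)"
    using per_l2D(3)[OF p] eq by (simp add: sq_int_iff_sq_mass m per_l2D(1)[OF p])
  then show "(\<lambda>u. p (s + u)) \<in> per_l2"
    using m per_l2D(2)[OF p] by (simp add: per_l2_def flip: add.assoc)
  have "ennreal ((l2n (ivl (-1) 1) (\<lambda>u. p (s + u)))\<^sup>2) = ennreal ((l2n (ivl (-1) 1) p)\<^sup>2)"
    using eq by (simp add: ennreal_l2n_sq_mass sq per_l2D(3)[OF p])
  then show "l2n (ivl (-1) 1) (\<lambda>u. p (s + u)) = l2n (ivl (-1) 1) p" by simp
qed

lemma per_l2_reflect:
  assumes p: "p \<in> per_l2"
  shows "(\<lambda>u. p (- u)) \<in> per_l2" "l2n (ivl (-1) 1) (\<lambda>u. p (- u)) = l2n (ivl (-1) 1) p"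
proof -
  note [measurable] = per_l2D(1)[OF p]
  have eq: "sq_mass (\<lambda>u. p (- u)) {- 1<..<1} = sq_mass p {- 1<..<1}"
    using sq_mass_reflect[OF per_l2D(1)[OF p], of "-1" 1] by simp
  have m: "(\<lambda>u. p (- u)) \<in> borel_measurable borel" by measurable
  have sq: "(\<lambda>u. p (- u)) \<in> sq_int (ivl (-1) 1)"
    using per_l2D(3)[OF p] eq by (simp add: sq_int_iff_sq_mass m per_l2D(1)[OF p])
  have "p (- (u + 2)) = p (- u)" for u
    using per_l2D(2)[OF p, of "- (u + 2)"] by simp
  then show "(\<lambda>u. p (- u)) \<in> per_l2"
    using m sq by (simp add: per_l2_def)
  have "ennreal ((l2n (ivl (-1) 1) (\<lambda>u. p (- u)))\<^sup>2) = ennreal ((l2n (ivl (-1) 1) p)\<^sup>2)"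
    using eq by (simp add: ennreal_l2n_sq_mass sq per_l2D(3)[OF p])
  then show "l2n (ivl (-1) 1) (\<lambda>u. p (- u)) = l2n (ivl (-1) 1) p" by simp
qed

lemma per_l2_lincomb:
  assumes "p \<in> per_l2" "q \<in> per_l2"
  shows "(\<lambda>u. \<alpha> * p u + \<beta> * q u) \<in> per_l2"
  using assms sq_int_lincomb[of p "ivl (-1) 1" q \<alpha> \<beta>] unfolding per_l2_def by auto

lemma per_l2_diff: "p \<in> per_l2 \<Longrightarrow> q \<in> per_l2 \<Longrightarrow> (\<lambda>u. p u - q u) \<in> per_l2"
  using per_l2_lincomb[of p q 1 "-1"] by simp

lemma sq_int_subinterval:
  assumes f: "f \<in> sq_int (ivl a b)" and sub: "a \<le> c" "d \<le> b" and m: "f \<in> borel_measurable borel"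
  shows "f \<in> sq_int (ivl c d)" "l2n (ivl c d) f \<le> l2n (ivl a b) f"
proof -
  have le: "sq_mass f {c<..<d} \<le> sq_mass f {a<..<b}"
    unfolding sq_mass_def using sub by (intro nn_integral_mono) (auto simp: indicator_def)
  then show s: "f \<in> sq_int (ivl c d)"
    using f by (simp add: sq_int_iff_sq_mass[OF m] order.strict_trans1)
  have "ennreal ((l2n (ivl c d) f)\<^sup>2) \<le> ennreal ((l2n (ivl a b) f)\<^sup>2)"
    using le f s by (simp add: ennreal_l2n_sq_mass)
  then have "(l2n (ivl c d) f)\<^sup>2 \<le> (l2n (ivl a b) f)\<^sup>2" by simp
  then show "l2n (ivl c d) f \<le> l2n (ivl a b) f" by (rule power2_le_imp_le) simp
qed

lemma per_l2_half:
  assumes "p \<in> per_l2"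
  shows "p \<in> sq_int (ivl 0 1)" "l2n (ivl 0 1) p \<le> l2n (ivl (-1) 1) p"
  using sq_int_subinterval[OF per_l2D(3)[OF assms], of 0 1] per_l2D(1)[OF assms] by auto

lemma l2n_halves:
  assumes p: "p \<in> per_l2"
  shows "(l2n (ivl (-1) 1) p)\<^sup>2 = (l2n (ivl 0 1) p)\<^sup>2 + (l2n (ivl 0 1) (\<lambda>u. p (- u)))\<^sup>2"
proof -
  note m = per_l2D(1)[OF p]
  have "ennreal ((l2n (ivl (-1) 1) p)\<^sup>2) = sq_mass p {- 1<..<0} + sq_mass p {0<..<1}"
    using sq_mass_split[OF m, of "-1" 0 1] per_l2D(3)[OF p] by (simp add: ennreal_l2n_sq_mass)
  also have "sq_mass p {- 1<..<0} = sq_mass (\<lambda>u. p (- u)) {0<..<1}"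
    using sq_mass_reflect[OF m, of 0 1] by simp
  also have "sq_mass (\<lambda>u. p (- u)) {0<..<1} + sq_mass p {0<..<1}
    = ennreal ((l2n (ivl 0 1) (\<lambda>u. p (- u)))\<^sup>2 + (l2n (ivl 0 1) p)\<^sup>2)"
    using per_l2_half(1)[OF p] per_l2_half(1)[OF per_l2_reflect(1)[OF p]]
    by (simp add: ennreal_plus flip: ennreal_l2n_sq_mass)
  finally have "(l2n (ivl (-1) 1) p)\<^sup>2 = (l2n (ivl 0 1) (\<lambda>u. p (- u)))\<^sup>2 + (l2n (ivl 0 1) p)\<^sup>2"
    by (subst (asm) ennreal_inj) auto
  then show ?thesis by simp
qed

section \<open>Density of smooth periodic profiles and continuity of translation\<close>

definition C2_per :: "(real \<Rightarrow> real) \<Rightarrow> (real \<Rightarrow> real) \<Rightarrow> (real \<Rightarrow> real) \<Rightarrow> bool" where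
  "C2_per q q' q'' \<longleftrightarrow> (\<forall>u. q (u + 2) = q u) \<and> (\<forall>u. (q has_real_derivative q' u) (at u)) \<and>
    (\<forall>u. (q' has_real_derivative q'' u) (at u)) \<and> continuous_on UNIV q''"

lemma C2_per_continuous:
  assumes "C2_per q q' q''"
  shows "continuous_on UNIV q" "continuous_on UNIV q'" "continuous_on UNIV q''" "q \<in> per_l2"
proof -
  show q: "continuous_on UNIV q" "continuous_on UNIV q'" "continuous_on UNIV q''"
    using assms unfolding C2_per_def by (auto intro!: DERIV_continuous_on)
  have "q \<in> borel_measurable borel" by (rule borel_measurable_continuous_onI[OF q(1)])
  moreover have "q \<in> sq_int (ivl (-1) 1)"
    by (intro continuous_sq_int_ivl continuous_on_subset[OF q(1)]) auto
  ultimately show "q \<in> per_l2" using assms unfolding C2_per_def per_l2_def by auto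
qed

text \<open>On [0,1] the map x \<mapsto> cos (pi x) is inverted by arccos / pi, which gives the
  polynomials in the cosine. The factor sin (pi x) has no zero in the open interval, so as a weight
  it excludes no function.\<close>

lemma l2_dense_sin_poly_cos:
  assumes f: "f \<in> sq_int (ivl 0 1)" and e: "0 < e"
  shows "\<exists>R. l2n (ivl 0 1) (\<lambda>x. f x - sin (pi * x) * poly R (cos (pi * x))) < e"
    "\<exists>P. l2n (ivl 0 1) (\<lambda>x. f x - poly P (cos (pi * x))) < e"
proof -
  have D: "l2_dense (ivl 0 1) (range (\<lambda>p x. poly p (cos (pi * x))))"
  proof (rule l2_dense_poly_comp[where r = "\<lambda>y. arccos y / pi" and c = "-1" and d = 1])
    show "continuous_on {-1..1} (\<lambda>y. arccos y / pi)" by (intro continuous_intros) auto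
    show "arccos (cos (pi * x)) / pi = x" if "x \<in> {0..1}" for x
      using that by (subst arccos_cos) (auto simp: mult_left_le)
  qed (auto intro!: continuous_intros)
  have "\<exists>d\<in>range (\<lambda>p x. poly p (cos (pi * x))). l2n (ivl 0 1) (\<lambda>x. f x - sin (pi * x) * d x) < e"
  proof (rule l2_dense_weighted[OF D _ _ _ f _ e])
    show "(\<lambda>x. sin (pi * x)) \<in> borel_measurable (ivl 0 1)"
      by (intro continuous_on_measurable_lborel_on continuous_intros)
    have s: "0 < sin (pi * x)" if "x \<in> space (ivl 0 1)" for x
      using that by (intro sin_gt_zero) auto
    show "0 \<le> sin (pi * x)" if "x \<in> space (ivl 0 1)" for x using s[OF that] by simp
    show "f x = 0" if "x \<in> space (ivl 0 1)" "sin (pi * x) = 0" for x using s[OF that(1)] that(2) by simp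
    show "sin (pi * x) \<le> 1" for x by simp
  qed
  then show "\<exists>R. l2n (ivl 0 1) (\<lambda>x. f x - sin (pi * x) * poly R (cos (pi * x))) < e" by blast
  show "\<exists>P. l2n (ivl 0 1) (\<lambda>x. f x - poly P (cos (pi * x))) < e"
    using l2_denseD[OF D f e] by blast
qed

text \<open>Functions of the form P(cos) + sin R(cos) are closed under differentiation, so one
  derivative formula, applied twice, gives both derivatives.\<close>

lemma C2_per_trig:
  "\<exists>q' q''. C2_per (\<lambda>u. poly P (cos (pi * u)) + sin (pi * u) * poly R (cos (pi * u))) q' q''"
proof -
  have der: "((\<lambda>u. poly P (cos (pi * u)) + sin (pi * u) * poly R (cos (pi * u))) has_real_derivative
     poly (smult pi ([:0, 1:] * R - (1 - [:0, 0, 1:]) * pderiv R)) (cos (pi * u))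
       + sin (pi * u) * poly (smult (- pi) (pderiv P)) (cos (pi * u))) (at u)" for P R :: "real poly" and u
  proof -
    have c: "((\<lambda>u. cos (pi * u)) has_real_derivative - (pi * sin (pi * u))) (at u)"
      by (auto intro!: derivative_eq_intros)
    have s: "((\<lambda>u. sin (pi * u)) has_real_derivative pi * cos (pi * u)) (at u)"
      by (auto intro!: derivative_eq_intros)
    have pc: "((\<lambda>u. poly p (cos (pi * u))) has_real_derivative poly (pderiv p) (cos (pi * u)) * (- (pi * sin (pi * u)))) (at u)" for p
      by (rule DERIV_chain2[OF poly_DERIV c])
    \<comment> \<open>Replacing sin^2 by 1 - cos^2 brings the derivative back to the original form;
      \<open>[:0, 1:]\<close> is the polynomial X and \<open>1 - [:0, 0, 1:]\<close> is 1 -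
      X^2.\<close>
    have "sin (pi * u) * sin (pi * u) = 1 - cos (pi * u) * cos (pi * u)"
      using sin_cos_squared_add[of "pi * u"] by (simp add: power2_eq_square)
    then have s2: "sin (pi * u) * (sin (pi * u) * X) = X - cos (pi * u) * (cos (pi * u) * X)" for X
      by (simp add: left_diff_distrib flip: mult.assoc)
    have eq: "poly (smult pi ([:0, 1:] * R - (1 - [:0, 0, 1:]) * pderiv R)) (cos (pi * u))
       + sin (pi * u) * poly (smult (- pi) (pderiv P)) (cos (pi * u))
      = poly (pderiv P) (cos (pi * u)) * (- (pi * sin (pi * u)))
        + ((pi * cos (pi * u)) * poly R (cos (pi * u))
           + (poly (pderiv R) (cos (pi * u)) * (- (pi * sin (pi * u)))) * sin (pi * u))"
      by (simp add: algebra_simps s2)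
    show ?thesis unfolding eq by (rule DERIV_add[OF pc DERIV_mult[OF s pc]])
  qed
  have "C2_per (\<lambda>u. poly P (cos (pi * u)) + sin (pi * u) * poly R (cos (pi * u))) a b" 
    if "\<And>u. ((\<lambda>u. poly P (cos (pi * u)) + sin (pi * u) * poly R (cos (pi * u))) has_real_derivative a u) (at u)"
      "\<And>u. (a has_real_derivative b u) (at u)" "continuous_on UNIV b" for a b
  proof -
    have "cos (pi * (u + 2)) = cos (pi * u)" "sin (pi * (u + 2)) = sin (pi * u)" for u
      using cos_periodic[of "pi * u"] sin_periodic[of "pi * u"] by (simp_all add: algebra_simps)
    then show ?thesis using that unfolding C2_per_def by auto
  qed
  note C = this
  show ?thesis by (intro exI, rule C[OF der der]) (intro continuous_intros)
qed

text \<open>Split \<open>p\<close> into even and odd parts and approximate each on (0,1): the even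
  part by a polynomial in the cosine, the odd part by sine times such a polynomial. Parity carries
  both approximations over to (-1,0).\<close>

lemma C2_per_dense:
  assumes p: "p \<in> per_l2" and e: "0 < e"
  shows "\<exists>q q' q''. C2_per q q' q'' \<and> l2n (ivl (-1) 1) (\<lambda>u. p u - q u) < e"
proof -
  note r = per_l2_reflect(1)[OF p]
  let ?M = "ivl 0 1"
  note ps = per_l2_half(1)[OF p] and rs = per_l2_half(1)[OF r]
  have E: "(\<lambda>u. (1/2) * p u + (1/2) * p (- u)) \<in> sq_int ?M"
    and O: "(\<lambda>u. (1/2) * p u + (-1/2) * p (- u)) \<in> sq_int ?M"
    by (rule sq_int_lincomb[OF ps rs])+
  obtain P where P: "l2n ?M (\<lambda>x. ((1/2) * p x + (1/2) * p (- x)) - poly P (cos (pi * x))) < e / 4"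
    using l2_dense_sin_poly_cos(2)[OF E, of "e / 4"] e by auto
  obtain R where R: "l2n ?M (\<lambda>x. ((1/2) * p x + (-1/2) * p (- x)) - sin (pi * x) * poly R (cos (pi * x))) < e / 4"
    using l2_dense_sin_poly_cos(1)[OF O, of "e / 4"] e by auto
  define q where "q u = poly P (cos (pi * u)) + sin (pi * u) * poly R (cos (pi * u))" for u
  obtain q' q'' where q: "C2_per q q' q''" using C2_per_trig[of P R] unfolding q_def by blast
  note qp = C2_per_continuous(4)[OF q]
  note d = per_l2_diff[OF p qp]
  let ?A = "\<lambda>x. ((1/2) * p x + (1/2) * p (- x)) - poly P (cos (pi * x))"
  let ?B = "\<lambda>x. ((1/2) * p x + (-1/2) * p (- x)) - sin (pi * x) * poly R (cos (pi * x))"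
  have A: "?A \<in> sq_int ?M" by (rule sq_int_diff[OF E]) (intro continuous_sq_int_ivl continuous_intros)
  have B: "?B \<in> sq_int ?M" by (rule sq_int_diff[OF O]) (intro continuous_sq_int_ivl continuous_intros)
  have "(\<lambda>u. p u - q u) = (\<lambda>x. ?A x + ?B x)" by (auto simp: q_def)
  then have 1: "l2n ?M (\<lambda>u. p u - q u) \<le> e / 2" using l2n_triangle[OF A B] P R by simp
  have "(\<lambda>u. p (- u) - q (- u)) = (\<lambda>x. ?A x - ?B x)" by (auto simp: q_def)
  then have 2: "l2n ?M (\<lambda>u. p (- u) - q (- u)) \<le> e / 2" using l2n_triangle_diff[OF A B] P R by simp
  have "(l2n (ivl (-1) 1) (\<lambda>u. p u - q u))\<^sup>2 \<le> (e / 2)\<^sup>2 + (e / 2)\<^sup>2"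
    unfolding l2n_halves[OF d] using 1 2 by (intro add_mono power_mono) auto
  also have "\<dots> < e\<^sup>2" using e by (simp add: power2_eq_square)
  finally have "l2n (ivl (-1) 1) (\<lambda>u. p u - q u) < e" by (rule power2_less_imp_less) (use e in simp)
  with q show ?thesis by blast
qed

text \<open>Replace \<open>p\<close> by a continuous \<open>q\<close>: translation preserves the
  norm over a period, so the replacement costs the same at both times, and \<open>q\<close> itself
  is uniformly continuous on a bounded window.\<close>

lemma per_l2_translation_continuous:
  assumes p: "p \<in> per_l2"
  shows "((\<lambda>s. l2n (ivl (-1) 1) (\<lambda>u. p (s + u) - p (t + u))) \<longlongrightarrow> 0) (at t)"
proof (rule tendstoI)
  fix e :: real assume e: "0 < e"
  let ?M = "ivl (-1) 1"
  obtain q q' q'' where q: "C2_per q q' q''" "l2n ?M (\<lambda>u. p u - q u) < e / 4"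
    using C2_per_dense[OF p, of "e / 4"] e by auto
  note qp = C2_per_continuous(4)[OF q(1)]
  \<comment> \<open>The window contains \<open>t + u\<close> and \<open>s + u\<close> for all u in
    (-1,1) as soon as \<open>s\<close> is within 1 of \<open>t\<close>.\<close>
  have "uniformly_continuous_on {t - 2..t + 2} q"
    by (intro compact_uniformly_continuous continuous_on_subset[OF C2_per_continuous(1)[OF q(1)]]) auto
  moreover have "0 < e / 8" using e by simp
  ultimately obtain d where d: "0 < d" "\<And>x y. x \<in> {t - 2..t + 2} \<Longrightarrow> y \<in> {t - 2..t + 2} \<Longrightarrow> dist y x < d \<Longrightarrow> dist (q y) (q x) < e / 8"
    unfolding uniformly_continuous_on_def by meson
  show "\<forall>\<^sub>F s in at t. dist (l2n ?M (\<lambda>u. p (s + u) - p (t + u))) 0 < e"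
    unfolding eventually_at
  proof (intro exI[of _ "min d 1"] conjI ballI impI)
    fix s assume s: "s \<noteq> t \<and> dist s t < min d 1"
    note ps = per_l2D(3)[OF per_l2_translate(1)[OF p]] and qs = per_l2D(3)[OF per_l2_translate(1)[OF qp]]
    have m: "measure ?M (space ?M) = 2" by (simp add: measure_restrict_space)
    have "sqrt 2 < 2" by (simp add: real_sqrt_less_iff real_less_lsqrt)
    have "l2n ?M (\<lambda>u. q (s + u) - q (t + u)) \<le> (e / 8) * sqrt (measure ?M (space ?M))"
    proof (rule l2n_le_bound)
      show "(\<lambda>u. q (s + u) - q (t + u)) \<in> borel_measurable ?M"
        using sq_int_diff[OF qs qs] by (rule sq_int_measurable)
      show "\<bar>q (s + u) - q (t + u)\<bar> \<le> e / 8" if "u \<in> space ?M" for u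
        using d(2)[of "t + u" "s + u"] that s by (auto simp: dist_real_def abs_if split: if_splits)
    qed (use e in auto)
    also have "\<dots> < e / 4" unfolding m using e \<open>sqrt 2 < 2\<close> by simp
    finally have 2: "l2n ?M (\<lambda>u. q (s + u) - q (t + u)) < e / 4" .
    have tr: "l2n ?M (\<lambda>u. p (c + u) - q (c + u)) < e / 4" for c
      using per_l2_translate(2)[OF per_l2_diff[OF p qp], of c] q(2) by simp
    have "l2n ?M (\<lambda>u. p (s + u) - p (t + u)) \<le> l2n ?M (\<lambda>u. p (s + u) - q (s + u)) + l2n ?M (\<lambda>u. q (s + u) - p (t + u))"
      by (rule l2n_triangle3[OF ps qs ps])
    also have "l2n ?M (\<lambda>u. q (s + u) - p (t + u)) \<le> l2n ?M (\<lambda>u. q (s + u) - q (t + u)) + l2n ?M (\<lambda>u. q (t + u) - p (t + u))"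
      by (rule l2n_triangle3[OF qs qs ps])
    also have "l2n ?M (\<lambda>u. q (t + u) - p (t + u)) = l2n ?M (\<lambda>u. p (t + u) - q (t + u))"
      by (rule l2n_minus_commute)
    finally show "dist (l2n ?M (\<lambda>u. p (s + u) - p (t + u))) 0 < e"
      using tr[of s] tr[of t] 2 e by simp
  qed (use d(1) in auto)
qed

lemma integral_mult_tendsto2:
  assumes f: "\<And>n. f n \<in> sq_int M" "f' \<in> sq_int M" "(\<lambda>n. l2n M (\<lambda>x. f n x - f' x)) \<longlonglongrightarrow> 0"
    and g: "\<And>n. g n \<in> sq_int M" "g' \<in> sq_int M" "(\<lambda>n. l2n M (\<lambda>x. g n x - g' x)) \<longlonglongrightarrow> 0"
  shows "(\<lambda>n. \<integral>x. f n x * g n x \<partial>M) \<longlonglongrightarrow> (\<integral>x. f' x * g' x \<partial>M)"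
proof -
  have 0: "(\<lambda>n. \<integral>x. f n x * (g n x - g' x) \<partial>M) \<longlonglongrightarrow> 0"
  proof (rule Lim_null_comparison)
    show "\<forall>\<^sub>F n in sequentially. norm (\<integral>x. f n x * (g n x - g' x) \<partial>M) \<le> l2n M (f n) * l2n M (\<lambda>x. g n x - g' x)"
      using l2n_Cauchy_Schwarz[OF f(1) sq_int_diff[OF g(1,2)]] by simp
    have "(\<lambda>n. l2n M (f n) * l2n M (\<lambda>x. g n x - g' x)) \<longlonglongrightarrow> l2n M f' * 0"
      by (intro tendsto_mult l2n_tendsto f g(3))
    then show "(\<lambda>n. l2n M (f n) * l2n M (\<lambda>x. g n x - g' x)) \<longlonglongrightarrow> 0" by simp
  qed
  have "(\<lambda>n. (\<integral>x. f n x * g' x \<partial>M) + (\<integral>x. f n x * (g n x - g' x) \<partial>M)) \<longlonglongrightarrow> (\<integral>x. f' x * g' x \<partial>M) + 0"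
    by (intro tendsto_add integral_mult_tendsto f g(2) 0)
  moreover have "(\<integral>x. f n x * g' x \<partial>M) + (\<integral>x. f n x * (g n x - g' x) \<partial>M) = (\<integral>x. f n x * g n x \<partial>M)" for n
    using integrable_mult_sq_int[OF f(1)[of n] g(2)] integrable_mult_sq_int[OF f(1)[of n] sq_int_diff[OF g(1)[of n] g(2)]]
    by (subst Bochner_Integration.integral_add[symmetric]) (auto simp: right_diff_distrib)
  ultimately show ?thesis by simp
qed

subsection \<open>D'Alembert's formula\<close>

text \<open>A general solution p(t + x) + r(t - x) vanishes at x = 0 only if r = -p, and then at x =
  1 only if p has period 2.\<close>

definition dalembert :: "(real \<Rightarrow> real) \<Rightarrow> real \<times> real \<Rightarrow> real" where
  "dalembert p = (\<lambda>(x, t). p (t + x) - p (t - x))"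

text \<open>The velocity \<open>\<phi>\<^sub>t(\<cdot>,t)\<close> of \<open>\<phi> = dalembert p\<close> is the derivative of
  \<open>dalembert_flux p t\<close>.\<close>

definition dalembert_flux :: "(real \<Rightarrow> real) \<Rightarrow> real \<Rightarrow> real \<Rightarrow> real" where
  "dalembert_flux p t x = p (t + x) + p (t - x)"

lemma per_l2_shift_reflect:
  assumes "p \<in> per_l2"
  shows "(\<lambda>x. p (t - x)) \<in> per_l2" "l2n (ivl (-1) 1) (\<lambda>x. p (t - x)) = l2n (ivl (-1) 1) p"
  using per_l2_reflect[OF per_l2_translate(1)[OF assms, of t]] per_l2_translate(2)[OF assms, of t] by simp_all

lemma dalembert_slice:
  assumes p: "p \<in> per_l2"
  shows "(\<lambda>x. dalembert p (x, t)) \<in> sq_int (ivl 0 1)"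
    "l2n (ivl 0 1) (\<lambda>x. dalembert p (x, t)) \<le> 2 * l2n (ivl (-1) 1) p"
    "dalembert_flux p t \<in> sq_int (ivl 0 1)"
    "l2n (ivl 0 1) (dalembert_flux p t) \<le> 2 * l2n (ivl (-1) 1) p"
proof -
  note a = per_l2_translate[OF p, of t] and b = per_l2_shift_reflect[OF p, of t]
  note a' = per_l2_half[OF a(1)] and b' = per_l2_half[OF b(1)]
  show "(\<lambda>x. dalembert p (x, t)) \<in> sq_int (ivl 0 1)"
    unfolding dalembert_def using sq_int_diff[OF a'(1) b'(1)] by simp
  show "l2n (ivl 0 1) (\<lambda>x. dalembert p (x, t)) \<le> 2 * l2n (ivl (-1) 1) p"
    unfolding dalembert_def using l2n_triangle_diff[OF a'(1) b'(1)] a' b' a b by simp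
  show "dalembert_flux p t \<in> sq_int (ivl 0 1)"
    unfolding dalembert_flux_def using sq_int_add[OF a'(1) b'(1)] by simp
  show "l2n (ivl 0 1) (dalembert_flux p t) \<le> 2 * l2n (ivl (-1) 1) p"
    unfolding dalembert_flux_def using l2n_triangle[OF a'(1) b'(1)] a' b' a b by simp
qed

lemma dalembert_diff:
  "dalembert (\<lambda>u. p u - q u) z = dalembert p z - dalembert q z"
  "dalembert_flux (\<lambda>u. p u - q u) t x = dalembert_flux p t x - dalembert_flux q t x"
  by (auto simp: dalembert_def dalembert_flux_def split: prod.splits)

lemma dalembert_slice_continuous:
  assumes p: "p \<in> per_l2"
  shows "((\<lambda>s. l2n (ivl 0 1) (\<lambda>x. dalembert p (x, s) - dalembert p (x, t))) \<longlongrightarrow> 0) (at t)"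
    "((\<lambda>s. l2n (ivl 0 1) (\<lambda>x. dalembert_flux p s x - dalembert_flux p t x)) \<longlongrightarrow> 0) (at t)"
proof -
  let ?N = "\<lambda>s. l2n (ivl (-1) 1) (\<lambda>u. p (s + u) - p (t + u))"
  have lim: "((\<lambda>s. 2 * ?N s) \<longlongrightarrow> 0) (at t)"
    using tendsto_mult_left[OF per_l2_translation_continuous[OF p, of t], of 2] by simp
  have b: "l2n (ivl 0 1) (\<lambda>x. dalembert p (x, s) - dalembert p (x, t)) \<le> 2 * ?N s"
    "l2n (ivl 0 1) (\<lambda>x. dalembert_flux p s x - dalembert_flux p t x) \<le> 2 * ?N s" for s
  proof -
    \<comment> \<open>The difference between two times is the slice at time 0 belonging to the
      difference of two translates of the profile.\<close>
    define r where "r u = p (s + u) - p (t + u)" for u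
    have r: "r \<in> per_l2"
      unfolding r_def by (rule per_l2_diff[OF per_l2_translate(1)[OF p] per_l2_translate(1)[OF p]])
    have "dalembert p (x, s) - dalembert p (x, t) = dalembert r (x, 0)"
      "dalembert_flux p s x - dalembert_flux p t x = dalembert_flux r 0 x" for x
      by (auto simp: r_def dalembert_def dalembert_flux_def)
    then show "l2n (ivl 0 1) (\<lambda>x. dalembert p (x, s) - dalembert p (x, t)) \<le> 2 * ?N s"
      "l2n (ivl 0 1) (\<lambda>x. dalembert_flux p s x - dalembert_flux p t x) \<le> 2 * ?N s"
      using dalembert_slice(2,4)[OF r, of 0] by (simp_all add: r_def[symmetric])
  qed
  show "((\<lambda>s. l2n (ivl 0 1) (\<lambda>x. dalembert p (x, s) - dalembert p (x, t))) \<longlongrightarrow> 0) (at t)"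
    by (rule Lim_null_comparison[OF _ lim]) (use b(1) in auto)
  show "((\<lambda>s. l2n (ivl 0 1) (\<lambda>x. dalembert_flux p s x - dalembert_flux p t x)) \<longlongrightarrow> 0) (at t)"
    by (rule Lim_null_comparison[OF _ lim]) (use b(2) in auto)
qed

lemma dalembert_measurable:
  assumes "p \<in> borel_measurable borel"
  shows "dalembert p \<in> borel_measurable borel"
proof -
  note [measurable] = assms
  have "(\<lambda>(x, t). p (t + x) - p (t - x)) \<in> borel_measurable (borel \<Otimes>\<^sub>M borel)" by measurable
  then show ?thesis unfolding dalembert_def by (simp add: borel_prod)
qed

lemma Q_borel [measurable, simp]: "Q T \<in> sets borel"
  unfolding Q_def by (intro borel_open open_Times) auto

lemma dalembert_C0_L2:
  assumes p: "p \<in> per_l2"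
  shows "C0_L2 T (dalembert p)"
  unfolding C0_L2_def
proof (intro conjI ballI)
  show "set_borel_measurable lborel (Q T) (dalembert p)"
    using dalembert_measurable[OF per_l2D(1)[OF p]]
    by (simp add: set_borel_measurable_lborel_on borel_measurable_lborel_on)
  show "(\<lambda>x. dalembert p (x, t)) \<in> L2 Omega" for t
    using dalembert_slice(1)[OF p] by (simp add: L2_Omega)
  show "((\<lambda>s. L2_norm Omega (\<lambda>x. dalembert p (x, s) - dalembert p (x, t))) \<longlongrightarrow> 0) (at t within {0..T})" for t
    unfolding L2_norm_Omega by (rule tendsto_within_subset[OF dalembert_slice_continuous(1)[OF p]]) simp
qed

lemma integral_deriv_ivl:
  assumes "a \<le> b" "\<And>x. x \<in> {a..b} \<Longrightarrow> (F has_real_derivative g x) (at x within {a..b})"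
    and "continuous_on {a..b} g"
  shows "(\<integral>x. g x \<partial>ivl a b) = F b - F a"
  using primitive_deriv[OF assms(2,3), of b] assms(1) by (simp add: integral_eq_primitive)

lemma integral_ivl_eq:
  fixes g :: "real \<Rightarrow> real"
  assumes "continuous_on {a..b} g"
  shows "(\<integral>x. g x \<partial>ivl a b) = integral {a..b} g"
proof -
  have "set_integrable lborel {a<..<b} g"
    using sq_int_imp_integrable[OF finite_measure_ivl continuous_sq_int_ivl[OF assms]]
    by (simp add: set_integrable_lborel_on)
  from set_borel_integral_eq_integral(2)[OF this] show ?thesis
    by (simp add: set_integral_lborel_on integral_open_interval_real)
qed

text \<open>Time and space derivatives swap roles: \<phi>_t is the x-derivative of the flux, and the
  test function absorbs this derivative by parts with no boundary term.\<close>

lemma dalembert_C2_duality_deriv: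
  assumes q: "C2_per q q' q''" and \<psi>: "\<psi> \<in> C1c 0 1"
  shows "((\<lambda>t. \<integral>x. dalembert q (x, t) * \<psi> x \<partial>ivl 0 1)
     has_real_derivative - (\<integral>x. dalembert_flux q t x * deriv \<psi> x \<partial>ivl 0 1)) (at t)"
proof -
  note qc = C2_per_continuous[OF q]
  have dq: "(q has_real_derivative q' u) (at u)" for u using q by (simp add: C2_per_def)
  note [continuous_intros] = continuous_on_compose2[OF qc(1)] continuous_on_compose2[OF qc(2)]
    continuous_on_compose2[OF C1c_D(3)[OF \<psi>]] continuous_on_compose2[OF C1c_D(2)[OF \<psi>]]
  let ?f = "\<lambda>t x. (q (t + x) - q (t - x)) * \<psi> x"
  let ?g = "\<lambda>t x. (q' (t + x) - q' (t - x)) * \<psi> x"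
  have "((\<lambda>t. integral (cbox 0 1) (?f t)) has_field_derivative integral (cbox 0 1) (?g t)) (at t within UNIV)"
  proof (rule leibniz_rule_field_derivative)
    show "((\<lambda>t. ?f t x) has_field_derivative ?g t x) (at t within UNIV)" for t x
      by (auto intro!: derivative_eq_intros DERIV_chain2[OF dq])
    show "?f t integrable_on cbox 0 1" for t
      by (intro integrable_continuous continuous_intros) auto
    show "continuous_on (UNIV \<times> cbox 0 1) (\<lambda>(t, x). ?g t x)"
      unfolding split_beta by (intro continuous_intros) auto
  qed auto
  moreover have "integral (cbox 0 1) (?f t) = (\<integral>x. dalembert q (x, t) * \<psi> x \<partial>ivl 0 1)" for t
  proof -
    have "continuous_on {0..1} (?f t)" by (intro continuous_intros) auto
    from integral_ivl_eq[OF this] show ?thesis by (simp add: dalembert_def)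
  qed
  moreover have "integral (cbox 0 1) (?g t) = - (\<integral>x. dalembert_flux q t x * deriv \<psi> x \<partial>ivl 0 1)"
  proof -
    have c1: "continuous_on {0..1} (?g t)" by (intro continuous_intros) auto
    have c2: "continuous_on {0..1} (\<lambda>x. dalembert_flux q t x * deriv \<psi> x)"
      unfolding dalembert_flux_def by (intro continuous_intros) auto
    have "(\<integral>x. ?g t x + dalembert_flux q t x * deriv \<psi> x \<partial>ivl 0 1)
        = dalembert_flux q t 1 * \<psi> 1 - dalembert_flux q t 0 * \<psi> 0"
    proof (rule integral_deriv_ivl)
      fix x :: real
      have "((\<lambda>x. (q (t + x) + q (t - x)) * \<psi> x) has_real_derivative
          ?g t x + (q (t + x) + q (t - x)) * deriv \<psi> x) (at x)"
        by (auto intro!: derivative_eq_intros DERIV_chain2[OF dq] C1c_D(1)[OF \<psi>])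
      then show "((\<lambda>x. dalembert_flux q t x * \<psi> x) has_real_derivative
          ?g t x + dalembert_flux q t x * deriv \<psi> x) (at x within {0..1})"
        unfolding dalembert_flux_def by (rule DERIV_subset) simp
    qed (use c1 c2 in \<open>auto intro: continuous_on_add\<close>)
    also have "\<dots> = 0" using C1c_D(4)[OF \<psi>, of 0] C1c_D(4)[OF \<psi>, of 1] by simp
    finally have "(\<integral>x. ?g t x \<partial>ivl 0 1) + (\<integral>x. dalembert_flux q t x * deriv \<psi> x \<partial>ivl 0 1) = 0"
      using sq_int_imp_integrable[OF finite_measure_ivl continuous_sq_int_ivl[OF c1]]
        sq_int_imp_integrable[OF finite_measure_ivl continuous_sq_int_ivl[OF c2]]
      by simp
    then show ?thesis using integral_ivl_eq[OF c1] by simp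
  qed
  ultimately show ?thesis by simp
qed

text \<open>Mean value theorem in time. The estimate contains neither derivatives of
  \<open>q\<close> nor a division by \<open>s - t\<close>, so it is stable under L^2 limits in
  \<open>q\<close> and H^1 limits in \<open>\<psi>\<close>.\<close>

lemma dalembert_C2_duality_bound:
  assumes q: "C2_per q q' q''" and \<psi>: "\<psi> \<in> C1c 0 1"
    and K: "\<And>\<tau>. \<bar>\<tau> - t\<bar> \<le> \<bar>s - t\<bar> \<Longrightarrow> l2n (ivl 0 1) (\<lambda>x. dalembert_flux q \<tau> x - dalembert_flux q t x) \<le> K"
  shows "\<bar>(\<integral>x. dalembert q (x, s) * \<psi> x \<partial>ivl 0 1) - (\<integral>x. dalembert q (x, t) * \<psi> x \<partial>ivl 0 1)
     + (s - t) * (\<integral>x. dalembert_flux q t x * deriv \<psi> x \<partial>ivl 0 1)\<bar> \<le> \<bar>s - t\<bar> * (K * l2n (ivl 0 1) (deriv \<psi>))"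
proof -
  let ?M = "\<lambda>t. \<integral>x. dalembert q (x, t) * \<psi> x \<partial>ivl 0 1"
  let ?m = "\<lambda>t. \<integral>x. dalembert_flux q t x * deriv \<psi> x \<partial>ivl 0 1"
  note D = dalembert_C2_duality_deriv[OF q \<psi>]
  note qp = C2_per_continuous(4)[OF q]
  note fs = dalembert_slice(3)[OF qp] and ds = C1c_deriv_sq_int[OF \<psi>]
  have "\<exists>\<tau>. \<bar>\<tau> - t\<bar> \<le> \<bar>s - t\<bar> \<and> ?M s - ?M t = (s - t) * - ?m \<tau>"
  proof -
    consider "s < t" | "s = t" | "t < s" by linarith
    then show ?thesis
    proof cases
      case 1
      obtain \<tau> where \<tau>: "s < \<tau>" "\<tau> < t" "?M t - ?M s = (t - s) * - ?m \<tau>"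
        using MVT2[OF 1, of ?M "\<lambda>\<tau>. - ?m \<tau>"] D by blast
      then show ?thesis by (intro exI[of _ \<tau>]) (auto simp: algebra_simps)
    next
      case 2
      then show ?thesis by auto
    next
      case 3
      obtain \<tau> where \<tau>: "t < \<tau>" "\<tau> < s" "?M s - ?M t = (s - t) * - ?m \<tau>"
        using MVT2[OF 3, of ?M "\<lambda>\<tau>. - ?m \<tau>"] D by blast
      then show ?thesis by (intro exI[of _ \<tau>]) auto
    qed
  qed
  then obtain \<tau> where \<tau>: "\<bar>\<tau> - t\<bar> \<le> \<bar>s - t\<bar>" "?M s - ?M t = (s - t) * - ?m \<tau>" by blast
  have "?m \<tau> - ?m t = (\<integral>x. (dalembert_flux q \<tau> x - dalembert_flux q t x) * deriv \<psi> x \<partial>ivl 0 1)"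
    using integrable_mult_sq_int[OF fs ds] by (simp add: left_diff_distrib)
  also have "\<bar>\<dots>\<bar> \<le> l2n (ivl 0 1) (\<lambda>x. dalembert_flux q \<tau> x - dalembert_flux q t x) * l2n (ivl 0 1) (deriv \<psi>)"
    by (rule l2n_Cauchy_Schwarz[OF sq_int_diff[OF fs fs] ds])
  also have "\<dots> \<le> K * l2n (ivl 0 1) (deriv \<psi>)" by (intro mult_right_mono K[OF \<tau>(1)]) simp
  finally have "\<bar>s - t\<bar> * \<bar>?m \<tau> - ?m t\<bar> \<le> \<bar>s - t\<bar> * (K * l2n (ivl 0 1) (deriv \<psi>))"
    by (intro mult_left_mono) auto
  moreover have "?M s - ?M t + (s - t) * ?m t = - ((s - t) * (?m \<tau> - ?m t))"
    using \<tau>(2) by (simp add: algebra_simps)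
  ultimately show ?thesis by (simp add: abs_mult)
qed

lemma C2_per_sequence:
  assumes p: "p \<in> per_l2"
  obtains q q' q'' :: "nat \<Rightarrow> real \<Rightarrow> real" where "\<And>n. C2_per (q n) (q' n) (q'' n)"
    "(\<lambda>n. l2n (ivl (-1) 1) (\<lambda>u. q n u - p u)) \<longlonglongrightarrow> 0"
proof -
  have "\<forall>n. \<exists>r. C2_per (fst r) (fst (snd r)) (snd (snd r)) \<and> l2n (ivl (-1) 1) (\<lambda>u. p u - fst r u) < inverse (real (Suc n))"
  proof
    fix n
    have "0 < inverse (real (Suc n))" by simp
    from C2_per_dense[OF p this] obtain q q' q'' where
      "C2_per q q' q''" "l2n (ivl (-1) 1) (\<lambda>u. p u - q u) < inverse (real (Suc n))" by blast
    then show "\<exists>r. C2_per (fst r) (fst (snd r)) (snd (snd r)) \<and> l2n (ivl (-1) 1) (\<lambda>u. p u - fst r u) < inverse (real (Suc n))"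
      by (intro exI[of _ "(q, q', q'')"]) simp
  qed
  then obtain r where r: "\<forall>n. C2_per (fst (r n)) (fst (snd (r n))) (snd (snd (r n)))
      \<and> l2n (ivl (-1) 1) (\<lambda>u. p u - fst (r n) u) < inverse (real (Suc n))"
    by (rule choice[THEN exE])
  show ?thesis
  proof (rule that)
    show "C2_per (fst (r n)) (fst (snd (r n))) (snd (snd (r n)))" for n using r by blast
    show "(\<lambda>n. l2n (ivl (-1) 1) (\<lambda>u. fst (r n) u - p u)) \<longlonglongrightarrow> 0"
    proof (rule Lim_null_comparison[OF _ LIMSEQ_inverse_real_of_nat])
      have "l2n (ivl (-1) 1) (\<lambda>u. fst (r n) u - p u) \<le> inverse (real (Suc n))" for n
        using r l2n_minus_commute[of "ivl (-1) 1" p "fst (r n)"] less_imp_le by metis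
      then show "\<forall>\<^sub>F n in sequentially. norm (l2n (ivl (-1) 1) (\<lambda>u. fst (r n) u - p u)) \<le> inverse (real (Suc n))"
        by simp
    qed
  qed
qed

lemma dalembert_slice_tendsto:
  assumes p: "p \<in> per_l2" and q: "\<And>n. q n \<in> per_l2" "(\<lambda>n. l2n (ivl (-1) 1) (\<lambda>u. q n u - p u)) \<longlonglongrightarrow> 0"
  shows "(\<lambda>n. l2n (ivl 0 1) (\<lambda>x. dalembert (q n) (x, t) - dalembert p (x, t))) \<longlonglongrightarrow> 0"
    "(\<lambda>n. l2n (ivl 0 1) (\<lambda>x. dalembert_flux (q n) t x - dalembert_flux p t x)) \<longlonglongrightarrow> 0"
proof -
  have lim: "(\<lambda>n. 2 * l2n (ivl (-1) 1) (\<lambda>u. q n u - p u)) \<longlonglongrightarrow> 0"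
    using tendsto_mult_left[OF q(2), of 2] by simp
  show "(\<lambda>n. l2n (ivl 0 1) (\<lambda>x. dalembert (q n) (x, t) - dalembert p (x, t))) \<longlonglongrightarrow> 0"
    by (rule Lim_null_comparison[OF _ lim])
      (use dalembert_slice(2)[OF per_l2_diff[OF q(1) p]] in \<open>simp add: dalembert_diff\<close>)
  show "(\<lambda>n. l2n (ivl 0 1) (\<lambda>x. dalembert_flux (q n) t x - dalembert_flux p t x)) \<longlonglongrightarrow> 0"
    by (rule Lim_null_comparison[OF _ lim])
      (use dalembert_slice(4)[OF per_l2_diff[OF q(1) p]] in \<open>simp add: dalembert_diff [abs_def]\<close>)
qed

text \<open>The C^2 estimate in the limit, with \<open>q n\<close> tending to \<open>p\<close> and
  test functions tending to \<open>v\<close> in H^1.\<close>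

lemma dalembert_duality_bound:
  assumes p: "p \<in> per_l2" and v: "v \<in> H10"
    and K: "\<And>\<tau>. \<bar>\<tau> - t\<bar> \<le> \<bar>s - t\<bar> \<Longrightarrow> l2n (ivl 0 1) (\<lambda>x. dalembert_flux p \<tau> x - dalembert_flux p t x) \<le> K"
  shows "\<bar>(\<integral>x. dalembert p (x, s) * v x \<partial>ivl 0 1) - (\<integral>x. dalembert p (x, t) * v x \<partial>ivl 0 1)
     + (s - t) * (\<integral>x. dalembert_flux p t x * weak_deriv v x \<partial>ivl 0 1)\<bar> \<le> \<bar>s - t\<bar> * (K * H10_norm v)"
proof -
  let ?M = "ivl 0 1"
  obtain q q' q'' :: "nat \<Rightarrow> real \<Rightarrow> real" where q: "\<And>n. C2_per (q n) (q' n) (q'' n)"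
    "(\<lambda>n. l2n (ivl (-1) 1) (\<lambda>u. q n u - p u)) \<longlonglongrightarrow> 0"
    using C2_per_sequence[OF p] by blast
  note qp = C2_per_continuous(4)[OF q(1)]
  obtain \<psi> :: "nat \<Rightarrow> real \<Rightarrow> real" where \<psi>: "\<And>n. \<psi> n \<in> C1c 0 1"
      "(\<lambda>n. l2n ?M (\<lambda>x. \<psi> n x - v x)) \<longlonglongrightarrow> 0"
      "(\<lambda>n. l2n ?M (\<lambda>x. deriv (\<psi> n) x - weak_deriv v x)) \<longlonglongrightarrow> 0"
    using v unfolding H10_def by (auto simp: L2_norm_Omega)
  note V = H10_weak_deriv[OF v]
  note \<psi>s = C1c_sq_int[OF \<psi>(1)] and ds = C1c_deriv_sq_int[OF \<psi>(1)]
  note S = dalembert_slice(1,3)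
  note lim = dalembert_slice_tendsto[OF p qp q(2)]
  define N where "N n = l2n (ivl (-1) 1) (\<lambda>u. q n u - p u)" for n
  \<comment> \<open>Replacing \<open>p\<close> by \<open>q n\<close> changes the flux by at most
    \<open>2 * N n\<close> at each of the two times.\<close>
  have Kn: "l2n ?M (\<lambda>x. dalembert_flux (q n) \<tau> x - dalembert_flux (q n) t x) \<le> K + 4 * N n"
    if "\<bar>\<tau> - t\<bar> \<le> \<bar>s - t\<bar>" for \<tau> n
  proof -
    have e: "l2n ?M (\<lambda>x. dalembert_flux (q n) c x - dalembert_flux p c x) \<le> 2 * N n" for c
      using dalembert_slice(4)[OF per_l2_diff[OF qp p], of n c] by (simp add: dalembert_diff [abs_def] N_def)
    have "l2n ?M (\<lambda>x. dalembert_flux (q n) \<tau> x - dalembert_flux (q n) t x)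
      \<le> l2n ?M (\<lambda>x. dalembert_flux (q n) \<tau> x - dalembert_flux p \<tau> x)
        + l2n ?M (\<lambda>x. dalembert_flux p \<tau> x - dalembert_flux (q n) t x)"
      by (rule l2n_triangle3[OF S(2)[OF qp] S(2)[OF p] S(2)[OF qp]])
    also have "l2n ?M (\<lambda>x. dalembert_flux p \<tau> x - dalembert_flux (q n) t x)
      \<le> l2n ?M (\<lambda>x. dalembert_flux p \<tau> x - dalembert_flux p t x)
        + l2n ?M (\<lambda>x. dalembert_flux p t x - dalembert_flux (q n) t x)"
      by (rule l2n_triangle3[OF S(2)[OF p] S(2)[OF p] S(2)[OF qp]])
    also have "l2n ?M (\<lambda>x. dalembert_flux p t x - dalembert_flux (q n) t x)
      = l2n ?M (\<lambda>x. dalembert_flux (q n) t x - dalembert_flux p t x)" by (rule l2n_minus_commute)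
    finally show ?thesis using e[of \<tau>] e[of t] K[OF that] by linarith
  qed
  have ineq: "\<bar>(\<integral>x. dalembert (q n) (x, s) * \<psi> n x \<partial>?M) - (\<integral>x. dalembert (q n) (x, t) * \<psi> n x \<partial>?M)
     + (s - t) * (\<integral>x. dalembert_flux (q n) t x * deriv (\<psi> n) x \<partial>?M)\<bar>
     \<le> \<bar>s - t\<bar> * ((K + 4 * N n) * l2n ?M (deriv (\<psi> n)))" for n
    by (rule dalembert_C2_duality_bound[OF q(1) \<psi>(1) Kn])
  show ?thesis
  proof (rule LIMSEQ_le[OF _ _ exI[of _ 0]])
    show "(\<lambda>n. \<bar>(\<integral>x. dalembert (q n) (x, s) * \<psi> n x \<partial>?M) - (\<integral>x. dalembert (q n) (x, t) * \<psi> n x \<partial>?M)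
       + (s - t) * (\<integral>x. dalembert_flux (q n) t x * deriv (\<psi> n) x \<partial>?M)\<bar>)
      \<longlonglongrightarrow> \<bar>(\<integral>x. dalembert p (x, s) * v x \<partial>?M) - (\<integral>x. dalembert p (x, t) * v x \<partial>?M)
       + (s - t) * (\<integral>x. dalembert_flux p t x * weak_deriv v x \<partial>?M)\<bar>"
      by (intro tendsto_intros integral_mult_tendsto2 S[OF qp] S[OF p] lim \<psi>s ds V(1,2) \<psi>(2,3))
    have "(\<lambda>n. \<bar>s - t\<bar> * ((K + 4 * N n) * l2n ?M (deriv (\<psi> n)))) \<longlonglongrightarrow> \<bar>s - t\<bar> * ((K + 4 * 0) * l2n ?M (weak_deriv v))"
      unfolding N_def by (intro tendsto_intros l2n_tendsto ds V(2) \<psi>(3) q(2))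
    then show "(\<lambda>n. \<bar>s - t\<bar> * ((K + 4 * N n) * l2n ?M (deriv (\<psi> n)))) \<longlonglongrightarrow> \<bar>s - t\<bar> * (K * H10_norm v)"
      by (simp add: H10_norm_eq)
  qed (use ineq in blast)
qed

text \<open>The error of the difference quotient is bounded by the modulus of continuity of the flux
  times \<open>H10_norm v\<close>. Uniformity in \<open>v\<close> is what turns this into
  convergence in the dual norm.\<close>

lemma dalembert_C1_Hm1:
  assumes p: "p \<in> per_l2"
  shows "C1_Hm1 T (dalembert p) (\<lambda>t v. - (\<integral>x. dalembert_flux p t x * weak_deriv v x \<partial>ivl 0 1))"
  unfolding C1_Hm1_def
proof (intro ballI conjI)
  fix t
  let ?M = "ivl 0 1"
  let ?m = "\<lambda>t v. - (\<integral>x. dalembert_flux p t x * weak_deriv v x \<partial>?M)"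
  note F = dalembert_slice(3)[OF p]
  show "?m t \<in> Hm1"
    by (rule Hm1_I(1)[OF sq_int_uminus[OF F]]) simp
  have diff: "?m s v - ?m t v = (\<integral>x. (- (dalembert_flux p s x - dalembert_flux p t x)) * weak_deriv v x \<partial>?M)"
    if "v \<in> H10" for s v
    using integrable_mult_sq_int[OF F H10_weak_deriv(2)[OF that]] by (simp add: left_diff_distrib)
  have "0 \<le> Hm1_norm (\<lambda>v. ?m s v - ?m t v)"
    "Hm1_norm (\<lambda>v. ?m s v - ?m t v) \<le> l2n ?M (\<lambda>x. dalembert_flux p s x - dalembert_flux p t x)" for s
    using Hm1_I(2,3)[OF sq_int_uminus[OF sq_int_diff[OF F F]] diff] unfolding l2n_uminus by blast+
  then show "((\<lambda>s. Hm1_norm (\<lambda>v. ?m s v - ?m t v)) \<longlongrightarrow> 0) (at t within {0..T})"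
    by (intro Lim_null_comparison[OF _ tendsto_within_subset[OF dalembert_slice_continuous(2)[OF p, of t] subset_UNIV]]) auto
  show "((\<lambda>s. Hm1_norm (\<lambda>v. (L2_inner (\<lambda>x. dalembert p (x, s)) v - L2_inner (\<lambda>x. dalembert p (x, t)) v) / (s - t)
      - ?m t v)) \<longlongrightarrow> 0) (at t within {0..T})"
  proof (rule tendstoI)
    fix e :: real assume e: "0 < e"
    have "\<forall>\<^sub>F s in at t. l2n ?M (\<lambda>x. dalembert_flux p s x - dalembert_flux p t x) < e / 2"
      using order_tendstoD(2)[OF dalembert_slice_continuous(2)[OF p, of t], of "e / 2"] e by simp
    then obtain d where d: "0 < d" "\<And>s. s \<noteq> t \<Longrightarrow> dist s t < d \<Longrightarrow>
        l2n ?M (\<lambda>x. dalembert_flux p s x - dalembert_flux p t x) < e / 2"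
      unfolding eventually_at by blast
    show "\<forall>\<^sub>F s in at t within {0..T}. dist (Hm1_norm (\<lambda>v. (L2_inner (\<lambda>x. dalembert p (x, s)) v
        - L2_inner (\<lambda>x. dalembert p (x, t)) v) / (s - t) - ?m t v)) 0 < e"
      unfolding eventually_at
    proof (intro exI[of _ d] conjI ballI impI d(1))
      fix s assume s: "s \<noteq> t \<and> dist s t < d"
      have K: "l2n ?M (\<lambda>x. dalembert_flux p \<tau> x - dalembert_flux p t x) \<le> e / 2" if "\<bar>\<tau> - t\<bar> \<le> \<bar>s - t\<bar>" for \<tau>
      proof (cases "\<tau> = t")
        case False
        then show ?thesis using d(2)[of \<tau>] s that by (simp add: dist_real_def)
      qed (use e in simp)
      let ?L = "\<lambda>v. (L2_inner (\<lambda>x. dalembert p (x, s)) v - L2_inner (\<lambda>x. dalembert p (x, t)) v) / (s - t) - ?m t v"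
      have "\<bar>?L v\<bar> \<le> e / 2 * H10_norm v" if "v \<in> H10" for v
      proof -
        have "\<bar>?L v\<bar> = \<bar>(\<integral>x. dalembert p (x, s) * v x \<partial>ivl 0 1) - (\<integral>x. dalembert p (x, t) * v x \<partial>ivl 0 1)
          + (s - t) * (\<integral>x. dalembert_flux p t x * weak_deriv v x \<partial>ivl 0 1)\<bar> / \<bar>s - t\<bar>"
          unfolding L2_inner_ivl using s by (simp add: field_simps flip: abs_divide)
        also have "\<dots> \<le> \<bar>s - t\<bar> * (e / 2 * H10_norm v) / \<bar>s - t\<bar>"
          by (intro divide_right_mono dalembert_duality_bound[OF p that K]) auto
        also have "\<dots> = e / 2 * H10_norm v" using s by simp
        finally show ?thesis .
      qed
      from Hm1_norm_bound[OF this] e show "dist (Hm1_norm ?L) 0 < e" by simp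
    qed
  qed
qed

subsection \<open>Integration over the cylinder\<close>

text \<open>Both orders matter for Green's identity: the time derivatives of the adjoint solution
  are integrated in t first, the space derivatives in x first.\<close>

lemma Q_Fubini:
  fixes g :: "real \<times> real \<Rightarrow> real"
  assumes g: "integrable (lborel_on (Q T)) g"
  shows "(\<integral>z. g z \<partial>lborel_on (Q T)) = (\<integral>x. (\<integral>t. g (x, t) \<partial>ivl 0 T) \<partial>ivl 0 1)"
    "(\<integral>z. g z \<partial>lborel_on (Q T)) = (\<integral>t. (\<integral>x. g (x, t) \<partial>ivl 0 1) \<partial>ivl 0 T)"
    "integrable (ivl 0 T) (\<lambda>t. \<integral>x. g (x, t) \<partial>ivl 0 1)"
proof -
  define G where "G x t = indicator {0<..<1::real} x * (indicator {0<..<T} t * g (x, t))" for x t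
  have Geq: "(\<lambda>z. indicator (Q T) z *\<^sub>R g z) = case_prod G"
    by (auto simp: fun_eq_iff G_def Q_def indicator_def)
  have Gi: "integrable (lborel \<Otimes>\<^sub>M lborel) (case_prod G)"
    using g unfolding lborel_prod Geq[symmetric] by (subst (asm) integrable_restrict_space) auto
  have tot: "(\<integral>z. g z \<partial>lborel_on (Q T)) = integral\<^sup>L (lborel \<Otimes>\<^sub>M lborel) (case_prod G)"
    unfolding lborel_prod Geq[symmetric] by (subst integral_restrict_space) auto
  have i1: "(\<integral>t. G x t \<partial>lborel) = indicator {0<..<1} x *\<^sub>R (\<integral>t. g (x, t) \<partial>ivl 0 T)" for x
    unfolding G_def by (subst integral_restrict_space) auto
  have i2: "(\<integral>x. G x t \<partial>lborel) = indicator {0<..<T} t *\<^sub>R (\<integral>x. g (x, t) \<partial>ivl 0 1)" for t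
  proof -
    have "(\<integral>x. G x t \<partial>lborel) = (\<integral>x. indicator {0<..<T} t * (indicator {0<..<1} x *\<^sub>R g (x, t)) \<partial>lborel)"
      by (intro Bochner_Integration.integral_cong) (auto simp: G_def)
    then show ?thesis by (simp add: integral_restrict_space)
  qed
  show "(\<integral>z. g z \<partial>lborel_on (Q T)) = (\<integral>x. (\<integral>t. g (x, t) \<partial>ivl 0 T) \<partial>ivl 0 1)"
    unfolding tot lborel_pair.integral_fst[OF Gi, symmetric] i1 by (subst integral_restrict_space) auto
  show "(\<integral>z. g z \<partial>lborel_on (Q T)) = (\<integral>t. (\<integral>x. g (x, t) \<partial>ivl 0 1) \<partial>ivl 0 T)"
    unfolding tot lborel_pair.integral_snd[OF Gi, symmetric] i2 by (subst integral_restrict_space) auto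
  show "integrable (ivl 0 T) (\<lambda>t. \<integral>x. g (x, t) \<partial>ivl 0 1)"
    using lborel_pair.integrable_snd[OF Gi] unfolding i2 by (subst integrable_restrict_space) auto
qed

text \<open>Besides giving integrability on the cylinder, the case \<open>K = 0\<close> turns
  vanishing on almost every time slice into vanishing almost everywhere.\<close>

lemma sq_int_Q:
  fixes \<phi> :: "real \<times> real \<Rightarrow> real"
  assumes T: "0 \<le> T" and m: "\<phi> \<in> borel_measurable (lborel_on (Q T))" and K: "0 \<le> K"
    and sl: "AE t in ivl 0 T. (\<lambda>x. \<phi> (x, t)) \<in> sq_int (ivl 0 1) \<and> l2n (ivl 0 1) (\<lambda>x. \<phi> (x, t)) \<le> K"
  shows "\<phi> \<in> sq_int (lborel_on (Q T))" "l2n (lborel_on (Q T)) \<phi> \<le> sqrt T * K"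
proof -
  define f where "f z = ennreal ((\<phi> z)\<^sup>2) * indicator (Q T) z" for z
  have "(\<lambda>z. ennreal ((\<phi> z)\<^sup>2)) \<in> borel_measurable (lborel_on (Q T))" using m by measurable
  then have "f \<in> borel_measurable lborel"
    unfolding f_def by (subst (asm) borel_measurable_restrict_space_iff_ennreal) auto
  then have fm: "f \<in> borel_measurable (lborel \<Otimes>\<^sub>M lborel)" by (simp only: lborel_prod)
  have "(\<integral>\<^sup>+z. ennreal ((\<phi> z)\<^sup>2) \<partial>lborel_on (Q T)) = (\<integral>\<^sup>+z. f z \<partial>lborel)"
    unfolding f_def by (subst nn_integral_restrict_space) auto
  also have "\<dots> = (\<integral>\<^sup>+t. (\<integral>\<^sup>+x. f (x, t) \<partial>lborel) \<partial>lborel)"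
    using lborel_pair.nn_integral_snd[OF fm] by (simp only: lborel_prod)
  also have "\<dots> \<le> (\<integral>\<^sup>+t. ennreal (K\<^sup>2) * indicator {0<..<T} t \<partial>lborel)"
  proof (rule nn_integral_mono_AE)
    show "AE t in lborel. (\<integral>\<^sup>+x. f (x, t) \<partial>lborel) \<le> ennreal (K\<^sup>2) * indicator {0<..<T} t"
      using sl[unfolded AE_lborel_on[OF borel_open[OF open_greaterThanLessThan]]]
    proof eventually_elim
      case (elim t)
      show ?case
      proof (cases "t \<in> {0<..<T}")
        case True
        then have s: "(\<lambda>x. \<phi> (x, t)) \<in> sq_int (ivl 0 1)" "l2n (ivl 0 1) (\<lambda>x. \<phi> (x, t)) \<le> K" using elim by auto
        have "(\<integral>\<^sup>+x. f (x, t) \<partial>lborel) = (\<integral>\<^sup>+x. ennreal ((\<phi> (x, t))\<^sup>2) * indicator {0<..<1} x \<partial>lborel)"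
          using True by (intro nn_integral_cong) (auto simp: f_def Q_def indicator_def)
        also have "\<dots> = ennreal ((l2n (ivl 0 1) (\<lambda>x. \<phi> (x, t)))\<^sup>2)"
          unfolding ennreal_l2n_power2[OF s(1)] by (subst nn_integral_restrict_space) auto
        also have "\<dots> \<le> ennreal (K\<^sup>2)" using s(2) by (intro ennreal_leI power_mono) auto
        finally show ?thesis using True by simp
      next
        case False
        then have "f (x, t) = 0" for x by (auto simp: f_def Q_def indicator_def)
        then show ?thesis by simp
      qed
    qed
  qed
  also have "\<dots> = ennreal (K\<^sup>2) * ennreal T"
    using T by (subst nn_integral_cmult_indicator) auto
  also have "\<dots> = ennreal ((sqrt T * K)\<^sup>2)"
    using T by (simp add: power_mult_distrib mult.commute flip: ennreal_mult)
  finally have le: "(\<integral>\<^sup>+z. ennreal ((\<phi> z)\<^sup>2) \<partial>lborel_on (Q T)) \<le> ennreal ((sqrt T * K)\<^sup>2)" .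
  show "\<phi> \<in> sq_int (lborel_on (Q T))" "l2n (lborel_on (Q T)) \<phi> \<le> sqrt T * K"
    using sq_int_nn_integral[OF m le] T K by auto
qed

lemma bounded_Q: "bounded (Q T)"
  unfolding Q_def by (intro bounded_Times) auto

lemma finite_measure_Q [simp]: "finite_measure (lborel_on (Q T))"
  by (rule finite_measure_lborel_on[OF bounded_Q Q_borel])

lemma continuous_sq_int_Q:
  fixes f :: "real \<times> real \<Rightarrow> real"
  assumes "continuous_on ({0..1} \<times> {0..T}) f"
  shows "f \<in> sq_int (lborel_on (Q T))"
  by (rule continuous_sq_int_lborel_on[OF assms _ _ Q_borel]) (auto simp: Q_def intro!: compact_Times)

lemma dalembert_sq_int_Q:
  assumes T: "0 \<le> T" and p: "p \<in> per_l2"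
  shows "dalembert p \<in> sq_int (lborel_on (Q T))"
    "l2n (lborel_on (Q T)) (dalembert p) \<le> sqrt T * (2 * l2n (ivl (-1) 1) p)"
  using sq_int_Q[OF T borel_measurable_lborel_on[OF dalembert_measurable[OF per_l2D(1)[OF p]]],
      of "2 * l2n (ivl (-1) 1) p"] dalembert_slice(1,2)[OF p] by auto

subsection \<open>Transposition\<close>

text \<open>Green's identity. Since \<phi>_tt = \<phi>_xx, the integrand \<phi> f is (\<phi> w_tt -
  \<phi>_tt w) - (\<phi> w_xx - \<phi>_xx w), a t-derivative minus an x-derivative. Only the terms
  at t = 0 survive, and the velocity there is rewritten through the flux so that no derivative of
  \<open>q\<close> remains.\<close>

lemma transposition_C2:
  assumes T: "0 \<le> T" and q: "C2_per q q' q''" and w: "adjoint_solution T f w wt"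
  shows "\<exists>wx. continuous_on {0..1} wx \<and> (\<forall>x\<in>{0..1}. ((\<lambda>x. w (x, 0)) has_real_derivative wx x) (at x within {0..1})) \<and>
     w (0, 0) = 0 \<and> w (1, 0) = 0 \<and> continuous_on {0..1} (\<lambda>x. wt (x, 0)) \<and> continuous_on ({0..1} \<times> {0..T}) f \<and>
     (\<integral>z. dalembert q z * f z \<partial>lborel_on (Q T)) =
     - (\<integral>x. dalembert_flux q 0 x * wx x \<partial>ivl 0 1) - (\<integral>x. dalembert q (x, 0) * wt (x, 0) \<partial>ivl 0 1)"
proof -
  let ?R = "{0..1} \<times> {0..T}"
  obtain wx wxx wxt wtt where A:
    "(\<forall>g\<in>{w, wx, wt, wxx, wxt, wtt}. continuous_on ?R g) \<and>
     (\<forall>x\<in>{0..1}. \<forall>t\<in>{0..T}.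
        ((\<lambda>z. w (z, t)) has_real_derivative wx (x, t)) (at x within {0..1}) \<and>
        ((\<lambda>s. w (x, s)) has_real_derivative wt (x, t)) (at t within {0..T}) \<and>
        ((\<lambda>z. wx (z, t)) has_real_derivative wxx (x, t)) (at x within {0..1}) \<and>
        ((\<lambda>s. wx (x, s)) has_real_derivative wxt (x, t)) (at t within {0..T}) \<and>
        ((\<lambda>z. wt (z, t)) has_real_derivative wxt (x, t)) (at x within {0..1}) \<and>
        ((\<lambda>s. wt (x, s)) has_real_derivative wtt (x, t)) (at t within {0..T}) \<and>
        wtt (x, t) - wxx (x, t) = f (x, t)) \<and>
     (\<forall>t\<in>{0..T}. w (0, t) = 0 \<and> w (1, t) = 0) \<and>
     (\<forall>x\<in>{0..1}. w (x, T) = 0 \<and> wt (x, T) = 0)"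
    using w unfolding adjoint_solution_def by (elim exE) (rule that)
  note A1 = A[THEN conjunct1] and A2 = A[THEN conjunct2, THEN conjunct1]
    and A34 = A[THEN conjunct2, THEN conjunct2]
  note c = bspec[OF A1] and d = bspec[OF bspec[OF A2]]
    and bd = bspec[OF A34[THEN conjunct1]] and fin = bspec[OF A34[THEN conjunct2]]
  have cw: "continuous_on ?R w" "continuous_on ?R wt" "continuous_on ?R wx" "continuous_on ?R wtt" "continuous_on ?R wxx"
    by (intro c; simp)+
  have dx: "((\<lambda>z. w (z, t)) has_real_derivative wx (x, t)) (at x within {0..1})"
    "((\<lambda>z. wx (z, t)) has_real_derivative wxx (x, t)) (at x within {0..1})"
    and dt: "((\<lambda>s. w (x, s)) has_real_derivative wt (x, t)) (at t within {0..T})"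
    "((\<lambda>s. wt (x, s)) has_real_derivative wtt (x, t)) (at t within {0..T})"
    and feq: "f (x, t) = wtt (x, t) - wxx (x, t)"
    if "x \<in> {0..1}" "t \<in> {0..T}" for x t
    using d[OF that] by simp_all
  have fc: "continuous_on ?R f"
  proof -
    have "continuous_on ?R (\<lambda>z. wtt z - wxx z)" by (intro continuous_on_diff cw)
    then show ?thesis by (rule continuous_on_eq) (use feq in auto)
  qed
  have slx: "continuous_on {0..1} (\<lambda>x. g (x, t))" if "continuous_on ?R g" "t \<in> {0..T}" for g :: "real \<times> real \<Rightarrow> real" and t
    by (rule continuous_on_compose2[OF that(1)]) (use that(2) in \<open>auto intro!: continuous_intros\<close>)
  have slt: "continuous_on {0..T} (\<lambda>t. g (x, t))" if "continuous_on ?R g" "x \<in> {0..1}" for g :: "real \<times> real \<Rightarrow> real" and x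
    by (rule continuous_on_compose2[OF that(1)]) (use that(2) in \<open>auto intro!: continuous_intros\<close>)
  note qc = C2_per_continuous[OF q]
  have dq: "(q has_real_derivative q' u) (at u)" "(q' has_real_derivative q'' u) (at u)" for u
    using q by (simp_all add: C2_per_def)
  have per: "q (u + 2) = q u" for u using q by (simp add: C2_per_def)
  let ?\<phi> = "\<lambda>x t. q (t + x) - q (t - x)"
  let ?\<phi>t = "\<lambda>x t. q' (t + x) - q' (t - x)"
  let ?\<phi>x = "\<lambda>x t. q' (t + x) + q' (t - x)"
  let ?\<phi>2 = "\<lambda>x t. q'' (t + x) - q'' (t - x)"
  note [continuous_intros] = continuous_on_compose2[OF qc(1)] continuous_on_compose2[OF qc(2)] continuous_on_compose2[OF qc(3)]
  have c\<phi>: "continuous_on A (\<lambda>z. ?\<phi> (fst z) (snd z))" "continuous_on A (\<lambda>z. ?\<phi>2 (fst z) (snd z))" for A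
    by (intro continuous_intros; auto)+
  \<comment> \<open>The same \<open>?\<phi>2\<close> stands for \<phi>_tt in \<open>?F1\<close> and
    for \<phi>_xx in \<open>?F2\<close>; this is where the wave equation for \<open>q\<close>
    enters.\<close>
  let ?F1 = "\<lambda>z. ?\<phi> (fst z) (snd z) * wtt z - ?\<phi>2 (fst z) (snd z) * w z"
  let ?F2 = "\<lambda>z. ?\<phi> (fst z) (snd z) * wxx z - ?\<phi>2 (fst z) (snd z) * w z"
  have F1c: "continuous_on ?R ?F1" and F2c: "continuous_on ?R ?F2"
    by (intro continuous_on_diff continuous_on_mult c\<phi> cw)+
  have F1i: "integrable (lborel_on (Q T)) ?F1" and F2i: "integrable (lborel_on (Q T)) ?F2"
    using F1c F2c by (auto intro!: sq_int_imp_integrable continuous_sq_int_Q)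
  have I1: "(\<integral>t. ?F1 (x, t) \<partial>ivl 0 T) = ?\<phi>t x 0 * w (x, 0) - ?\<phi> x 0 * wt (x, 0)" if x: "x \<in> {0<..<1}" for x
  proof -
    have x': "x \<in> {0..1}" using x by simp
    have "(\<integral>t. ?F1 (x, t) \<partial>ivl 0 T) = (?\<phi> x T * wt (x, T) - ?\<phi>t x T * w (x, T)) - (?\<phi> x 0 * wt (x, 0) - ?\<phi>t x 0 * w (x, 0))"
    proof (rule integral_deriv_ivl[OF T])
      fix t assume t: "t \<in> {0..T}"
      have a: "(?\<phi> x has_real_derivative ?\<phi>t x t) (at t within {0..T})"
        "(?\<phi>t x has_real_derivative ?\<phi>2 x t) (at t within {0..T})"
        by (rule DERIV_subset[where s = UNIV], auto intro!: derivative_eq_intros DERIV_chain2[OF dq(1)] DERIV_chain2[OF dq(2)])+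
      have "((\<lambda>t. ?\<phi> x t * wt (x, t) - ?\<phi>t x t * w (x, t)) has_real_derivative
         (?\<phi>t x t * wt (x, t) + wtt (x, t) * ?\<phi> x t) - (?\<phi>2 x t * w (x, t) + wt (x, t) * ?\<phi>t x t)) (at t within {0..T})"
        by (intro DERIV_diff DERIV_mult a dt[OF x' t])
      then show "((\<lambda>t. ?\<phi> x t * wt (x, t) - ?\<phi>t x t * w (x, t)) has_real_derivative ?F1 (x, t)) (at t within {0..T})"
        by (simp add: algebra_simps)
    next
      show "continuous_on {0..T} (\<lambda>t. ?F1 (x, t))" by (rule slt[OF F1c x'])
    qed
    then show ?thesis using fin[OF x'] by simp
  qed
  have I2: "(\<integral>x. ?F2 (x, t) \<partial>ivl 0 1) = 0" if t: "t \<in> {0<..<T}" for t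
  proof -
    have t': "t \<in> {0..T}" using t by simp
    have "(\<integral>x. ?F2 (x, t) \<partial>ivl 0 1) = (?\<phi> 1 t * wx (1, t) - ?\<phi>x 1 t * w (1, t)) - (?\<phi> 0 t * wx (0, t) - ?\<phi>x 0 t * w (0, t))"
    proof (rule integral_deriv_ivl)
      fix x :: real assume x: "x \<in> {0..1}"
      have a: "((\<lambda>x. ?\<phi> x t) has_real_derivative ?\<phi>x x t) (at x within {0..1})"
        "((\<lambda>x. ?\<phi>x x t) has_real_derivative ?\<phi>2 x t) (at x within {0..1})"
        by (rule DERIV_subset[where s = UNIV], auto intro!: derivative_eq_intros DERIV_chain2[OF dq(1)] DERIV_chain2[OF dq(2)])+
      have "((\<lambda>x. ?\<phi> x t * wx (x, t) - ?\<phi>x x t * w (x, t)) has_real_derivative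
         (?\<phi>x x t * wx (x, t) + wxx (x, t) * ?\<phi> x t) - (?\<phi>2 x t * w (x, t) + wx (x, t) * ?\<phi>x x t)) (at x within {0..1})"
        by (intro DERIV_diff DERIV_mult a dx[OF x t'])
      then show "((\<lambda>x. ?\<phi> x t * wx (x, t) - ?\<phi>x x t * w (x, t)) has_real_derivative ?F2 (x, t)) (at x within {0..1})"
        by (simp add: algebra_simps)
    next
      show "continuous_on {0..1} (\<lambda>x. ?F2 (x, t))" by (rule slx[OF F2c t'])
    qed simp
    \<comment> \<open>The arguments \<open>t + 1\<close> and \<open>t - 1\<close> differ by one
      period.\<close>
    moreover have "?\<phi> 1 t = 0" using per[of "t - 1"] by (simp add: algebra_simps)
    ultimately show ?thesis using bd[OF t'] by simp
  qed
  have T0: "0 \<in> {0..T}" using T by simp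
  have cw0: "continuous_on {0..1} (\<lambda>x. w (x, 0))" "continuous_on {0..1} (\<lambda>x. wx (x, 0))" "continuous_on {0..1} (\<lambda>x. wt (x, 0))"
    using slx[OF cw(1) T0] slx[OF cw(3) T0] slx[OF cw(2) T0] by auto
  have c0: "continuous_on A (\<lambda>x. ?\<phi>t x 0)" "continuous_on A (\<lambda>x. ?\<phi> x 0)" "continuous_on A (dalembert_flux q 0)" for A
    unfolding dalembert_flux_def by (intro continuous_intros; auto)+
  have i: "integrable (ivl 0 1) (\<lambda>x. ?\<phi>t x 0 * w (x, 0))" "integrable (ivl 0 1) (\<lambda>x. ?\<phi> x 0 * wt (x, 0))"
    "integrable (ivl 0 1) (\<lambda>x. dalembert_flux q 0 x * wx (x, 0))"
    by (rule sq_int_imp_integrable[OF finite_measure_ivl continuous_sq_int_ivl],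
        rule continuous_on_mult[OF c0(1) cw0(1)] continuous_on_mult[OF c0(2) cw0(3)] continuous_on_mult[OF c0(3) cw0(2)])+
  \<comment> \<open>The initial velocity is the x-derivative of the flux and \<open>w\<close>
    vanishes at both ends, so the pairing moves onto the x-derivative of \<open>w\<close>.\<close>
  have "(\<integral>x. ?\<phi>t x 0 * w (x, 0) + dalembert_flux q 0 x * wx (x, 0) \<partial>ivl 0 1)
     = dalembert_flux q 0 1 * w (1, 0) - dalembert_flux q 0 0 * w (0, 0)"
  proof (rule integral_deriv_ivl)
    fix x :: real assume x: "x \<in> {0..1}"
    have a: "(dalembert_flux q 0 has_real_derivative ?\<phi>t x 0) (at x within {0..1})"
      unfolding dalembert_flux_def
      by (rule DERIV_subset[where s = UNIV], auto intro!: derivative_eq_intros DERIV_chain2[OF dq(1)])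
    show "((\<lambda>x. dalembert_flux q 0 x * w (x, 0)) has_real_derivative
        ?\<phi>t x 0 * w (x, 0) + dalembert_flux q 0 x * wx (x, 0)) (at x within {0..1})"
      using DERIV_mult[OF a dx(1)[OF x T0]] by (simp add: mult.commute)
  next
    show "continuous_on {0..1} (\<lambda>x. ?\<phi>t x 0 * w (x, 0) + dalembert_flux q 0 x * wx (x, 0))"
      by (rule continuous_on_add[OF continuous_on_mult[OF c0(1) cw0(1)] continuous_on_mult[OF c0(3) cw0(2)]])
  qed simp
  then have parts: "(\<integral>x. ?\<phi>t x 0 * w (x, 0) \<partial>ivl 0 1) = - (\<integral>x. dalembert_flux q 0 x * wx (x, 0) \<partial>ivl 0 1)"
    using i bd[OF T0] by simp
  have "(\<integral>z. dalembert q z * f z \<partial>lborel_on (Q T)) = (\<integral>z. ?F1 z - ?F2 z \<partial>lborel_on (Q T))"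
    using feq by (intro Bochner_Integration.integral_cong) (auto simp: dalembert_def Q_def right_diff_distrib)
  also have "\<dots> = (\<integral>z. ?F1 z \<partial>lborel_on (Q T)) - (\<integral>z. ?F2 z \<partial>lborel_on (Q T))"
    by (rule Bochner_Integration.integral_diff[OF F1i F2i])
  also have "(\<integral>z. ?F2 z \<partial>lborel_on (Q T)) = (\<integral>t. 0 \<partial>ivl 0 T)"
    unfolding Q_Fubini(2)[OF F2i] by (rule Bochner_Integration.integral_cong[OF refl]) (rule I2, simp)
  also have "(\<integral>z. ?F1 z \<partial>lborel_on (Q T)) = (\<integral>x. ?\<phi>t x 0 * w (x, 0) - ?\<phi> x 0 * wt (x, 0) \<partial>ivl 0 1)"
    unfolding Q_Fubini(1)[OF F1i] by (rule Bochner_Integration.integral_cong[OF refl]) (rule I1, simp)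
  also have "\<dots> = - (\<integral>x. dalembert_flux q 0 x * wx (x, 0) \<partial>ivl 0 1) - (\<integral>x. ?\<phi> x 0 * wt (x, 0) \<partial>ivl 0 1)"
    using i parts by simp
  finally have main: "(\<integral>z. dalembert q z * f z \<partial>lborel_on (Q T)) =
     - (\<integral>x. dalembert_flux q 0 x * wx (x, 0) \<partial>ivl 0 1) - (\<integral>x. dalembert q (x, 0) * wt (x, 0) \<partial>ivl 0 1)"
    by (simp add: dalembert_def)
  show ?thesis
    using main bd[OF T0] dx(1)[OF _ T0] fc cw0 by (intro exI[of _ "\<lambda>x. wx (x, 0)"] conjI ballI) auto
qed

lemma H10_C1:
  assumes c: "continuous_on {0..1} wx" and d: "\<forall>x\<in>{0..1}. (v has_real_derivative wx x) (at x within {0..1})"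
    and z: "v 0 = 0" "v 1 = 0"
  shows "v \<in> H10" "AE x in ivl 0 1. weak_deriv v x = wx x"
proof -
  have s: "wx \<in> sq_int (ivl 0 1)" by (rule continuous_sq_int_ivl[OF c])
  have "continuous_on {0..1} v" by (rule DERIV_continuous_on) (use d in blast)
  then have m: "v \<in> borel_measurable (ivl 0 1)" by (intro sq_int_measurable[OF continuous_sq_int_ivl])
  have i: "(\<integral>x. wx x \<partial>ivl 0 1) = 0" using integral_deriv_ivl[of 0 1 v wx] d c z by simp
  have ae: "AE x in ivl 0 1. v x = primitive 0 1 wx x"
    by (rule AE_I2) (use primitive_deriv[of 0 1 v wx] d c z in auto)
  show "v \<in> H10" "AE x in ivl 0 1. weak_deriv v x = wx x"
    by (rule H10_I(1)[OF m s i ae], rule H10_I(2)[OF m s i ae])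
qed

text \<open>Both sides of Green's identity are continuous in the profile for the L^2 norm over a
  period, so density of C^2 profiles extends it to \<open>per_l2\<close>.\<close>

lemma transposition:
  assumes T: "0 \<le> T" and p: "p \<in> per_l2" and w: "adjoint_solution T f w wt"
  shows "(\<lambda>x. w (x, 0)) \<in> H10" "(\<integral>z. dalembert p z * f z \<partial>lborel_on (Q T)) =
     - (\<integral>x. dalembert_flux p 0 x * weak_deriv (\<lambda>x. w (x, 0)) x \<partial>ivl 0 1)
     - (\<integral>x. dalembert p (x, 0) * wt (x, 0) \<partial>ivl 0 1)"
    "f \<in> sq_int (lborel_on (Q T))" "(\<lambda>x. wt (x, 0)) \<in> sq_int (ivl 0 1)"
proof -
  let ?v = "\<lambda>x. w (x, 0)"
  obtain q q' q'' :: "nat \<Rightarrow> real \<Rightarrow> real" where q: "\<And>n. C2_per (q n) (q' n) (q'' n)"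
    "(\<lambda>n. l2n (ivl (-1) 1) (\<lambda>u. q n u - p u)) \<longlonglongrightarrow> 0"
    using C2_per_sequence[OF p] by blast
  note qp = C2_per_continuous(4)[OF q(1)]
  obtain wx where wx: "continuous_on {0..1} wx" "\<forall>x\<in>{0..1}. (?v has_real_derivative wx x) (at x within {0..1})"
    "?v 0 = 0" "?v 1 = 0" and wtc: "continuous_on {0..1} (\<lambda>x. wt (x, 0))" and fc: "continuous_on ({0..1} \<times> {0..T}) f"
    using transposition_C2[OF T q(1) w] by blast
  note H = H10_C1[of wx ?v, OF wx]
  show "?v \<in> H10" by (rule H(1))
  note V = H10_weak_deriv[OF H(1)]
  show fs: "f \<in> sq_int (lborel_on (Q T))" by (rule continuous_sq_int_Q[OF fc])
  show wts: "(\<lambda>x. wt (x, 0)) \<in> sq_int (ivl 0 1)" by (rule continuous_sq_int_ivl[OF wtc])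
  \<comment> \<open>Each \<open>n\<close> comes with its own derivative of \<open>w\<close> at time
    0; all of them agree almost everywhere with the one \<open>weak_deriv\<close>, which makes the
    limit possible.\<close>
  have eq: "(\<integral>z. dalembert (q n) z * f z \<partial>lborel_on (Q T)) =
     - (\<integral>x. dalembert_flux (q n) 0 x * weak_deriv ?v x \<partial>ivl 0 1) - (\<integral>x. dalembert (q n) (x, 0) * wt (x, 0) \<partial>ivl 0 1)" for n
  proof -
    obtain wx' where wx': "continuous_on {0..1} wx'" "\<forall>x\<in>{0..1}. (?v has_real_derivative wx' x) (at x within {0..1})"
      and e: "(\<integral>z. dalembert (q n) z * f z \<partial>lborel_on (Q T)) =
       - (\<integral>x. dalembert_flux (q n) 0 x * wx' x \<partial>ivl 0 1) - (\<integral>x. dalembert (q n) (x, 0) * wt (x, 0) \<partial>ivl 0 1)"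
      using transposition_C2[OF T q(1) w, of n] by blast
    note H' = H10_C1[of wx' ?v, OF wx' wx(3,4)]
    have "(\<integral>x. dalembert_flux (q n) 0 x * weak_deriv ?v x \<partial>ivl 0 1) = (\<integral>x. dalembert_flux (q n) 0 x * wx' x \<partial>ivl 0 1)"
    proof (rule integral_cong_AE)
      show "AE x in ivl 0 1. dalembert_flux (q n) 0 x * weak_deriv ?v x = dalembert_flux (q n) 0 x * wx' x"
        using H'(2) by eventually_elim simp
    qed (use dalembert_slice(3)[OF qp] V(2) continuous_sq_int_ivl[OF wx'(1)] in \<open>auto intro!: borel_measurable_times sq_int_measurable\<close>)
    with e show ?thesis by simp
  qed
  note lim = dalembert_slice_tendsto[OF p qp q(2), of 0]
  note S = dalembert_slice(1,3)
  have "(\<lambda>n. \<integral>z. dalembert (q n) z * f z \<partial>lborel_on (Q T)) \<longlonglongrightarrow> (\<integral>z. dalembert p z * f z \<partial>lborel_on (Q T))"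
  proof (rule integral_mult_tendsto[OF dalembert_sq_int_Q(1)[OF T qp] dalembert_sq_int_Q(1)[OF T p] fs])
    have l: "(\<lambda>n. sqrt T * (2 * l2n (ivl (-1) 1) (\<lambda>u. q n u - p u))) \<longlonglongrightarrow> sqrt T * (2 * 0)"
      by (intro tendsto_intros q(2))
    show "(\<lambda>n. l2n (lborel_on (Q T)) (\<lambda>z. dalembert (q n) z - dalembert p z)) \<longlonglongrightarrow> 0"
    proof (rule Lim_null_comparison)
      show "\<forall>\<^sub>F n in sequentially. norm (l2n (lborel_on (Q T)) (\<lambda>z. dalembert (q n) z - dalembert p z))
         \<le> sqrt T * (2 * l2n (ivl (-1) 1) (\<lambda>u. q n u - p u))"
        using dalembert_sq_int_Q(2)[OF T per_l2_diff[OF qp p]] by (simp add: dalembert_diff [abs_def])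
    qed (use l in simp)
  qed
  moreover have "(\<lambda>n. \<integral>z. dalembert (q n) z * f z \<partial>lborel_on (Q T)) \<longlonglongrightarrow>
     - (\<integral>x. dalembert_flux p 0 x * weak_deriv ?v x \<partial>ivl 0 1) - (\<integral>x. dalembert p (x, 0) * wt (x, 0) \<partial>ivl 0 1)"
    unfolding eq by (intro tendsto_intros integral_mult_tendsto S[OF qp] S[OF p] lim V(2) wts)
  ultimately show "(\<integral>z. dalembert p z * f z \<partial>lborel_on (Q T)) =
     - (\<integral>x. dalembert_flux p 0 x * weak_deriv ?v x \<partial>ivl 0 1) - (\<integral>x. dalembert p (x, 0) * wt (x, 0) \<partial>ivl 0 1)"
    by (rule LIMSEQ_unique)
qed

text \<open>The velocity is the distributional derivative of the flux at time 0. Equality almost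
  everywhere and on \<open>H10\<close> alone reflects that elements of \<open>W\<close> are
  representatives.\<close>

definition dalembert_data :: "(real \<Rightarrow> real) \<Rightarrow> (real \<Rightarrow> real) \<times> ((real \<Rightarrow> real) \<Rightarrow> real) \<Rightarrow> bool" where
  "dalembert_data p = (\<lambda>(\<phi>\<^sub>0, \<phi>\<^sub>1). \<phi>\<^sub>0 \<in> sq_int (ivl 0 1) \<and> (AE x in ivl 0 1. \<phi>\<^sub>0 x = dalembert p (x, 0)) \<and>
     (\<forall>v\<in>H10. \<phi>\<^sub>1 v = - (\<integral>x. dalembert_flux p 0 x * weak_deriv v x \<partial>ivl 0 1)))"

lemma dalembert_wave_solution:
  assumes T: "0 \<le> T" and p: "p \<in> per_l2" and d: "dalembert_data p (\<phi>\<^sub>0, \<phi>\<^sub>1)"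
  shows "is_wave_solution T (\<phi>\<^sub>0, \<phi>\<^sub>1) (dalembert p)"
  unfolding is_wave_solution_def prod.case
proof (intro conjI allI impI exI)
  have d1: "\<phi>\<^sub>0 \<in> sq_int (ivl 0 1)" "AE x in ivl 0 1. \<phi>\<^sub>0 x = dalembert p (x, 0)"
    and d2: "\<And>v. v \<in> H10 \<Longrightarrow> \<phi>\<^sub>1 v = - (\<integral>x. dalembert_flux p 0 x * weak_deriv v x \<partial>ivl 0 1)"
    using d by (auto simp: dalembert_data_def)
  show "C0_L2 T (dalembert p)" by (rule dalembert_C0_L2[OF p])
  show "AE x\<in>Omega in lborel. dalembert p (x, 0) = \<phi>\<^sub>0 x"
    using d1(2) by (subst (asm) AE_lborel_on) (auto elim: eventually_mono)
  show "C1_Hm1 T (dalembert p) (\<lambda>t v. - (\<integral>x. dalembert_flux p t x * weak_deriv v x \<partial>ivl 0 1))"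
    by (rule dalembert_C1_Hm1[OF p])
  show "\<forall>v\<in>H10. - (\<integral>x. dalembert_flux p 0 x * weak_deriv v x \<partial>ivl 0 1) = \<phi>\<^sub>1 v"
    using d2 by simp
  fix f w wt assume w: "adjoint_solution T f w wt"
  note tr = transposition[OF T p w]
  have "(\<integral>x. \<phi>\<^sub>0 x * wt (x, 0) \<partial>ivl 0 1) = (\<integral>x. dalembert p (x, 0) * wt (x, 0) \<partial>ivl 0 1)"
  proof (rule integral_cong_AE)
    show "AE x in ivl 0 1. \<phi>\<^sub>0 x * wt (x, 0) = dalembert p (x, 0) * wt (x, 0)"
      using d1(2) by eventually_elim simp
  qed (use d1(1) dalembert_slice(1)[OF p] tr(4) in \<open>auto intro!: borel_measurable_times sq_int_measurable\<close>)
  then show "(LINT z:Q T|lborel. dalembert p z * f z) = \<phi>\<^sub>1 (\<lambda>x. w (x, 0)) - L2_inner \<phi>\<^sub>0 (\<lambda>x. wt (x, 0))"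
    using tr(2) d2[OF tr(1)] by (simp add: set_integral_lborel_on L2_inner_ivl)
qed

lemma per_l2_extend:
  assumes "f \<in> sq_int (ivl (-1) 1)"
  shows "\<exists>p\<in>per_l2. \<forall>u\<in>{-1<..<1}. p u = f u"
proof -
  define F where "F x = indicator {-1<..<1::real} x *\<^sub>R f x" for x
  have "(\<lambda>x. indicator {-1<..<1} x *\<^sub>R f x) \<in> borel_measurable lborel"
    using sq_int_measurable[OF assms] by (subst (asm) borel_measurable_restrict_space_iff) auto
  then have [measurable]: "F \<in> borel_measurable borel" unfolding F_def [abs_def] by simp
  \<comment> \<open>Moves \<open>u\<close> by an even integer into [-1,1).\<close>
  define r where "r u = u - 2 * of_int \<lfloor>(u + 1) / 2\<rfloor>" for u :: real
  have "(\<lambda>u::real. real_of_int \<lfloor>(u + 1) / 2\<rfloor>) \<in> borel_measurable borel"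
    by (rule measurable_compose[OF _ borel_measurable_real_floor]) measurable
  then have [measurable]: "r \<in> borel_measurable borel"
    unfolding r_def [abs_def] by (intro borel_measurable_diff borel_measurable_times) auto
  define p where "p u = F (r u)" for u
  have pm: "p \<in> borel_measurable borel" unfolding p_def by measurable
  have "r (u + 2) = r u" for u
  proof -
    have "(u + 2 + 1) / 2 = (u + 1) / 2 + 1" by (simp add: field_simps)
    then have "\<lfloor>(u + 2 + 1) / 2\<rfloor> = \<lfloor>(u + 1) / 2\<rfloor> + 1" by (simp only: one_add_floor)
    then show ?thesis unfolding r_def by simp
  qed
  then have per: "p (u + 2) = p u" for u by (simp add: p_def)
  have pf: "p u = f u" if "u \<in> {-1<..<1}" for u
  proof -
    have "\<lfloor>(u + 1) / 2\<rfloor> = 0" using that by (intro floor_eq_iff[THEN iffD2]) auto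
    then show ?thesis using that by (simp add: p_def r_def F_def)
  qed
  have "p \<in> sq_int (ivl (-1) 1)"
    by (rule sq_int_bound[OF assms borel_measurable_lborel_on[OF pm]]) (use pf in auto)
  with pm per pf show ?thesis by (auto simp: per_l2_def)
qed

text \<open>On (0,1) the data prescribe the two combinations p(x) - p(-x) = \<phi>_0 and p(x) +
  p(-x) = -h, where \<open>h\<close> represents \<phi>_1. Solving gives \<open>p\<close> on (-1,1)
  except at 0, and periodicity does the rest.\<close>

lemma W_dalembert:
  assumes "(\<phi>\<^sub>0, \<phi>\<^sub>1) \<in> W"
  shows "\<exists>p\<in>per_l2. dalembert_data p (\<phi>\<^sub>0, \<phi>\<^sub>1)"
proof -
  have \<phi>0: "\<phi>\<^sub>0 \<in> sq_int (ivl 0 1)" and \<phi>1: "\<phi>\<^sub>1 \<in> Hm1" using assms by (auto simp: W_def L2_Omega)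
  have "\<exists>h. h \<in> sq_int (ivl 0 1) \<and> (\<forall>v\<in>H10. \<phi>\<^sub>1 v = (\<integral>x. h x * weak_deriv v x \<partial>ivl 0 1))"
    by (rule Hm1_representation[OF \<phi>1]) blast
  then obtain h where h: "h \<in> sq_int (ivl 0 1)" "\<And>v. v \<in> H10 \<Longrightarrow> \<phi>\<^sub>1 v = (\<integral>x. h x * weak_deriv v x \<partial>ivl 0 1)"
    by blast
  define F where "F x = indicator {0<..<1::real} x *\<^sub>R \<phi>\<^sub>0 x" for x
  define H where "H x = indicator {0<..<1::real} x *\<^sub>R h x" for x
  have "(\<lambda>x. indicator {0<..<1} x *\<^sub>R k x) \<in> borel_measurable lborel" if "k \<in> sq_int (ivl 0 1)" for k :: "real \<Rightarrow> real"
    using sq_int_measurable[OF that] by (subst (asm) borel_measurable_restrict_space_iff) auto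
  from this[OF \<phi>0] this[OF h(1)]
  have [measurable]: "F \<in> borel_measurable borel" "H \<in> borel_measurable borel"
    unfolding F_def [abs_def] H_def [abs_def] by simp_all
  \<comment> \<open>One formula for both halves: \<open>F\<close> and \<open>H\<close> vanish
    outside (0,1), so for y > 0 only the terms at \<open>y\<close> count and for y < 0 only those at
    \<open>- y\<close>.\<close>
  define b where "b y = (F y - F (- y) - H y - H (- y)) / 2" for y
  have bm: "b \<in> borel_measurable borel" "(\<lambda>x. b (- x)) \<in> borel_measurable borel"
    unfolding b_def by measurable
  have b: "b x = (1/2) * \<phi>\<^sub>0 x + (-1/2) * h x" "b (- x) = (-1/2) * \<phi>\<^sub>0 x + (-1/2) * h x" if "x \<in> {0<..<1}" for x
    using that by (auto simp: b_def F_def H_def field_simps)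
  have sm: "sq_mass g {0<..<1} < \<infinity>" if "g \<in> borel_measurable borel" "k \<in> sq_int (ivl 0 1)" "\<And>x. x \<in> {0<..<1} \<Longrightarrow> g x = k x" for g k
  proof -
    have "g \<in> sq_int (ivl 0 1)"
      by (rule sq_int_bound[OF that(2) borel_measurable_lborel_on[OF that(1)]]) (use that(3) in auto)
    then show ?thesis using sq_int_iff_sq_mass[OF that(1)] by simp
  qed
  have "sq_mass b {-1<..<1} = sq_mass (\<lambda>x. b (- x)) {0<..<1} + sq_mass b {0<..<1}"
    using sq_mass_split[OF bm(1), of "-1" 0 1] sq_mass_reflect[OF bm(1), of 0 1] by simp
  also have "\<dots> < \<infinity>"
    using sm[OF bm(1) sq_int_lincomb[OF \<phi>0 h(1)] b(1)] sm[OF bm(2) sq_int_lincomb[OF \<phi>0 h(1)] b(2)] by simp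
  finally have "b \<in> sq_int (ivl (-1) 1)" using sq_int_iff_sq_mass[OF bm(1)] by simp
  then obtain p where P: "p \<in> per_l2" and pb: "\<forall>u\<in>{-1<..<1}. p u = b u"
    using per_l2_extend by blast
  have pp: "p x = (1/2) * \<phi>\<^sub>0 x + (-1/2) * h x" "p (- x) = (-1/2) * \<phi>\<^sub>0 x + (-1/2) * h x" if "x \<in> {0<..<1}" for x
    using that b[OF that] pb by simp_all
  have "dalembert_data p (\<phi>\<^sub>0, \<phi>\<^sub>1)"
    unfolding dalembert_data_def prod.case
  proof (intro conjI ballI \<phi>0)
    show "AE x in ivl 0 1. \<phi>\<^sub>0 x = dalembert p (x, 0)"
      by (rule AE_I2) (use pp in \<open>auto simp: dalembert_def\<close>)
    fix v assume v: "v \<in> H10"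
    have "(\<integral>x. h x * weak_deriv v x \<partial>ivl 0 1) = (\<integral>x. - (dalembert_flux p 0 x * weak_deriv v x) \<partial>ivl 0 1)"
      by (intro Bochner_Integration.integral_cong) (use pp in \<open>auto simp: dalembert_flux_def\<close>)
    then show "\<phi>\<^sub>1 v = - (\<integral>x. dalembert_flux p 0 x * weak_deriv v x \<partial>ivl 0 1)"
      using h(2)[OF v] by simp
  qed
  with P show ?thesis by blast
qed

subsection \<open>Uniqueness\<close>

text \<open>The product formula for sin (k pi x) cos (pi x) yields, by induction on n and for all k
  at once, orthogonality to sin (k pi x) cos^n (pi x). The case k = 1 covers sin (pi x) times all
  polynomials in cos (pi x), a dense set.\<close>

lemma sines_complete:
  assumes f: "f \<in> sq_int (ivl 0 1)"
    and orth: "\<And>k::nat. (\<integral>x. f x * sin (k * pi * x) \<partial>ivl 0 1) = 0"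
  shows "AE x in ivl 0 1. f x = 0"
proof -
  let ?M = "ivl 0 1"
  have s: "(\<lambda>x. sin (k * pi * x) * cos (pi * x) ^ n) \<in> sq_int ?M" for k n :: nat
    by (intro continuous_sq_int_ivl continuous_intros)
  note i = integrable_mult_sq_int[OF f s]
  have o: "(\<integral>x. f x * (sin (k * pi * x) * cos (pi * x) ^ n) \<partial>?M) = 0" for k n :: nat
  proof (induction n arbitrary: k)
    case 0
    then show ?case using orth[of k] by simp
  next
    case (Suc n)
    show ?case
    proof (cases k)
      case 0
      then show ?thesis by simp
    next
      case (Suc j)
      have "sin (k * pi * x) * cos (pi * x) = (1/2) * sin (Suc k * pi * x) + (1/2) * sin (j * pi * x)" for x :: real
        using Suc sin_times_cos[of "k * pi * x" "pi * x"] by (simp add: algebra_simps)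
      then have "f x * (sin (k * pi * x) * cos (pi * x) ^ Suc n) =
        (1/2) * (f x * (sin (Suc k * pi * x) * cos (pi * x) ^ n)) + (1/2) * (f x * (sin (j * pi * x) * cos (pi * x) ^ n))" for x :: real
        by (simp add: distrib_right distrib_left flip: mult.assoc)
      then have "(\<integral>x. f x * (sin (k * pi * x) * cos (pi * x) ^ Suc n) \<partial>?M) =
         (\<integral>x. (1/2) * (f x * (sin (Suc k * pi * x) * cos (pi * x) ^ n)) + (1/2) * (f x * (sin (j * pi * x) * cos (pi * x) ^ n)) \<partial>?M)"
        by (simp only:)
      also have "\<dots> = 0"
        using i[of "Suc k" n] i[of j n] Suc.IH[of "Suc k"] Suc.IH[of j] by simp
      finally show ?thesis .
    qed
  qed
  define D where "D = range (\<lambda>R x. sin (pi * x) * poly R (cos (pi * x)))"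
  have "l2_dense ?M D"
    unfolding l2_dense_def
  proof (intro conjI ballI allI impI)
    show "D \<subseteq> sq_int ?M"
      unfolding D_def by (auto intro!: continuous_sq_int_ivl continuous_intros)
    fix g and e :: real assume "g \<in> sq_int ?M" "0 < e"
    from l2_dense_sin_poly_cos(1)[OF this]
    obtain R where "l2n ?M (\<lambda>x. g x - sin (pi * x) * poly R (cos (pi * x))) < e" by blast
    then show "\<exists>d\<in>D. l2n ?M (\<lambda>x. g x - d x) < e"
      by (rule bexI[where x = "\<lambda>x. sin (pi * x) * poly R (cos (pi * x))"]) (simp add: D_def)
  qed
  then show ?thesis
  proof (rule l2_dense_orthogonal[OF _ f])
    fix d assume "d \<in> D"
    then obtain R where d: "d = (\<lambda>x. sin (pi * x) * poly R (cos (pi * x)))" by (auto simp: D_def)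
    have "f x * d x = (\<Sum>j\<le>degree R. coeff R j * (f x * (sin (real 1 * pi * x) * cos (pi * x) ^ j)))" for x
      by (simp add: d poly_altdef sum_distrib_left mult_ac)
    then have "(\<integral>x. f x * d x \<partial>?M) = (\<integral>x. (\<Sum>j\<le>degree R. coeff R j * (f x * (sin (real 1 * pi * x) * cos (pi * x) ^ j))) \<partial>?M)"
      by (simp only:)
    also have "\<dots> = (\<Sum>j\<le>degree R. \<integral>x. coeff R j * (f x * (sin (real 1 * pi * x) * cos (pi * x) ^ j)) \<partial>?M)"
      by (rule Bochner_Integration.integral_sum) (intro integrable_mult_right i)
    also have "\<dots> = 0"
      using o[of 1] by simp
    finally show "(\<integral>x. f x * d x \<partial>?M) = 0" .
  qed
qed

text \<open>The separated test functions \<open>w = sin (\<lambda> x) h(t)\<close>, where \<open>h'' + \<lambda>\<^sup>2 h = g\<close> and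
  \<open>h(T) = h'(T) = 0\<close> is solved by Duhamel's formula.\<close>

lemma adjoint_solution_separated:
  assumes T: "0 < T" and g: "continuous_on UNIV g" and k: "0 < k"
  shows "\<exists>w wt. adjoint_solution T (\<lambda>(x, t). sin (real k * pi * x) * g t) w wt"
proof -
  define l where "l = real k * pi"
  have l: "0 < l" using k by (simp add: l_def)
  have gc: "continuous_on A g" for A using g continuous_on_subset by blast
  have "continuous_on {0..T} (\<lambda>s. sin (l * s) * g s)" by (intro continuous_intros gc)
  then obtain A where A0: "\<And>t. t \<in> {0..T} \<Longrightarrow> (A has_vector_derivative sin (l * t) * g t) (at t within {0..T})"
    using antiderivative_continuous by blast
  have "continuous_on {0..T} (\<lambda>s. cos (l * s) * g s)" by (intro continuous_intros gc)
  then obtain B where B0: "\<And>t. t \<in> {0..T} \<Longrightarrow> (B has_vector_derivative cos (l * t) * g t) (at t within {0..T})"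
    using antiderivative_continuous by blast
  have A: "(A has_real_derivative sin (l * t) * g t) (at t within {0..T})"
    and B: "(B has_real_derivative cos (l * t) * g t) (at t within {0..T})" if "t \<in> {0..T}" for t
    using A0[OF that] B0[OF that] by (simp_all add: has_real_derivative_iff_has_vector_derivative)
  \<comment> \<open>Duhamel's integral of sin (l (s - t)) g(s) over (t,T), divided by l. The
    addition formula separates s from t, so only the antiderivatives \<open>A\<close> and
    \<open>B\<close> have to be differentiated.\<close>
  define h where "h t = (cos (l * t) * (A T - A t) - sin (l * t) * (B T - B t)) / l" for t
  define h1 where "h1 t = - (sin (l * t) * (A T - A t)) - cos (l * t) * (B T - B t)" for t
  have dh: "(h has_real_derivative h1 t) (at t within {0..T})" if t: "t \<in> {0..T}" for t
    unfolding h_def h1_def using l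
    by (auto intro!: derivative_eq_intros A[OF t] B[OF t] simp: field_simps)
  have dh1: "(h1 has_real_derivative g t - l\<^sup>2 * h t) (at t within {0..T})" if t: "t \<in> {0..T}" for t
  proof -
    let ?X = "- (cos (l * t) * l * (A T - A t) + (0 - sin (l * t) * g t) * sin (l * t))
      - (- sin (l * t) * l * (B T - B t) + (0 - cos (l * t) * g t) * cos (l * t))"
    have D: "(h1 has_real_derivative ?X) (at t within {0..T})"
      unfolding h1_def by (auto intro!: derivative_eq_intros A[OF t] B[OF t])
    have s2: "sin (l * t) * (sin (l * t) * g t) + cos (l * t) * (cos (l * t) * g t) = g t"
      using sin_cos_squared_add[of "l * t"] by (simp add: power2_eq_square flip: mult.assoc distrib_right)
    have lh: "l\<^sup>2 * h t = l * (cos (l * t) * (A T - A t) - sin (l * t) * (B T - B t))"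
      using l by (simp add: h_def power2_eq_square)
    have "?X = (sin (l * t) * (sin (l * t) * g t) + cos (l * t) * (cos (l * t) * g t))
      - l * (cos (l * t) * (A T - A t) - sin (l * t) * (B T - B t))"
      by (simp add: algebra_simps)
    then have "?X = g t - l\<^sup>2 * h t" by (simp only: s2 lh)
    with D show ?thesis by (simp only:)
  qed
  have hc: "continuous_on {0..T} h" by (rule DERIV_continuous_on[OF dh])
  have h1c: "continuous_on {0..T} h1" by (rule DERIV_continuous_on[OF dh1])
  have fin: "h T = 0" "h1 T = 0" by (simp_all add: h_def h1_def)
  \<comment> \<open>\<open>l\<close> is an integer multiple of pi, which gives the boundary
    condition at x = 1.\<close>
  have zero: "sin (l * 1) = 0" unfolding l_def by simp
  have ds: "((\<lambda>z. sin (l * z) * c) has_real_derivative l * cos (l * x) * c) (at x within S)"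
    "((\<lambda>z. l * cos (l * z) * c) has_real_derivative - (l\<^sup>2 * sin (l * x) * c)) (at x within S)" for x c S
    by (auto intro!: derivative_eq_intros simp: power2_eq_square)
  have dm: "((\<lambda>s. c * y s) has_real_derivative c * y') (at t within S)" if "(y has_real_derivative y') (at t within S)" for c y y' t S
    using that by (rule DERIV_cmult)
  let ?R = "{0..1} \<times> {0..T}"
  have ch: "continuous_on ?R (\<lambda>z. h (snd z))" "continuous_on ?R (\<lambda>z. h1 (snd z))" "continuous_on ?R (\<lambda>z. g (snd z))"
    by (auto intro!: continuous_on_compose2[OF hc] continuous_on_compose2[OF h1c] continuous_on_compose2[OF g] continuous_on_snd continuous_on_id)
  define w wx wt wxx wxt wtt where "w z = sin (l * fst z) * h (snd z)"
    and "wx z = l * cos (l * fst z) * h (snd z)"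
    and "wt z = sin (l * fst z) * h1 (snd z)" and "wxx z = - (l\<^sup>2 * sin (l * fst z) * h (snd z))"
    and "wxt z = l * cos (l * fst z) * h1 (snd z)"
    and "wtt z = sin (l * fst z) * (g (snd z) - l\<^sup>2 * h (snd z))" for z :: "real \<times> real"
  have "adjoint_solution T (\<lambda>(x, t). sin (l * x) * g t) w wt"
    unfolding adjoint_solution_def
  proof (rule exI[of _ wx], rule exI[of _ wxx], rule exI[of _ wxt], rule exI[of _ wtt], intro conjI ballI)
    fix G assume "G \<in> {w, wx, wt, wxx, wxt, wtt}"
    moreover have "continuous_on ?R w" "continuous_on ?R wx" "continuous_on ?R wt" "continuous_on ?R wxx"
       "continuous_on ?R wxt" "continuous_on ?R wtt"
      unfolding w_def wx_def wt_def wxx_def wxt_def wtt_def by (intro continuous_intros ch)+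
    ultimately show "continuous_on ?R G" by auto
  next
    fix x t :: real assume x: "x \<in> {0..1}" and t: "t \<in> {0..T}"
    show "((\<lambda>z. w (z, t)) has_real_derivative wx (x, t)) (at x within {0..1})"
      "((\<lambda>z. wx (z, t)) has_real_derivative wxx (x, t)) (at x within {0..1})"
      "((\<lambda>z. wt (z, t)) has_real_derivative wxt (x, t)) (at x within {0..1})"
      unfolding w_def wx_def wt_def wxx_def wxt_def fst_conv snd_conv by (rule ds)+
    show "((\<lambda>s. w (x, s)) has_real_derivative wt (x, t)) (at t within {0..T})"
      "((\<lambda>s. wx (x, s)) has_real_derivative wxt (x, t)) (at t within {0..T})"
      "((\<lambda>s. wt (x, s)) has_real_derivative wtt (x, t)) (at t within {0..T})"
      unfolding w_def wx_def wt_def wxt_def wtt_def fst_conv snd_conv by (rule dm dh[OF t] dh1[OF t])+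
    show "wtt (x, t) - wxx (x, t) = (case (x, t) of (x, t) \<Rightarrow> sin (l * x) * g t)"
      by (simp add: wtt_def wxx_def algebra_simps)
  qed (use fin zero in \<open>auto simp: w_def wt_def\<close>)
  then show ?thesis unfolding l_def by blast
qed

text \<open>Continuity in time on the compact interval bounds the slice norms uniformly, which makes
  the solution square integrable on the cylinder.\<close>

lemma C0_L2_sq_int_Q:
  assumes T: "0 < T" and \<phi>: "C0_L2 T \<phi>"
  obtains K where "0 \<le> K" "\<And>t. t \<in> {0..T} \<Longrightarrow> l2n (ivl 0 1) (\<lambda>x. \<phi> (x, t)) \<le> K"
    "\<phi> \<in> borel_measurable (lborel_on (Q T))" "\<And>t. t \<in> {0..T} \<Longrightarrow> (\<lambda>x. \<phi> (x, t)) \<in> sq_int (ivl 0 1)"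
    "\<phi> \<in> sq_int (lborel_on (Q T))"
proof -
  have m: "\<phi> \<in> borel_measurable (lborel_on (Q T))"
    using \<phi> by (simp add: C0_L2_def set_borel_measurable_lborel_on)
  have s: "(\<lambda>x. \<phi> (x, t)) \<in> sq_int (ivl 0 1)"
    and lim: "((\<lambda>s. l2n (ivl 0 1) (\<lambda>x. \<phi> (x, s) - \<phi> (x, t))) \<longlongrightarrow> 0) (at t within {0..T})" if "t \<in> {0..T}" for t
    using \<phi> that by (auto simp: C0_L2_def L2_Omega L2_norm_Omega)
  have "continuous_on {0..T} (\<lambda>t. l2n (ivl 0 1) (\<lambda>x. \<phi> (x, t)))"
    unfolding continuous_on_def
  proof
    fix t assume t: "t \<in> {0..T}"
    show "((\<lambda>t. l2n (ivl 0 1) (\<lambda>x. \<phi> (x, t))) \<longlongrightarrow> l2n (ivl 0 1) (\<lambda>x. \<phi> (x, t))) (at t within {0..T})"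
    proof (rule Lim_null[THEN iffD2], rule Lim_null_comparison[OF _ lim[OF t]])
      show "\<forall>\<^sub>F s in at t within {0..T}. norm (l2n (ivl 0 1) (\<lambda>x. \<phi> (x, s)) - l2n (ivl 0 1) (\<lambda>x. \<phi> (x, t)))
          \<le> l2n (ivl 0 1) (\<lambda>x. \<phi> (x, s) - \<phi> (x, t))"
        unfolding eventually_at using l2n_reverse_triangle[OF s s[OF t]]
        by (intro exI[of _ 1]) auto
    qed
  qed
  then have "bounded ((\<lambda>t. l2n (ivl 0 1) (\<lambda>x. \<phi> (x, t))) ` {0..T})"
    by (intro compact_imp_bounded compact_continuous_image) auto
  then obtain K where "\<forall>t\<in>{0..T}. l2n (ivl 0 1) (\<lambda>x. \<phi> (x, t)) \<le> K"
    by (auto simp: bounded_iff)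
  then have K: "\<And>t. t \<in> {0..T} \<Longrightarrow> l2n (ivl 0 1) (\<lambda>x. \<phi> (x, t)) \<le> K" by blast
  then have K0: "0 \<le> K" using T order_trans[OF l2n_nonneg K[of 0]] by simp
  have "AE t in ivl 0 T. (\<lambda>x. \<phi> (x, t)) \<in> sq_int (ivl 0 1) \<and> l2n (ivl 0 1) (\<lambda>x. \<phi> (x, t)) \<le> K"
    by (rule AE_I2) (use s K in auto)
  note q = sq_int_Q(1)[OF less_imp_le[OF T] m K0 this]
  show ?thesis by (rule that[OF K0 _ m _ q]) (use K s in auto)
qed

text \<open>Testing the difference against separated sources sin (k pi x) g(t) shows that its k-th
  sine coefficient is orthogonal to every continuous \<open>g\<close>, hence zero for almost every
  t. Completeness of the sines finishes each slice.\<close>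

theorem wave_solution_unique:
  assumes T: "0 < T" and \<phi>: "is_wave_solution T d \<phi>" and \<psi>: "is_wave_solution T d \<psi>"
  shows "AE z in lborel_on (Q T). \<phi> z = \<psi> z"
proof -
  obtain \<phi>\<^sub>0 \<phi>\<^sub>1 where d: "d = (\<phi>\<^sub>0, \<phi>\<^sub>1)" by (cases d)
  have c\<phi>: "C0_L2 T \<phi>" and c\<psi>: "C0_L2 T \<psi>"
    using \<phi> \<psi> unfolding d is_wave_solution_def by auto
  have tr\<phi>: "(\<integral>z. \<phi> z * f z \<partial>lborel_on (Q T)) = (\<integral>z. \<psi> z * f z \<partial>lborel_on (Q T))" if "adjoint_solution T f w wt" for f w wt
    using \<phi> \<psi> that unfolding d is_wave_solution_def prod.case
    by (simp add: set_integral_lborel_on)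
  obtain K where K: "0 \<le> K" "\<And>t. t \<in> {0..T} \<Longrightarrow> l2n (ivl 0 1) (\<lambda>x. \<phi> (x, t)) \<le> K"
    and m\<phi>: "\<phi> \<in> borel_measurable (lborel_on (Q T))" and s\<phi>: "\<And>t. t \<in> {0..T} \<Longrightarrow> (\<lambda>x. \<phi> (x, t)) \<in> sq_int (ivl 0 1)"
    and q\<phi>: "\<phi> \<in> sq_int (lborel_on (Q T))"
    by (rule C0_L2_sq_int_Q[OF T c\<phi>]) (rule that)
  obtain L where L: "0 \<le> L" "\<And>t. t \<in> {0..T} \<Longrightarrow> l2n (ivl 0 1) (\<lambda>x. \<psi> (x, t)) \<le> L"
    and m\<psi>: "\<psi> \<in> borel_measurable (lborel_on (Q T))" and s\<psi>: "\<And>t. t \<in> {0..T} \<Longrightarrow> (\<lambda>x. \<psi> (x, t)) \<in> sq_int (ivl 0 1)"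
    and q\<psi>: "\<psi> \<in> sq_int (lborel_on (Q T))"
    by (rule C0_L2_sq_int_Q[OF T c\<psi>]) (rule that)
  define e where "e z = \<phi> z - \<psi> z" for z
  have es: "e \<in> sq_int (lborel_on (Q T))" unfolding e_def by (rule sq_int_diff[OF q\<phi> q\<psi>])
  have esl: "(\<lambda>x. e (x, t)) \<in> sq_int (ivl 0 1)" "l2n (ivl 0 1) (\<lambda>x. e (x, t)) \<le> K + L" if t: "t \<in> {0..T}" for t
    unfolding e_def using sq_int_diff[OF s\<phi>[OF t] s\<psi>[OF t]] l2n_triangle_diff[OF s\<phi>[OF t] s\<psi>[OF t]] K(2)[OF t] L(2)[OF t]
    by auto
  define a where "a k t = (\<integral>x. e (x, t) * sin (real k * pi * x) \<partial>ivl 0 1)" for k :: nat and t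
  have "AE t in ivl 0 T. a k t = 0" if k: "0 < k" for k
  proof -
    let ?s = "\<lambda>x. sin (real k * pi * x)"
    have sq: "?s \<in> sq_int (ivl 0 1)" by (intro continuous_sq_int_ivl continuous_intros)
    have i: "integrable (lborel_on (Q T)) (\<lambda>z. e z * (?s (fst z) * g (snd z)))" if g: "continuous_on UNIV g" for g
      by (intro integrable_mult_sq_int[OF es] continuous_sq_int_Q continuous_intros continuous_on_compose2[OF g]) auto
    \<comment> \<open>Measurability in t of a slice integral comes from Fubini, with the source
      constant in time.\<close>
    have am: "a k \<in> borel_measurable (ivl 0 T)"
    proof -
      have "integrable (lborel_on (Q T)) (\<lambda>z. e z * (?s (fst z) * 1))" by (rule i) simp
      from Q_Fubini(3)[OF this] show ?thesis
        unfolding a_def [abs_def] fst_conv snd_conv mult_1_right by auto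
    qed
    have "\<bar>a k t\<bar> \<le> (K + L) * l2n (ivl 0 1) ?s" if "t \<in> space (ivl 0 T)" for t
    proof -
      have t: "t \<in> {0..T}" using that by simp
      have "\<bar>a k t\<bar> \<le> l2n (ivl 0 1) (\<lambda>x. e (x, t)) * l2n (ivl 0 1) ?s"
        unfolding a_def by (rule l2n_Cauchy_Schwarz[OF esl(1)[OF t] sq])
      also have "\<dots> \<le> (K + L) * l2n (ivl 0 1) ?s" by (intro mult_right_mono esl(2)[OF t]) simp
      finally show ?thesis .
    qed
    then have as: "a k \<in> sq_int (ivl 0 T)" by (rule sq_int_bounded[OF finite_measure_ivl am])
    show ?thesis
    proof (rule l2_dense_orthogonal[OF l2_dense_continuous as])
      fix g :: "real \<Rightarrow> real" assume "g \<in> {g. continuous_on UNIV g}"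
      then have g: "continuous_on UNIV g" by simp
      obtain w wt where w: "adjoint_solution T (\<lambda>(x, t). ?s x * g t) w wt"
        using adjoint_solution_separated[OF T g k] by blast
      have f: "(\<lambda>(x, t). ?s x * g t) = (\<lambda>z. ?s (fst z) * g (snd z))" by auto
      have fs: "(\<lambda>z. ?s (fst z) * g (snd z)) \<in> sq_int (lborel_on (Q T))"
        by (intro continuous_sq_int_Q continuous_intros continuous_on_compose2[OF g]) auto
      have "(\<integral>z. e z * (?s (fst z) * g (snd z)) \<partial>lborel_on (Q T)) = 0"
        using tr\<phi>[OF w] integrable_mult_sq_int[OF q\<phi> fs] integrable_mult_sq_int[OF q\<psi> fs]
        unfolding f e_def by (simp add: left_diff_distrib)
      then have "(\<integral>t. (\<integral>x. e (x, t) * (?s x * g t) \<partial>ivl 0 1) \<partial>ivl 0 T) = 0"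
        using Q_Fubini(2)[OF i[OF g]] by simp
      moreover have "(\<integral>x. e (x, t) * (?s x * g t) \<partial>ivl 0 1) = a k t * g t" for t
        unfolding a_def by (simp flip: mult.assoc)
      ultimately show "(\<integral>t. a k t * g t \<partial>ivl 0 T) = 0" by simp
    qed
  qed
  moreover have "a 0 t = 0" for t by (simp add: a_def)
  ultimately have "AE t in ivl 0 T. a k t = 0" for k by (cases "k = 0") auto
  \<comment> \<open>There are countably many coefficients, so one exceptional null set of times
    serves all of them.\<close>
  then have "AE t in ivl 0 T. \<forall>k. a k t = 0" by (simp add: AE_all_countable)
  moreover have "AE t in ivl 0 T. t \<in> {0..T}" by (rule AE_I2) auto
  ultimately have "AE t in ivl 0 T. (\<lambda>x. e (x, t)) \<in> sq_int (ivl 0 1) \<and> l2n (ivl 0 1) (\<lambda>x. e (x, t)) \<le> 0"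
  proof eventually_elim
    case (elim t)
    note s = esl(1)[OF elim(2)]
    have "AE x in ivl 0 1. e (x, t) = 0"
      by (rule sines_complete[OF s]) (use elim(1) in \<open>simp add: a_def\<close>)
    then have "l2n (ivl 0 1) (\<lambda>x. e (x, t)) = l2n (ivl 0 1) (\<lambda>x. 0)"
      by (intro l2n_cong_AE sq_int_measurable[OF s]) auto
    then show ?case using s by simp
  qed
  from sq_int_Q(2)[OF less_imp_le[OF T] sq_int_measurable[OF es] order_refl this]
  have "l2n (lborel_on (Q T)) e = 0" by (simp add: antisym)
  from l2n_eq_0_imp_AE[OF es this] show ?thesis by (simp add: e_def)
qed

text \<open>Existence shows that the chosen \<open>wave_solution\<close> really is a solution, and
  uniqueness identifies it with d'Alembert's formula. From here on the choice no longer
  matters.\<close>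

corollary wave_solution_dalembert:
  assumes T: "0 < T" and p: "p \<in> per_l2" and d: "dalembert_data p (\<phi>\<^sub>0, \<phi>\<^sub>1)"
  shows "AE z in lborel_on (Q T). wave_solution T (\<phi>\<^sub>0, \<phi>\<^sub>1) z = dalembert p z"
    "wave_solution T (\<phi>\<^sub>0, \<phi>\<^sub>1) \<in> borel_measurable (lborel_on (Q T))"
proof -
  have s: "is_wave_solution T (\<phi>\<^sub>0, \<phi>\<^sub>1) (dalembert p)"
    by (rule dalembert_wave_solution[OF less_imp_le[OF T] p d])
  then have w: "is_wave_solution T (\<phi>\<^sub>0, \<phi>\<^sub>1) (wave_solution T (\<phi>\<^sub>0, \<phi>\<^sub>1))"
    unfolding wave_solution_def by (rule someI[where P = "is_wave_solution T (\<phi>\<^sub>0, \<phi>\<^sub>1)"])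
  show "AE z in lborel_on (Q T). wave_solution T (\<phi>\<^sub>0, \<phi>\<^sub>1) z = dalembert p z"
    by (rule wave_solution_unique[OF T w s])
  show "wave_solution T (\<phi>\<^sub>0, \<phi>\<^sub>1) \<in> borel_measurable (lborel_on (Q T))"
    using w unfolding is_wave_solution_def C0_L2_def by (simp add: set_borel_measurable_lborel_on)
qed

subsection \<open>Observability\<close>

text \<open>The change to characteristic coordinates u = t + x, v = t - x, carried out by
  one-dimensional affine substitutions and Fubini.\<close>

lemma nn_integral_rotate:
  fixes H :: "real \<times> real \<Rightarrow> ennreal"
  assumes [measurable]: "H \<in> borel_measurable (borel \<Otimes>\<^sub>M borel)"
  shows "(\<integral>\<^sup>+v. (\<integral>\<^sup>+u. H (u, v) \<partial>lborel) \<partial>lborel) = 2 * (\<integral>\<^sup>+t. (\<integral>\<^sup>+x. H (t + x, t - x) \<partial>lborel) \<partial>lborel)"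
proof -
  have Hm: "H \<in> borel_measurable (lborel \<Otimes>\<^sub>M lborel)" by measurable
  have 1: "(\<integral>\<^sup>+x. H (t + x, t - x) \<partial>lborel) = (\<integral>\<^sup>+u. H (u, 2 * t - u) \<partial>lborel)" for t
    using nn_integral_real_affine[of "\<lambda>u. H (u, 2 * t - u)" 1 t] by simp
  \<comment> \<open>For fixed u, substitute v = 2t - u; this scaling is the whole Jacobian.\<close>
  have 2: "(\<integral>\<^sup>+v. H (u, v) \<partial>lborel) = 2 * (\<integral>\<^sup>+t. H (u, 2 * t - u) \<partial>lborel)" for u
    using nn_integral_real_affine[of "\<lambda>v. H (u, v)" 2 "- u"] by simp
  have "(\<integral>\<^sup>+v. (\<integral>\<^sup>+u. H (u, v) \<partial>lborel) \<partial>lborel) = (\<integral>\<^sup>+u. (\<integral>\<^sup>+v. H (u, v) \<partial>lborel) \<partial>lborel)"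
    by (rule lborel_pair.Fubini[OF Hm])
  also have "\<dots> = 2 * (\<integral>\<^sup>+u. (\<integral>\<^sup>+t. H (u, 2 * t - u) \<partial>lborel) \<partial>lborel)"
    unfolding 2 by (rule nn_integral_cmult) measurable
  also have "(\<integral>\<^sup>+u. (\<integral>\<^sup>+t. H (u, 2 * t - u) \<partial>lborel) \<partial>lborel) = (\<integral>\<^sup>+t. (\<integral>\<^sup>+u. H (u, 2 * t - u) \<partial>lborel) \<partial>lborel)"
    by (rule lborel_pair.Fubini'[symmetric]) measurable
  finally show ?thesis unfolding 1 .
qed

section \<open>Periodic profiles on arbitrary intervals\<close>

lemma per_l2_const: "p \<in> per_l2 \<Longrightarrow> (\<lambda>u. p u - k) \<in> per_l2"
  unfolding per_l2_def by (auto intro!: sq_int_diff continuous_sq_int_ivl[OF continuous_on_const])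

lemma per_l2_sq_mass:
  assumes p: "p \<in> per_l2"
  shows "sq_mass p {a<..<a + 2} = sq_mass p {- 1<..<1}" "sq_mass p {- 1<..<1} < \<infinity>"
  using sq_mass_period[OF per_l2D(1,2)[OF p]] sq_int_iff_sq_mass[OF per_l2D(1)[OF p], of "{-1<..<1}"] per_l2D(3)[OF p]
  by auto

lemma per_l2_sq_int:
  assumes p: "p \<in> per_l2"
  shows "p \<in> sq_int (ivl a b)"
proof -
  have "sq_mass p {a<..<a + 2 * real n} < \<infinity>" for n
  proof (induction n)
    case 0
    then show ?case by (simp add: sq_mass_def)
  next
    case (Suc n)
    have "sq_mass p {a<..<a + 2 * real (Suc n)} = sq_mass p {a<..<a + 2 * real n} + sq_mass p {a + 2 * real n<..<(a + 2 * real n) + 2}"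
      using sq_mass_split[OF per_l2D(1)[OF p], of a "a + 2 * real n" "a + 2 * real (Suc n)"] by (simp add: algebra_simps)
    then show ?case using Suc per_l2_sq_mass[OF p] by simp
  qed
  moreover obtain n :: nat where "b - a \<le> real n" using real_arch_simple by blast
  then have "b \<le> a + 2 * real n" by linarith
  ultimately show ?thesis
    using sq_int_subinterval(1)[of p a "a + 2 * real n" a b] per_l2D(1)[OF p]
    by (simp add: sq_int_iff_sq_mass[OF per_l2D(1)[OF p]])
qed

lemma l2n_period:
  assumes p: "p \<in> per_l2"
  shows "l2n (ivl (-1) 1) p = l2n (ivl a (a + 2)) p"
proof -
  have "ennreal ((l2n (ivl (-1) 1) p)\<^sup>2) = ennreal ((l2n (ivl a (a + 2)) p)\<^sup>2)"
    using per_l2_sq_mass(1)[OF p, of a] by (simp add: ennreal_l2n_sq_mass per_l2_sq_int[OF p])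
  then show ?thesis by simp
qed

lemma l2n_union:
  assumes p: "p \<in> per_l2" and o: "a \<le> a'" "a' \<le> b" "b \<le> b'"
  shows "l2n (ivl a b') p \<le> l2n (ivl a b) p + l2n (ivl a' b') p"
proof (rule power2_le_imp_le)
  note s = per_l2_sq_int[OF p]
  have "ennreal ((l2n (ivl a b') p)\<^sup>2) = sq_mass p {a<..<b} + sq_mass p {b<..<b'}"
    using sq_mass_split[OF per_l2D(1)[OF p], of a b b'] o by (simp add: ennreal_l2n_sq_mass s)
  also have "\<dots> = ennreal ((l2n (ivl a b) p)\<^sup>2 + (l2n (ivl b b') p)\<^sup>2)"
    by (simp add: ennreal_plus ennreal_l2n_sq_mass s)
  finally have "(l2n (ivl a b') p)\<^sup>2 = (l2n (ivl a b) p)\<^sup>2 + (l2n (ivl b b') p)\<^sup>2"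
    by (subst (asm) ennreal_inj) auto
  also have "\<dots> \<le> (l2n (ivl a b) p)\<^sup>2 + (l2n (ivl a' b') p)\<^sup>2"
    using sq_int_subinterval(2)[OF s o(2) order_refl per_l2D(1)[OF p]] by (intro add_mono power_mono) auto
  also have "\<dots> \<le> (l2n (ivl a b) p + l2n (ivl a' b') p)\<^sup>2" by (simp add: power2_sum)
  finally show "(l2n (ivl a b') p)\<^sup>2 \<le> (l2n (ivl a b) p + l2n (ivl a' b') p)\<^sup>2" .
qed simp

section \<open>Control of the oscillation on intervals\<close>

lemma l2n_const: "l2n (ivl a b) (\<lambda>x. k) = \<bar>k\<bar> * sqrt (measure (ivl a b) {a<..<b})"
  by (simp add: l2n_def real_sqrt_mult mult.commute)

lemma measure_ivl: "a \<le> b \<Longrightarrow> measure (ivl a b) {a<..<b} = b - a"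
  by (simp add: measure_restrict_space)

text \<open>A bound on the L^2 distance from \<open>p\<close> to the constants. The constant
  \<open>k\<close> may depend on \<open>p\<close> but \<open>C\<close> may not; since
  \<open>dalembert\<close> does not see constants, nothing stronger can be expected.\<close>

definition osc_controlled :: "((real \<Rightarrow> real) \<Rightarrow> real) \<Rightarrow> real \<Rightarrow> real \<Rightarrow> bool" where
  "osc_controlled e a b \<longleftrightarrow> (\<exists>C\<ge>0. \<forall>p\<in>per_l2. \<exists>k. l2n (ivl a b) (\<lambda>u. p u - k) \<le> C * e p)"

text \<open>On the overlap, which has positive length, \<open>p\<close> is close to both constants,
  so the constants are close to each other and one of them serves the union.\<close>

lemma osc_controlled_union:
  assumes 1: "osc_controlled e a b" and 2: "osc_controlled e a' b'" and o: "a \<le> a'" "a' < b" "b \<le> b'"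
  shows "osc_controlled e a b'"
proof -
  obtain C where C: "C \<ge> 0" "\<And>p. p \<in> per_l2 \<Longrightarrow> \<exists>k. l2n (ivl a b) (\<lambda>u. p u - k) \<le> C * e p"
    using 1 unfolding osc_controlled_def by blast
  obtain D where D: "D \<ge> 0" "\<And>p. p \<in> per_l2 \<Longrightarrow> \<exists>k. l2n (ivl a' b') (\<lambda>u. p u - k) \<le> D * e p"
    using 2 unfolding osc_controlled_def by blast
  \<comment> \<open>The norm of a constant on the second interval compared with its norm on the
    overlap.\<close>
  define R where "R = sqrt (b' - a') / sqrt (b - a')"
  have R: "R \<ge> 0" using o by (simp add: R_def)
  have "\<exists>k. l2n (ivl a b') (\<lambda>u. p u - k) \<le> (C + (D + (C + D) * R)) * e p" if p: "p \<in> per_l2" for p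
  proof -
    obtain k where k: "l2n (ivl a b) (\<lambda>u. p u - k) \<le> C * e p" using C(2)[OF p] by blast
    obtain l where l: "l2n (ivl a' b') (\<lambda>u. p u - l) \<le> D * e p" using D(2)[OF p] by blast
    note pk = per_l2_const[OF p, of k] and pl = per_l2_const[OF p, of l]
    note sk = per_l2_sq_int[OF pk] and sl = per_l2_sq_int[OF pl]
    have "\<bar>l - k\<bar> * sqrt (b - a') = l2n (ivl a' b) (\<lambda>u. (p u - k) - (p u - l))"
      using o by (simp add: l2n_const measure_ivl)
    also have "\<dots> \<le> l2n (ivl a' b) (\<lambda>u. p u - k) + l2n (ivl a' b) (\<lambda>u. p u - l)"
      by (rule l2n_triangle_diff[OF sk sl])
    also have "\<dots> \<le> l2n (ivl a b) (\<lambda>u. p u - k) + l2n (ivl a' b') (\<lambda>u. p u - l)"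
      using o sq_int_subinterval(2)[OF sk _ _ per_l2D(1)[OF pk]] sq_int_subinterval(2)[OF sl _ _ per_l2D(1)[OF pl]]
      by (intro add_mono) auto
    also have "\<dots> \<le> (C + D) * e p" using k l by (simp add: distrib_right)
    finally have "\<bar>l - k\<bar> \<le> (C + D) * e p / sqrt (b - a')" using o by (simp add: field_simps)
    then have kl: "\<bar>l - k\<bar> * sqrt (b' - a') \<le> (C + D) * e p / sqrt (b - a') * sqrt (b' - a')"
      using o by (intro mult_right_mono) auto
    have "l2n (ivl a' b') (\<lambda>u. p u - k) = l2n (ivl a' b') (\<lambda>u. (p u - l) + (l - k))" by simp
    also have "\<dots> \<le> l2n (ivl a' b') (\<lambda>u. p u - l) + l2n (ivl a' b') (\<lambda>u. l - k)"
      by (rule l2n_triangle[OF sl]) (auto intro!: continuous_sq_int_ivl)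
    also have "l2n (ivl a' b') (\<lambda>u. l - k) = \<bar>l - k\<bar> * sqrt (b' - a')"
      using o by (simp add: l2n_const measure_ivl)
    finally have "l2n (ivl a' b') (\<lambda>u. p u - k) \<le> D * e p + (C + D) * R * e p"
      using l kl by (simp add: R_def mult_ac)
    then have "l2n (ivl a b') (\<lambda>u. p u - k) \<le> C * e p + (D * e p + (C + D) * R * e p)"
      using l2n_union[OF pk o(1) less_imp_le[OF o(2)] o(3)] k by linarith
    then show ?thesis by (intro exI[of _ k]) (simp add: algebra_simps)
  qed
  moreover have "0 \<le> C + (D + (C + D) * R)" using C D R by simp
  ultimately show ?thesis unfolding osc_controlled_def by blast
qed

text \<open>Windows of half-width \<open>\<epsilon>\<close> whose centres advance by at most
  \<open>\<epsilon>\<close> overlap, so finitely many steps join them from \<open>A\<close> to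
  \<open>B\<close>.\<close>

lemma osc_controlled_chain:
  assumes loc: "\<And>x. A \<le> x \<Longrightarrow> x \<le> B \<Longrightarrow> osc_controlled e (x - \<epsilon>) (x + \<epsilon>)" and \<epsilon>: "0 < \<epsilon>" and AB: "A \<le> B"
  shows "osc_controlled e (A - \<epsilon>) (B + \<epsilon>)"
proof -
  have "osc_controlled e (A - \<epsilon>) (min B (A + real n * \<epsilon>) + \<epsilon>)" for n
  proof (induction n)
    case 0
    then show ?case using loc[of A] AB by (simp add: min_def)
  next
    case (Suc n)
    define x where "x = min B (A + real (Suc n) * \<epsilon>)"
    have x: "A \<le> x" "x \<le> B" "min B (A + real n * \<epsilon>) \<le> x" "x \<le> min B (A + real n * \<epsilon>) + \<epsilon>"
      using \<epsilon> AB by (auto simp: x_def min_def algebra_simps)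
    have "osc_controlled e (A - \<epsilon>) (x + \<epsilon>)"
      by (rule osc_controlled_union[OF Suc loc[OF x(1,2)]]) (use x \<epsilon> in auto)
    then show ?case by (simp add: x_def)
  qed
  moreover obtain n :: nat where "(B - A) / \<epsilon> \<le> real n" using real_arch_simple by blast
  then have "B \<le> A + real n * \<epsilon>" using \<epsilon> by (simp add: field_simps)
  ultimately show ?thesis by (metis min.absorb1)
qed

text \<open>With the square root of the weight, the energy is a squared L^2 norm over the whole
  cylinder and the Hilbert space lemmas apply. The tube is absent because \<open>chi\<close>
  vanishes outside it.\<close>

definition tube_wave :: "(real \<Rightarrow> real) \<Rightarrow> (real \<Rightarrow> real) \<Rightarrow> (real \<Rightarrow> real) \<Rightarrow> real \<times> real \<Rightarrow> real" where
  "tube_wave chi c p z = sqrt (chi (fst z - c (snd z))) * dalembert p z"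

definition tube_norm :: "real \<Rightarrow> (real \<Rightarrow> real) \<Rightarrow> (real \<Rightarrow> real) \<Rightarrow> (real \<Rightarrow> real) \<Rightarrow> real" where
  "tube_norm T chi c p = l2n (lborel_on (Q T)) (tube_wave chi c p)"

text \<open>The curve \<open>c\<close> is a pointwise Lipschitz function on the whole line, that is,
  a good representative; admissible curves are connected to it by equality almost
  everywhere.\<close>

locale moving_cutoff =
  fixes T \<delta>\<^sub>0 \<delta> M :: real and chi c :: "real \<Rightarrow> real"
  assumes T: "2 \<le> T" and \<delta>: "\<delta> < \<delta>\<^sub>0" "0 < \<delta>\<^sub>0" "0 < \<delta>" and M: "0 < M" and cutoff: "is_cutoff \<delta>\<^sub>0 \<delta> chi"
    and lip: "\<bar>c s - c t\<bar> \<le> M * \<bar>s - t\<bar>" and inside: "\<delta>\<^sub>0 \<le> c t" "c t \<le> 1 - \<delta>\<^sub>0"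
begin

abbreviation D where "D \<equiv> tube_wave chi c"
abbreviation e where "e \<equiv> tube_norm T chi c"
abbreviation MQ where "MQ \<equiv> lborel_on (Q T)"

lemma T_pos: "0 < T" "0 \<le> T" using T by auto

lemma c_continuous: "continuous_on UNIV c"
proof -
  have "M-lipschitz_on UNIV c"
    by (rule lipschitz_onI) (use lip M in \<open>auto simp: dist_real_def\<close>)
  then show ?thesis by (rule lipschitz_on_continuous_on)
qed

lemma chi_props: "continuous_on UNIV chi" "0 \<le> chi s" "chi s \<le> 1"
  "\<bar>s\<bar> \<le> \<delta>\<^sub>0 - \<delta> \<Longrightarrow> chi s = 1" "\<delta>\<^sub>0 \<le> \<bar>s\<bar> \<Longrightarrow> chi s = 0"
proof -
  have "chi C1_differentiable_on UNIV" using cutoff by (simp add: is_cutoff_def)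
  then show "continuous_on UNIV chi" by (rule C1_differentiable_imp_continuous_on)
  show "0 \<le> chi s" "chi s \<le> 1" using cutoff by (simp_all add: is_cutoff_def)
  have one: "\<forall>s\<in>{- \<delta>\<^sub>0 + \<delta>..\<delta>\<^sub>0 - \<delta>}. chi s = 1" using cutoff by (simp add: is_cutoff_def)
  show "\<bar>s\<bar> \<le> \<delta>\<^sub>0 - \<delta> \<Longrightarrow> chi s = 1" by (rule bspec[OF one]) (auto simp: abs_le_iff)
  have zero: "\<forall>s. s \<notin> {- \<delta>\<^sub>0<..<\<delta>\<^sub>0} \<longrightarrow> chi s = 0" using cutoff by (simp add: is_cutoff_def)
  show "\<delta>\<^sub>0 \<le> \<bar>s\<bar> \<Longrightarrow> chi s = 0" by (rule mp[OF spec[OF zero]]) auto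
qed

lemma weight_measurable: "(\<lambda>z. sqrt (chi (fst z - c (snd z)))) \<in> borel_measurable borel"
  by (intro borel_measurable_continuous_onI continuous_intros continuous_on_compose2[OF chi_props(1)]
      continuous_on_compose2[OF c_continuous]) auto

lemma tube_wave_sq_int:
  assumes p: "p \<in> per_l2"
  shows "D p \<in> sq_int MQ" "e p \<le> 2 * sqrt T * l2n (ivl (-1) 1) p"
proof -
  note d = dalembert_sq_int_Q[OF T_pos(2) p]
  have b: "\<bar>sqrt (chi (fst z - c (snd z)))\<bar> \<le> 1" for z using chi_props(2,3) by simp
  note m = borel_measurable_lborel_on[OF weight_measurable, of "Q T"]
  show "D p \<in> sq_int MQ"
    unfolding tube_wave_def [abs_def] by (rule sq_int_mult_bounded[OF d(1) m b])
  have "e p \<le> 1 * l2n MQ (dalembert p)"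
    unfolding tube_norm_def tube_wave_def [abs_def] by (rule l2n_mult_bounded[OF d(1) m b]) simp
  with d(2) show "e p \<le> 2 * sqrt T * l2n (ivl (-1) 1) p" by simp
qed

lemma tube_wave_linear:
  "D (\<lambda>u. \<alpha> * p u + \<beta> * q u) = (\<lambda>z. \<alpha> * D p z + \<beta> * D q z)"
  "D (\<lambda>u. p u - q u) = (\<lambda>z. D p z - D q z)"
  "D (\<lambda>u. p u - k) = D p"
  by (auto simp: tube_wave_def dalembert_def fun_eq_iff algebra_simps)

text \<open>In characteristic coordinates the wave is p u - p v. A square of half-side
  \<open>\<epsilon>\<close> about the point of the curve at time \<open>t0\<close> stays within (1 +
  M) \<epsilon> of the curve, where the weight is 1, so the energy bounds the integral of (p u - p
  v)^2 over it. The factor 2 is the Jacobian.\<close>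

lemma square_mass_le:
  assumes p: "p \<in> per_l2" and t0: "\<epsilon> \<le> t0" "t0 \<le> T - \<epsilon>" and \<epsilon>: "0 < \<epsilon>" "(1 + M) * \<epsilon> \<le> \<delta>\<^sub>0 - \<delta>"
  shows "(\<integral>\<^sup>+v. sq_mass (\<lambda>u. p u - p v) {t0 + c t0 - \<epsilon><..<t0 + c t0 + \<epsilon>} * indicator {t0 - c t0 - \<epsilon><..<t0 - c t0 + \<epsilon>} v \<partial>lborel)
     \<le> 2 * ennreal ((e p)\<^sup>2)"
    "(\<integral>\<^sup>+u. sq_mass (\<lambda>v. p v - p u) {t0 - c t0 - \<epsilon><..<t0 - c t0 + \<epsilon>} * indicator {t0 + c t0 - \<epsilon><..<t0 + c t0 + \<epsilon>} u \<partial>lborel)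
     \<le> 2 * ennreal ((e p)\<^sup>2)"
proof -
  note [measurable] = per_l2D(1)[OF p]
  let ?I = "{t0 + c t0 - \<epsilon><..<t0 + c t0 + \<epsilon>}" and ?J = "{t0 - c t0 - \<epsilon><..<t0 - c t0 + \<epsilon>}"
  define H where "H = (\<lambda>(u, v). ennreal ((p u - p v)\<^sup>2) * indicator ?I u * indicator ?J v)"
  have Hm [measurable]: "H \<in> borel_measurable (borel \<Otimes>\<^sub>M borel)" unfolding H_def by measurable
  define f where "f z = ennreal ((D p z)\<^sup>2) * indicator (Q T) z" for z
  note Ds = tube_wave_sq_int(1)[OF p]
  have "(\<lambda>z. ennreal ((D p z)\<^sup>2)) \<in> borel_measurable MQ" using sq_int_measurable[OF Ds] by measurable
  then have "f \<in> borel_measurable lborel"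
    unfolding f_def by (subst (asm) borel_measurable_restrict_space_iff_ennreal) auto
  then have fm: "f \<in> borel_measurable (lborel \<Otimes>\<^sub>M lborel)" by (simp only: lborel_prod)
  have le: "H (t + x, t - x) \<le> f (x, t)" for x t
  proof (cases "t + x \<in> ?I \<and> t - x \<in> ?J")
    case True
    \<comment> \<open>\<open>t\<close> and \<open>x\<close> are half the sum and half the difference
      of the characteristic coordinates.\<close>
    then have b: "\<bar>t - t0\<bar> < \<epsilon>" "\<bar>x - c t0\<bar> < \<epsilon>" by auto
    have "\<bar>c t - c t0\<bar> \<le> M * \<bar>t - t0\<bar>" by (rule lip)
    also have "\<dots> \<le> M * \<epsilon>" using b(1) M by (intro mult_left_mono) auto
    finally have s: "\<bar>x - c t\<bar> \<le> \<delta>\<^sub>0 - \<delta>" using b \<epsilon>(2) by (simp add: distrib_right)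
    have "(x, t) \<in> Q T" using s b t0 inside[of t] \<delta> by (auto simp: Q_def)
    then have "f (x, t) = ennreal ((p (t + x) - p (t - x))\<^sup>2)"
      using chi_props(4)[OF s] by (simp add: f_def tube_wave_def dalembert_def)
    then show ?thesis using True by (simp add: H_def)
  next
    case False
    then show ?thesis by (auto simp: H_def)
  qed
  have "(\<integral>\<^sup>+v. (\<integral>\<^sup>+u. H (u, v) \<partial>lborel) \<partial>lborel) = 2 * (\<integral>\<^sup>+t. (\<integral>\<^sup>+x. H (t + x, t - x) \<partial>lborel) \<partial>lborel)"
    by (rule nn_integral_rotate[OF Hm])
  also have "\<dots> \<le> 2 * (\<integral>\<^sup>+t. (\<integral>\<^sup>+x. f (x, t) \<partial>lborel) \<partial>lborel)"
    by (intro mult_left_mono nn_integral_mono le) auto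
  also have "(\<integral>\<^sup>+t. (\<integral>\<^sup>+x. f (x, t) \<partial>lborel) \<partial>lborel) = (\<integral>\<^sup>+z. f z \<partial>lborel)"
    using lborel_pair.nn_integral_snd[OF fm] by (simp only: lborel_prod)
  also have "\<dots> = ennreal ((e p)\<^sup>2)"
    unfolding tube_norm_def ennreal_l2n_power2[OF Ds] f_def by (subst nn_integral_restrict_space) auto
  finally have main: "(\<integral>\<^sup>+v. (\<integral>\<^sup>+u. H (u, v) \<partial>lborel) \<partial>lborel) \<le> 2 * ennreal ((e p)\<^sup>2)" .
  have i1: "(\<integral>\<^sup>+u. H (u, v) \<partial>lborel) = sq_mass (\<lambda>u. p u - p v) ?I * indicator ?J v" for v
    unfolding sq_mass_def H_def prod.case by (rule nn_integral_multc) measurable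
  show "(\<integral>\<^sup>+v. sq_mass (\<lambda>u. p u - p v) ?I * indicator ?J v \<partial>lborel) \<le> 2 * ennreal ((e p)\<^sup>2)"
    using main unfolding i1 .
  have i2: "(\<integral>\<^sup>+v. H (u, v) \<partial>lborel) = sq_mass (\<lambda>v. p v - p u) ?J * indicator ?I u" for u
  proof -
    have "(\<integral>\<^sup>+v. H (u, v) \<partial>lborel) = (\<integral>\<^sup>+v. (ennreal ((p v - p u)\<^sup>2) * indicator ?J v) * indicator ?I u \<partial>lborel)"
      by (intro nn_integral_cong) (auto simp: H_def power2_commute indicator_def)
    also have "\<dots> = sq_mass (\<lambda>v. p v - p u) ?J * indicator ?I u"
      unfolding sq_mass_def by (rule nn_integral_multc) measurable
    finally show ?thesis .
  qed
  have "H \<in> borel_measurable (lborel \<Otimes>\<^sub>M lborel)" by measurable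
  from lborel_pair.Fubini[OF this] main
  have "(\<integral>\<^sup>+u. (\<integral>\<^sup>+v. H (u, v) \<partial>lborel) \<partial>lborel) \<le> 2 * ennreal ((e p)\<^sup>2)" by simp
  then show "(\<integral>\<^sup>+u. sq_mass (\<lambda>v. p v - p u) ?J * indicator ?I u \<partial>lborel) \<le> 2 * ennreal ((e p)\<^sup>2)"
    unfolding i2 .
qed

text \<open>Some value of \<open>p\<close> in the second interval does at least as well as the average.\<close>

lemma averaged_constant:
  assumes p: "p \<in> per_l2" and \<epsilon>: "0 < \<epsilon>"
    and le: "(\<integral>\<^sup>+v. sq_mass (\<lambda>u. p u - p v) {x - \<epsilon><..<x + \<epsilon>} * indicator {y - \<epsilon><..<y + \<epsilon>} v \<partial>lborel) \<le> 2 * ennreal (E\<^sup>2)"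
    and E: "0 \<le> E"
  shows "\<exists>k. l2n (ivl (x - \<epsilon>) (x + \<epsilon>)) (\<lambda>u. p u - k) \<le> (1 / sqrt \<epsilon>) * E"
proof -
  note [measurable] = per_l2D(1)[OF p]
  let ?F = "\<lambda>v. sq_mass (\<lambda>u. p u - p v) {x - \<epsilon><..<x + \<epsilon>}" and ?J = "{y - \<epsilon><..<y + \<epsilon>}"
  have Fm [measurable]: "?F \<in> borel_measurable borel" unfolding sq_mass_def by measurable
  have "\<exists>v. ?F v \<le> ennreal (E\<^sup>2 / \<epsilon>)"
  proof (rule ccontr)
    assume "\<not> ?thesis"
    \<comment> \<open>The interval has length 2 \<epsilon>, so exceeding E^2 / \<epsilon> at every
      \<open>v\<close> would push the integral above 2 E^2.\<close>
    then have lt: "ennreal (E\<^sup>2 / \<epsilon>) < ?F v" for v by (simp add: not_le)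
    let ?g = "\<lambda>v. ennreal (E\<^sup>2 / \<epsilon>) * indicator ?J v"
    have int: "(\<integral>\<^sup>+v. ?g v \<partial>lborel) = 2 * ennreal (E\<^sup>2)"
    proof -
      have "(\<integral>\<^sup>+v. ?g v \<partial>lborel) = ennreal (E\<^sup>2 / \<epsilon>) * ennreal (2 * \<epsilon>)"
        using \<epsilon> by (subst nn_integral_cmult_indicator) auto
      also have "\<dots> = ennreal (2 * E\<^sup>2)" using \<epsilon> by (subst ennreal_mult[symmetric]) auto
      finally show ?thesis by (simp add: ennreal_mult)
    qed
    have "(\<integral>\<^sup>+v. ?g v \<partial>lborel) < (\<integral>\<^sup>+v. ?F v * indicator ?J v \<partial>lborel)"
    proof (rule nn_integral_less)
      show "(\<integral>\<^sup>+v. ?g v \<partial>lborel) \<noteq> \<infinity>" unfolding int by (simp add: ennreal_mult_eq_top_iff)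
      show "AE v in lborel. ?g v \<le> ?F v * indicator ?J v"
        by (rule AE_I2) (use lt less_imp_le in \<open>auto simp: indicator_def\<close>)
      show "\<not> (AE v in lborel. ?F v * indicator ?J v \<le> ?g v)"
      proof
        assume "AE v in lborel. ?F v * indicator ?J v \<le> ?g v"
        then have "AE v in lborel. v \<notin> ?J"
        proof eventually_elim
          fix v assume h: "?F v * indicator ?J v \<le> ?g v"
          show "v \<notin> ?J"
          proof
            assume "v \<in> ?J"
            with h have "?F v \<le> ennreal (E\<^sup>2 / \<epsilon>)" by simp
            with lt[of v] show False by simp
          qed
        qed
        then have "?J \<in> null_sets lborel" by (subst (asm) AE_iff_null_sets[symmetric]) auto
        then show False using \<epsilon> by (simp add: null_sets_def)
      qed
    qed measurable
    with le int show False by simp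
  qed
  then obtain v where v: "?F v \<le> ennreal (E\<^sup>2 / \<epsilon>)" by blast
  note s = per_l2_sq_int[OF per_l2_const[OF p, of "p v"], of "x - \<epsilon>" "x + \<epsilon>"]
  have "ennreal ((l2n (ivl (x - \<epsilon>) (x + \<epsilon>)) (\<lambda>u. p u - p v))\<^sup>2) \<le> ennreal (E\<^sup>2 / \<epsilon>)"
    using v by (simp add: ennreal_l2n_sq_mass s)
  then have "(l2n (ivl (x - \<epsilon>) (x + \<epsilon>)) (\<lambda>u. p u - p v))\<^sup>2 \<le> E\<^sup>2 / \<epsilon>" using \<epsilon> by simp
  also have "\<dots> = ((1 / sqrt \<epsilon>) * E)\<^sup>2" using \<epsilon> by (simp add: power_divide)
  finally have "l2n (ivl (x - \<epsilon>) (x + \<epsilon>)) (\<lambda>u. p u - p v) \<le> (1 / sqrt \<epsilon>) * E"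
    by (rule power2_le_imp_le) (use E \<epsilon> in simp)
  then show ?thesis by blast
qed

lemma osc_controlled_local:
  assumes t0: "\<epsilon> \<le> t0" "t0 \<le> T - \<epsilon>" and \<epsilon>: "0 < \<epsilon>" "(1 + M) * \<epsilon> \<le> \<delta>\<^sub>0 - \<delta>"
  shows "osc_controlled e (t0 + c t0 - \<epsilon>) (t0 + c t0 + \<epsilon>)" "osc_controlled e (t0 - c t0 - \<epsilon>) (t0 - c t0 + \<epsilon>)"
proof -
  have e0: "0 \<le> e p" for p by (simp add: tube_norm_def)
  have s: "0 \<le> 1 / sqrt \<epsilon>" using \<epsilon> by simp
  show "osc_controlled e (t0 + c t0 - \<epsilon>) (t0 + c t0 + \<epsilon>)"
    unfolding osc_controlled_def
    using averaged_constant[OF _ \<epsilon>(1) square_mass_le(1)[OF _ t0 \<epsilon>] e0] s by blast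
  show "osc_controlled e (t0 - c t0 - \<epsilon>) (t0 - c t0 + \<epsilon>)"
    unfolding osc_controlled_def
    using averaged_constant[OF _ \<epsilon>(1) square_mass_le(2)[OF _ t0 \<epsilon>] e0] s by blast
qed

text \<open>Along the curve both \<open>t + c t\<close> and \<open>t - c t\<close> sweep intervals, and one of them has
  length at least \<open>T\<close>, hence covers a period.\<close>

theorem observability: "osc_controlled e (-1) 1"
proof -
  \<comment> \<open>The first bound keeps the characteristic squares where the weight is 1; the
    second, with T \<ge> 2, leaves room between \<epsilon> and T - \<epsilon>.\<close>
  define \<epsilon> where "\<epsilon> = min ((\<delta>\<^sub>0 - \<delta>) / (1 + M)) (1 / 2)"
  have \<epsilon>: "0 < \<epsilon>" "\<epsilon> \<le> 1 / 2" "(1 + M) * \<epsilon> \<le> \<delta>\<^sub>0 - \<delta>"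
  proof -
    show "0 < \<epsilon>" using \<delta> M by (simp add: \<epsilon>_def)
    show "\<epsilon> \<le> 1 / 2" unfolding \<epsilon>_def by (rule min.cobounded2)
    have "(1 + M) * \<epsilon> \<le> (1 + M) * ((\<delta>\<^sub>0 - \<delta>) / (1 + M))"
      using M by (intro mult_left_mono) (auto simp: \<epsilon>_def)
    then show "(1 + M) * \<epsilon> \<le> \<delta>\<^sub>0 - \<delta>" using M by simp
  qed
  have te: "\<epsilon> \<le> T - \<epsilon>" "\<epsilon> < T - \<epsilon>" using \<epsilon> T by auto
  have period: "osc_controlled e (-1) 1" if "osc_controlled e a b" "a + 2 \<le> b" for a b
  proof -
    obtain C where C: "C \<ge> 0" "\<And>p. p \<in> per_l2 \<Longrightarrow> \<exists>k. l2n (ivl a b) (\<lambda>u. p u - k) \<le> C * e p"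
      using \<open>osc_controlled e a b\<close> unfolding osc_controlled_def by blast
    have "\<exists>k. l2n (ivl (-1) 1) (\<lambda>u. p u - k) \<le> C * e p" if p: "p \<in> per_l2" for p
    proof -
      obtain k where k: "l2n (ivl a b) (\<lambda>u. p u - k) \<le> C * e p" using C(2)[OF p] by blast
      note pk = per_l2_const[OF p, of k]
      have "l2n (ivl (-1) 1) (\<lambda>u. p u - k) = l2n (ivl a (a + 2)) (\<lambda>u. p u - k)" by (rule l2n_period[OF pk])
      also have "\<dots> \<le> l2n (ivl a b) (\<lambda>u. p u - k)"
        by (rule sq_int_subinterval(2)[OF per_l2_sq_int[OF pk] order_refl \<open>a + 2 \<le> b\<close> per_l2D(1)[OF pk]])
      finally show ?thesis using k by (intro exI[of _ k]) simp
    qed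
    then show ?thesis using C(1) unfolding osc_controlled_def by blast
  qed
  \<comment> \<open>By the intermediate value theorem every centre between the two end values is
    attained at some admissible time.\<close>
  have swept: "osc_controlled e (f \<epsilon> - \<epsilon>) (f (T - \<epsilon>) + \<epsilon>)"
    if f: "continuous_on UNIV f" and fl: "f \<epsilon> \<le> f (T - \<epsilon>)"
      and loc: "\<And>t. \<epsilon> \<le> t \<Longrightarrow> t \<le> T - \<epsilon> \<Longrightarrow> osc_controlled e (f t - \<epsilon>) (f t + \<epsilon>)" for f
  proof (rule osc_controlled_chain[OF _ \<epsilon>(1) fl])
    fix x assume x: "f \<epsilon> \<le> x" "x \<le> f (T - \<epsilon>)"
    obtain t where "\<epsilon> \<le> t" "t \<le> T - \<epsilon>" "f t = x"
      using IVT'[OF x te(1) continuous_on_subset[OF f]] by auto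
    with loc[of t] show "osc_controlled e (x - \<epsilon>) (x + \<epsilon>)" by simp
  qed
  show ?thesis
  proof (cases "c \<epsilon> \<le> c (T - \<epsilon>)")
    case True
    \<comment> \<open>The half-widths of the extreme windows restore the \<epsilon> cut off at each
      end of the time interval, so the swept length is T plus the nonnegative increment of
      \<open>c\<close>.\<close>
    have "osc_controlled e ((\<epsilon> + c \<epsilon>) - \<epsilon>) ((T - \<epsilon> + c (T - \<epsilon>)) + \<epsilon>)"
      by (rule swept[of "\<lambda>t. t + c t"])
        (use True te osc_controlled_local(1)[OF _ _ \<epsilon>(1,3)] in \<open>auto intro!: continuous_intros c_continuous\<close>)
    then show ?thesis by (rule period) (use True T in auto)
  next
    case False
    have "osc_controlled e ((\<epsilon> - c \<epsilon>) - \<epsilon>) ((T - \<epsilon> - c (T - \<epsilon>)) + \<epsilon>)"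
      by (rule swept[of "\<lambda>t. t - c t"])
        (use False te osc_controlled_local(2)[OF _ _ \<epsilon>(1,3)] in \<open>auto intro!: continuous_intros c_continuous\<close>)
    then show ?thesis by (rule period) (use False T in auto)
  qed
qed

end

subsection \<open>The minimizer\<close>

text \<open>The linear part \<open>\<langle>\<phi>\<^sub>1, y\<^sub>0\<rangle> - \<langle>\<phi>\<^sub>0, y\<^sub>1\<rangle>\<close> in terms of the profile \<open>p\<close> of the data.\<close>

definition data_pairing :: "(real \<Rightarrow> real) \<Rightarrow> (real \<Rightarrow> real) \<Rightarrow> (real \<Rightarrow> real) \<Rightarrow> real" where
  "data_pairing y\<^sub>0 y\<^sub>1 p = - (\<integral>x. dalembert_flux p 0 x * weak_deriv y\<^sub>0 x \<partial>ivl 0 1)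
     - (\<integral>x. dalembert p (x, 0) * y\<^sub>1 x \<partial>ivl 0 1)"

lemma data_pairing_linear:
  assumes p: "p \<in> per_l2" and q: "q \<in> per_l2" and y: "y\<^sub>0 \<in> H10" "y\<^sub>1 \<in> sq_int (ivl 0 1)"
  shows "data_pairing y\<^sub>0 y\<^sub>1 (\<lambda>u. \<alpha> * p u + \<beta> * q u) = \<alpha> * data_pairing y\<^sub>0 y\<^sub>1 p + \<beta> * data_pairing y\<^sub>0 y\<^sub>1 q"
proof -
  note w = H10_weak_deriv(2)[OF y(1)]
  note i = integrable_mult_sq_int[OF dalembert_slice(3)[OF p, of 0] w] integrable_mult_sq_int[OF dalembert_slice(3)[OF q, of 0] w]
    integrable_mult_sq_int[OF dalembert_slice(1)[OF p, of 0] y(2)] integrable_mult_sq_int[OF dalembert_slice(1)[OF q, of 0] y(2)]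
  have 1: "dalembert_flux (\<lambda>u. \<alpha> * p u + \<beta> * q u) 0 x * weak_deriv y\<^sub>0 x
      = \<alpha> * (dalembert_flux p 0 x * weak_deriv y\<^sub>0 x) + \<beta> * (dalembert_flux q 0 x * weak_deriv y\<^sub>0 x)" for x
    by (simp add: dalembert_flux_def algebra_simps)
  have 2: "dalembert (\<lambda>u. \<alpha> * p u + \<beta> * q u) (x, 0) * y\<^sub>1 x
      = \<alpha> * (dalembert p (x, 0) * y\<^sub>1 x) + \<beta> * (dalembert q (x, 0) * y\<^sub>1 x)" for x
    by (simp add: dalembert_def algebra_simps)
  show ?thesis unfolding data_pairing_def 1 2 using i by (simp add: algebra_simps)
qed

text \<open>A constant changes the flux by a constant, which pairs to zero with a weak derivative of
  vanishing mean. Hence the linear part is controlled by the energy although the energy ignores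
  constants.\<close>

lemma data_pairing_const:
  assumes p: "p \<in> per_l2" and y: "y\<^sub>0 \<in> H10"
  shows "data_pairing y\<^sub>0 y\<^sub>1 (\<lambda>u. p u - k) = data_pairing y\<^sub>0 y\<^sub>1 p"
proof -
  note w = H10_weak_deriv(2,3)[OF y]
  note i = integrable_mult_sq_int[OF dalembert_slice(3)[OF p, of 0] w(1)]
  have 1: "dalembert_flux (\<lambda>u. p u - k) 0 x * weak_deriv y\<^sub>0 x
      = dalembert_flux p 0 x * weak_deriv y\<^sub>0 x - (2 * k) * weak_deriv y\<^sub>0 x" for x
    by (simp add: dalembert_flux_def algebra_simps)
  have 2: "dalembert (\<lambda>u. p u - k) (x, 0) = dalembert p (x, 0)" for x by (simp add: dalembert_def)
  show ?thesis
    unfolding data_pairing_def 1 2 using i w(2) sq_int_imp_integrable[OF finite_measure_ivl w(1)] by simp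
qed

lemma data_pairing_bound:
  assumes p: "p \<in> per_l2" and y: "y\<^sub>0 \<in> H10" "y\<^sub>1 \<in> sq_int (ivl 0 1)"
  shows "\<bar>data_pairing y\<^sub>0 y\<^sub>1 p\<bar> \<le> 2 * (l2n (ivl 0 1) (weak_deriv y\<^sub>0) + l2n (ivl 0 1) y\<^sub>1) * l2n (ivl (-1) 1) p"
proof -
  let ?N = "l2n (ivl (-1) 1) p"
  note w = H10_weak_deriv(2)[OF y(1)]
  have "\<bar>\<integral>x. dalembert_flux p 0 x * weak_deriv y\<^sub>0 x \<partial>ivl 0 1\<bar> \<le> 2 * ?N * l2n (ivl 0 1) (weak_deriv y\<^sub>0)"
    by (rule order_trans[OF l2n_Cauchy_Schwarz[OF dalembert_slice(3)[OF p] w]])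
      (intro mult_right_mono dalembert_slice(4)[OF p], simp)
  moreover have "\<bar>\<integral>x. dalembert p (x, 0) * y\<^sub>1 x \<partial>ivl 0 1\<bar> \<le> 2 * ?N * l2n (ivl 0 1) y\<^sub>1"
    by (rule order_trans[OF l2n_Cauchy_Schwarz[OF dalembert_slice(1)[OF p] y(2)]])
      (intro mult_right_mono dalembert_slice(2)[OF p], simp)
  ultimately show ?thesis unfolding data_pairing_def by (simp add: algebra_simps)
qed

definition mean :: "(real \<Rightarrow> real) \<Rightarrow> real" where
  "mean p = (\<integral>u. p u \<partial>ivl (-1) 1) / 2"

lemma mean_diff:
  assumes "p \<in> per_l2" "q \<in> per_l2"
  shows "mean (\<lambda>u. p u - q u) = mean p - mean q"
  unfolding mean_def using sq_int_imp_integrable[OF finite_measure_ivl per_l2D(3)] assms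
  by (simp add: diff_divide_distrib)

text \<open>Replaces an unspecified constant by the mean, at the price of a factor 2. The mean is
  linear in the profile, so differences of normalized profiles are again normalized.\<close>

lemma l2n_minus_mean_le:
  assumes p: "p \<in> per_l2"
  shows "l2n (ivl (-1) 1) (\<lambda>u. p u - mean p) \<le> 2 * l2n (ivl (-1) 1) (\<lambda>u. p u - k)"
proof -
  let ?M = "ivl (-1) 1"
  note q = per_l2_const[OF p, of k]
  define q where "q u = p u - k" for u
  have qp: "q \<in> per_l2" unfolding q_def by (rule q)
  have one: "(\<lambda>u. 1) \<in> sq_int ?M" by (rule continuous_sq_int_ivl[OF continuous_on_const])
  have "mean q = mean p - k"
    unfolding mean_def q_def
    using Bochner_Integration.integral_diff[OF sq_int_imp_integrable[OF finite_measure_ivl per_l2D(3)[OF p]]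
        sq_int_imp_integrable[OF finite_measure_ivl continuous_sq_int_ivl[OF continuous_on_const[of _ k]]]]
      measure_ivl[of "-1" 1]
    by (simp add: diff_divide_distrib)
  then have "l2n ?M (\<lambda>u. p u - mean p) = l2n ?M (\<lambda>u. q u - mean q)" by (simp add: q_def)
  also have "\<dots> \<le> l2n ?M q + l2n ?M (\<lambda>u. mean q)"
    by (rule l2n_triangle_diff[OF per_l2D(3)[OF qp] continuous_sq_int_ivl[OF continuous_on_const]])
  also have "l2n ?M (\<lambda>u. mean q) \<le> l2n ?M q"
  proof -
    have "\<bar>\<integral>u. q u * 1 \<partial>?M\<bar> \<le> l2n ?M q * l2n ?M (\<lambda>u. 1)"
      by (rule l2n_Cauchy_Schwarz[OF per_l2D(3)[OF qp] one])
    \<comment> \<open>The integral is twice the mean, and sqrt 2 is the norm of the constant 1 on an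
      interval of length 2.\<close>
    then have "(\<bar>mean q\<bar> * sqrt 2) * sqrt 2 \<le> l2n ?M q * sqrt 2"
      using measure_ivl[of "-1" 1] by (simp add: mean_def l2n_const mult.assoc)
    then have "\<bar>mean q\<bar> * sqrt 2 \<le> l2n ?M q" by (rule mult_right_le_imp_le) simp
    then show ?thesis using measure_ivl[of "-1" 1] by (simp add: l2n_const)
  qed
  finally show ?thesis by (simp add: q_def [abs_def])
qed

context moving_cutoff
begin

lemma coercive:
  obtains C where "0 \<le> C" "\<And>p. p \<in> per_l2 \<Longrightarrow> l2n (ivl (-1) 1) (\<lambda>u. p u - mean p) \<le> C * e p"
proof -
  obtain C where C: "C \<ge> 0" "\<And>p. p \<in> per_l2 \<Longrightarrow> \<exists>k. l2n (ivl (-1) 1) (\<lambda>u. p u - k) \<le> C * e p"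
    using observability unfolding osc_controlled_def by blast
  show ?thesis
  proof (rule that)
    show "0 \<le> 2 * C" using C by simp
    fix p assume p: "p \<in> per_l2"
    obtain k where "l2n (ivl (-1) 1) (\<lambda>u. p u - k) \<le> C * e p" using C(2)[OF p] by blast
    with l2n_minus_mean_le[OF p, of k] show "l2n (ivl (-1) 1) (\<lambda>u. p u - mean p) \<le> 2 * C * e p" by linarith
  qed
qed

text \<open>The Euler-Lagrange equation. The representing element must be \<open>D p\<close> for an
  actual profile, and a limit in L^2 of the cylinder need not obviously be one; coercivity transfers
  the Cauchy property from the waves to their normalized profiles, whose limit is the desired
  \<open>p\<close>.\<close>

lemma optimality_system:
  assumes y: "y\<^sub>0 \<in> H10" "y\<^sub>1 \<in> sq_int (ivl 0 1)"
  shows "\<exists>p\<in>per_l2. \<forall>q\<in>per_l2. (\<integral>z. D p z * D q z \<partial>MQ) = data_pairing y\<^sub>0 y\<^sub>1 q"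
proof -
  let ?M = "ivl (-1) 1"
  let ?l = "data_pairing y\<^sub>0 y\<^sub>1"
  obtain C where C: "0 \<le> C" "\<And>p. p \<in> per_l2 \<Longrightarrow> l2n ?M (\<lambda>u. p u - mean p) \<le> C * e p"
    using coercive by blast
  define B where "B = 2 * (l2n (ivl 0 1) (weak_deriv y\<^sub>0) + l2n (ivl 0 1) y\<^sub>1)"
  have B: "0 \<le> B" by (simp add: B_def)
  define \<Gamma> where "\<Gamma> = (\<lambda>p. (D p, ?l p)) ` per_l2"
  have lin: "(\<lambda>z. a * f z + b * g z, a * k + b * l) \<in> \<Gamma>" if "(f, k) \<in> \<Gamma>" "(g, l) \<in> \<Gamma>" for f k g l a b
  proof -
    obtain p q where pq: "p \<in> per_l2" "f = D p" "k = ?l p" "q \<in> per_l2" "g = D q" "l = ?l q"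
      using \<open>(f, k) \<in> \<Gamma>\<close> \<open>(g, l) \<in> \<Gamma>\<close> by (auto simp: \<Gamma>_def)
    show ?thesis
      unfolding \<Gamma>_def
    proof (rule image_eqI)
      show "(\<lambda>z. a * f z + b * g z, a * k + b * l) = (D (\<lambda>u. a * p u + b * q u), ?l (\<lambda>u. a * p u + b * q u))"
        unfolding pq tube_wave_linear(1) data_pairing_linear[OF pq(1,4) y] ..
      show "(\<lambda>u. a * p u + b * q u) \<in> per_l2" by (rule per_l2_lincomb[OF pq(1,4)])
    qed
  qed
  have bnd: "\<bar>k\<bar> \<le> (B * C) * l2n MQ f" if fk: "(f, k) \<in> \<Gamma>" for f k
  proof -
    obtain p where p: "p \<in> per_l2" "f = D p" "k = ?l p" using fk by (auto simp: \<Gamma>_def)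
    have "\<bar>k\<bar> = \<bar>?l (\<lambda>u. p u - mean p)\<bar>" using data_pairing_const[OF p(1) y(1)] p(3) by simp
    also have "\<dots> \<le> B * l2n ?M (\<lambda>u. p u - mean p)"
      unfolding B_def by (rule data_pairing_bound[OF per_l2_const[OF p(1)] y])
    also have "\<dots> \<le> B * (C * e p)" by (rule mult_left_mono[OF C(2)[OF p(1)] B])
    finally show ?thesis by (simp add: p(2) tube_norm_def mult.assoc)
  qed
  have sq: "f \<in> sq_int MQ" if "(f, k) \<in> \<Gamma>" for f k
    using that tube_wave_sq_int(1) by (auto simp: \<Gamma>_def)
  have "(\<lambda>u. 0) \<in> per_l2" by (simp add: per_l2_def)
  then have ne: "\<Gamma> \<noteq> {}" by (auto simp: \<Gamma>_def)
  have "\<exists>F K. (\<forall>n::nat. (F n, K n) \<in> \<Gamma>) \<and>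
      (\<forall>e>0. \<exists>N. \<forall>m\<ge>N. \<forall>n\<ge>N. l2n MQ (\<lambda>x. F m x - F n x) < e) \<and>
      (\<forall>(f, k)\<in>\<Gamma>. (\<lambda>n. \<integral>x. F n x * f x \<partial>MQ) \<longlonglongrightarrow> k)"
    by (rule riesz_minimizing_sequence[OF ne sq lin bnd])
  then obtain F K where FK: "\<And>n::nat. (F n, K n) \<in> \<Gamma>"
    and Cau: "\<And>e. e > 0 \<Longrightarrow> \<exists>N. \<forall>m\<ge>N. \<forall>n\<ge>N. l2n MQ (\<lambda>x. F m x - F n x) < e"
    and conv: "\<And>f k. (f, k) \<in> \<Gamma> \<Longrightarrow> (\<lambda>n. \<integral>x. F n x * f x \<partial>MQ) \<longlonglongrightarrow> k"
    by blast
  have "\<forall>n. \<exists>p. p \<in> per_l2 \<and> F n = D p" using FK by (auto simp: \<Gamma>_def)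
  then obtain P where "\<forall>n. P n \<in> per_l2 \<and> F n = D (P n)" by (rule choice[THEN exE])
  then have P: "\<And>n. P n \<in> per_l2" "\<And>n. F n = D (P n)" by auto
  \<comment> \<open>Normalization leaves the wave unchanged and removes the freedom in the
    profile.\<close>
  define R where "R n u = P n u - mean (P n)" for n u
  have R: "R n \<in> per_l2" for n unfolding R_def by (rule per_l2_const[OF P(1)])
  have DR: "D (R n) = F n" for n unfolding R_def tube_wave_linear(3) P(2) ..
  have "\<exists>N. \<forall>m\<ge>N. \<forall>n\<ge>N. l2n ?M (\<lambda>u. R m u - R n u) < \<eta>" if \<eta>: "0 < \<eta>" for \<eta>
  proof -
    \<comment> \<open>\<open>C\<close> may be 0, hence the added 1.\<close>
    have "0 < \<eta> / (C + 1)" using \<eta> C(1) by simp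
    from Cau[OF this] obtain N where N: "\<And>m n. N \<le> m \<Longrightarrow> N \<le> n \<Longrightarrow> l2n MQ (\<lambda>x. F m x - F n x) < \<eta> / (C + 1)"
      by blast
    have "l2n ?M (\<lambda>u. R m u - R n u) < \<eta>" if mn: "N \<le> m" "N \<le> n" for m n
    proof -
      define q where "q u = P m u - P n u" for u
      have q: "q \<in> per_l2" unfolding q_def by (rule per_l2_diff[OF P(1) P(1)])
      have "mean q = mean (P m) - mean (P n)" unfolding q_def by (rule mean_diff[OF P(1) P(1)])
      then have "R m u - R n u = q u - mean q" for u by (simp add: R_def q_def)
      then have "l2n ?M (\<lambda>u. R m u - R n u) = l2n ?M (\<lambda>u. q u - mean q)" by (simp only:)
      also have "\<dots> \<le> C * e q" by (rule C(2)[OF q])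
      also have "e q = l2n MQ (\<lambda>x. F m x - F n x)"
        unfolding tube_norm_def q_def tube_wave_linear(2) P(2) ..
      also have "C * l2n MQ (\<lambda>x. F m x - F n x) \<le> C * (\<eta> / (C + 1))"
        using N[OF mn] C(1) by (intro mult_left_mono) auto
      also have "\<dots> < \<eta>" using \<eta> C(1) by (simp add: field_simps)
      finally show ?thesis .
    qed
    then show ?thesis by blast
  qed
  from sq_int_complete[OF finite_measure_ivl per_l2D(3)[OF R] this]
  obtain r where r: "r \<in> sq_int ?M" "(\<lambda>n. l2n ?M (\<lambda>u. R n u - r u)) \<longlonglongrightarrow> 0" by blast
  \<comment> \<open>The limit exists only on one period and must be continued periodically.\<close>
  obtain p where p: "p \<in> per_l2" "\<forall>u\<in>{-1<..<1}. p u = r u" using per_l2_extend[OF r(1)] by blast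
  have "l2n ?M (\<lambda>u. R n u - r u) = l2n ?M (\<lambda>u. R n u - p u)" for n
    unfolding l2n_def using p(2) by (intro arg_cong[where f=sqrt] Bochner_Integration.integral_cong) auto
  with r(2) have Rp: "(\<lambda>n. l2n ?M (\<lambda>u. R n u - p u)) \<longlonglongrightarrow> 0" by (simp only:)
  have "(\<lambda>n. l2n MQ (\<lambda>z. D (R n) z - D p z)) \<longlonglongrightarrow> 0"
  proof (rule Lim_null_comparison)
    show "\<forall>\<^sub>F n in sequentially. norm (l2n MQ (\<lambda>z. D (R n) z - D p z)) \<le> 2 * sqrt T * l2n ?M (\<lambda>u. R n u - p u)"
      using tube_wave_sq_int(2)[OF per_l2_diff[OF R p(1)]] by (simp add: tube_norm_def tube_wave_linear(2))
    show "(\<lambda>n. 2 * sqrt T * l2n ?M (\<lambda>u. R n u - p u)) \<longlonglongrightarrow> 0"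
      using tendsto_mult_left[OF Rp, of "2 * sqrt T"] by simp
  qed
  note lim = integral_mult_tendsto[OF tube_wave_sq_int(1)[OF R] tube_wave_sq_int(1)[OF p(1)] tube_wave_sq_int(1) this]
  have "(\<integral>z. D p z * D q z \<partial>MQ) = ?l q" if q: "q \<in> per_l2" for q
  proof (rule LIMSEQ_unique[OF lim[OF q]])
    show "(\<lambda>n. \<integral>z. D (R n) z * D q z \<partial>MQ) \<longlonglongrightarrow> ?l q"
      unfolding DR by (rule conv) (use q in \<open>auto simp: \<Gamma>_def\<close>)
  qed
  with p(1) show ?thesis by blast
qed

text \<open>The energy does not depend on the representatives of curve and wave, so it can be
  evaluated with the Lipschitz curve and d'Alembert's formula.\<close>

lemma weighted_energy_eq:
  assumes \<gamma>: "\<gamma> \<in> borel_measurable (ivl 0 T)" "AE t in ivl 0 T. \<gamma> t = c t"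
    and \<phi>: "\<phi> \<in> borel_measurable MQ" "AE z in MQ. \<phi> z = dalembert p z" and p: "p \<in> per_l2"
  shows "weighted_energy T \<delta>\<^sub>0 chi \<gamma> \<phi> = (e p)\<^sup>2"
proof -
  have \<gamma>m: "(\<lambda>z. \<gamma> (snd z)) \<in> borel_measurable MQ"
  proof -
    \<comment> \<open>\<open>\<gamma>\<close> is measurable only on (0,T); extending it by 0 gives a
      Borel function on the line that can be composed with the projection.\<close>
    define G where "G t = indicator {0<..<T} t *\<^sub>R \<gamma> t" for t
    have "(\<lambda>t. indicator {0<..<T} t *\<^sub>R \<gamma> t) \<in> borel_measurable lborel"
      using \<gamma>(1) by (subst (asm) borel_measurable_restrict_space_iff) auto
    then have [measurable]: "G \<in> borel_measurable borel" unfolding G_def [abs_def] by simp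
    have "(\<lambda>z::real \<times> real. G (snd z)) \<in> borel_measurable (borel \<Otimes>\<^sub>M borel)" by measurable
    then have "(\<lambda>z::real \<times> real. G (snd z)) \<in> borel_measurable borel" by (simp only: borel_prod)
    then have "(\<lambda>z. G (snd z)) \<in> borel_measurable MQ" by (rule borel_measurable_lborel_on)
    then show ?thesis
      by (rule measurable_cong[THEN iffD1, rotated]) (auto simp: G_def Q_def)
  qed
  have cm: "(\<lambda>z. c (snd z)) \<in> borel_measurable MQ"
    by (intro borel_measurable_lborel_on borel_measurable_continuous_onI continuous_on_compose2[OF c_continuous] continuous_intros) auto
  have ae\<gamma>: "AE z in MQ. \<gamma> (snd z) - c (snd z) = 0"
  proof -
    have m: "(\<lambda>z. \<gamma> (snd z) - c (snd z)) \<in> borel_measurable MQ" by (rule borel_measurable_diff[OF \<gamma>m cm])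
    \<comment> \<open>A null set of times yields a null set of the cylinder: the difference vanishes
      on almost every slice, so its norm is 0.\<close>
    have "AE t in ivl 0 T. (\<lambda>x. \<gamma> (snd (x, t)) - c (snd (x, t))) \<in> sq_int (ivl 0 1)
        \<and> l2n (ivl 0 1) (\<lambda>x. \<gamma> (snd (x, t)) - c (snd (x, t))) \<le> 0"
      using \<gamma>(2) by eventually_elim simp
    note s = sq_int_Q[OF T_pos(2) m order_refl this]
    show ?thesis by (rule l2n_eq_0_imp_AE[OF s(1)]) (use s(2) in \<open>simp add: antisym\<close>)
  qed
  have chim: "chi \<in> borel_measurable borel" by (rule borel_measurable_continuous_onI[OF chi_props(1)])
  have xm: "(\<lambda>z. fst z :: real) \<in> borel_measurable MQ"
    by (intro borel_measurable_lborel_on borel_measurable_continuous_onI continuous_intros)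
  have "weighted_energy T \<delta>\<^sub>0 chi \<gamma> \<phi> = (\<integral>z. indicator (Q T) z *\<^sub>R ((\<phi> z)\<^sup>2 * chi (fst z - \<gamma> (snd z))) \<partial>lborel)"
    unfolding weighted_energy_def set_lebesgue_integral_def
  \<comment> \<open>The tube may be replaced by the cylinder because \<open>chi\<close> is 0 where
    the distance is at least \<open>\<delta>\<^sub>0\<close>.\<close>
  proof (rule Bochner_Integration.integral_cong[OF refl])
    fix z :: "real \<times> real"
    obtain x t where z: "z = (x, t)" by (cases z)
    show "indicat_real (tube T \<delta>\<^sub>0 \<gamma>) z *\<^sub>R (case z of (x, t) \<Rightarrow> (\<phi> (x, t))\<^sup>2 * chi (x - \<gamma> t))
       = indicat_real (Q T) z *\<^sub>R ((\<phi> z)\<^sup>2 * chi (fst z - \<gamma> (snd z)))"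
      using chi_props(5)[of "x - \<gamma> t"] by (auto simp: z tube_def indicator_def not_less)
  qed
  also have "\<dots> = (\<integral>z. (\<phi> z)\<^sup>2 * chi (fst z - \<gamma> (snd z)) \<partial>MQ)"
    by (subst integral_restrict_space) auto
  also have "\<dots> = (\<integral>z. (D p z)\<^sup>2 \<partial>MQ)"
  proof (rule integral_cong_AE)
    show "(\<lambda>z. (\<phi> z)\<^sup>2 * chi (fst z - \<gamma> (snd z))) \<in> borel_measurable MQ"
      by (intro borel_measurable_times borel_measurable_power \<phi>(1) measurable_compose[OF borel_measurable_diff[OF xm \<gamma>m] chim])
    show "(\<lambda>z. (D p z)\<^sup>2) \<in> borel_measurable MQ"
      by (rule borel_measurable_power[OF sq_int_measurable[OF tube_wave_sq_int(1)[OF p]]])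
    show "AE z in MQ. (\<phi> z)\<^sup>2 * chi (fst z - \<gamma> (snd z)) = (D p z)\<^sup>2"
      using ae\<gamma> \<phi>(2)
    proof eventually_elim
      case (elim z)
      then show ?case using chi_props(2) by (simp add: tube_wave_def power_mult_distrib)
    qed
  qed
  finally show ?thesis by (simp add: tube_norm_def l2n_power2)
qed

text \<open>Completing the square around a solution \<open>p\<close> of the optimality system gives
  (e q)^2 / 2 - l q = |D q - D p|^2 / 2 - (e p)^2 / 2. So any minimizer has the energy of
  \<open>p\<close>, and since (e p)^2 = l p the value J is the maximum of 2 l - e^2.\<close>

lemma J_eq_max:
  assumes \<gamma>: "\<gamma> \<in> borel_measurable (ivl 0 T)" "AE t in ivl 0 T. \<gamma> t = c t"
    and y: "y\<^sub>0 \<in> H10" "y\<^sub>1 \<in> sq_int (ivl 0 1)"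
  shows "\<exists>p\<in>per_l2. J T \<delta>\<^sub>0 chi y\<^sub>0 y\<^sub>1 \<gamma> = 2 * data_pairing y\<^sub>0 y\<^sub>1 p - (e p)\<^sup>2"
    "\<And>q. q \<in> per_l2 \<Longrightarrow> 2 * data_pairing y\<^sub>0 y\<^sub>1 q - (e q)\<^sup>2 \<le> J T \<delta>\<^sub>0 chi y\<^sub>0 y\<^sub>1 \<gamma>"
proof -
  let ?l = "data_pairing y\<^sub>0 y\<^sub>1"
  obtain p where p: "p \<in> per_l2" and opt: "\<And>q. q \<in> per_l2 \<Longrightarrow> (\<integral>z. D p z * D q z \<partial>MQ) = ?l q"
    using optimality_system[OF y] by blast
  note Ds = tube_wave_sq_int(1)
  have ep: "(e p)\<^sup>2 = ?l p"
    using opt[OF p] unfolding tube_norm_def l2n_power2 by (simp add: power2_eq_square)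
  have square: "(e q)\<^sup>2 / 2 - ?l q = (l2n MQ (\<lambda>z. D q z - D p z))\<^sup>2 / 2 - (e p)\<^sup>2 / 2" if q: "q \<in> per_l2" for q
    using l2n_expand[OF Ds[OF q] Ds[OF p], of 1 "-1"] opt[OF q]
    by (simp add: tube_norm_def mult.commute diff_divide_distrib add_divide_distrib)
  have Jstar: "J_star T \<delta>\<^sub>0 chi y\<^sub>0 y\<^sub>1 \<gamma> (\<phi>\<^sub>0, \<phi>\<^sub>1) = (e q)\<^sup>2 / 2 - ?l q"
    and energy: "weighted_energy T \<delta>\<^sub>0 chi \<gamma> (wave_solution T (\<phi>\<^sub>0, \<phi>\<^sub>1)) = (e q)\<^sup>2"
    if q: "q \<in> per_l2" and d: "dalembert_data q (\<phi>\<^sub>0, \<phi>\<^sub>1)" for q \<phi>\<^sub>0 \<phi>\<^sub>1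
  proof -
    note w = wave_solution_dalembert[OF T_pos(1) q d]
    show E: "weighted_energy T \<delta>\<^sub>0 chi \<gamma> (wave_solution T (\<phi>\<^sub>0, \<phi>\<^sub>1)) = (e q)\<^sup>2"
      by (rule weighted_energy_eq[OF \<gamma> w(2,1) q])
    have d': "\<phi>\<^sub>0 \<in> sq_int (ivl 0 1)" "AE x in ivl 0 1. \<phi>\<^sub>0 x = dalembert q (x, 0)"
      "\<phi>\<^sub>1 y\<^sub>0 = - (\<integral>x. dalembert_flux q 0 x * weak_deriv y\<^sub>0 x \<partial>ivl 0 1)"
      using d y(1) by (auto simp: dalembert_data_def)
    have "L2_inner \<phi>\<^sub>0 y\<^sub>1 = (\<integral>x. dalembert q (x, 0) * y\<^sub>1 x \<partial>ivl 0 1)"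
      unfolding L2_inner_ivl
    proof (rule integral_cong_AE)
      show "AE x in ivl 0 1. \<phi>\<^sub>0 x * y\<^sub>1 x = dalembert q (x, 0) * y\<^sub>1 x"
        using d'(2) by eventually_elim simp
    qed (use d'(1) dalembert_slice(1)[OF q] y(2) in \<open>auto intro!: borel_measurable_times sq_int_measurable\<close>)
    then show "J_star T \<delta>\<^sub>0 chi y\<^sub>0 y\<^sub>1 \<gamma> (\<phi>\<^sub>0, \<phi>\<^sub>1) = (e q)\<^sup>2 / 2 - ?l q"
      unfolding J_star_def prod.case E d'(3) by (simp add: data_pairing_def)
  qed
  let ?f = "J_star T \<delta>\<^sub>0 chi y\<^sub>0 y\<^sub>1 \<gamma>"
  \<comment> \<open>\<open>arg_min\<close> can be used only once some minimizer in \<open>W\<close>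
    is known; the Cauchy data of the wave with profile \<open>p\<close> provide one.\<close>
  define w where "w = (\<lambda>x. dalembert p (x, 0), \<lambda>v. - (\<integral>x. dalembert_flux p 0 x * weak_deriv v x \<partial>ivl 0 1))"
  have wd: "dalembert_data p w"
    unfolding w_def dalembert_data_def using dalembert_slice(1)[OF p] by simp
  have "snd w \<in> Hm1"
    unfolding w_def snd_conv by (rule Hm1_I(1)[OF sq_int_uminus[OF dalembert_slice(3)[OF p, of 0]]]) simp
  then have wW: "w \<in> W"
    using dalembert_slice(1)[OF p] by (simp add: W_def w_def L2_Omega)
  have fw: "?f w = - (e p)\<^sup>2 / 2"
    using Jstar[OF p wd[unfolded w_def]] ep by (simp add: w_def)
  have lower: "?f w \<le> ?f v" if v: "v \<in> W" for v
  proof -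
    obtain \<phi>\<^sub>0 \<phi>\<^sub>1 where v': "v = (\<phi>\<^sub>0, \<phi>\<^sub>1)" by (cases v)
    obtain q where q: "q \<in> per_l2" "dalembert_data q (\<phi>\<^sub>0, \<phi>\<^sub>1)" using W_dalembert v unfolding v' by blast
    show ?thesis unfolding fw v' Jstar[OF q] square[OF q(1)] by simp
  qed
  then have "is_arg_min ?f (\<lambda>p. p \<in> W) w"
    using wW unfolding is_arg_min_def by (auto simp: not_less)
  then have am: "is_arg_min ?f (\<lambda>p. p \<in> W) (arg_min ?f (\<lambda>p. p \<in> W))"
    unfolding arg_min_def by (rule someI)
  obtain \<phi>\<^sub>0 \<phi>\<^sub>1 where v: "arg_min ?f (\<lambda>p. p \<in> W) = (\<phi>\<^sub>0, \<phi>\<^sub>1)" by (cases "arg_min ?f (\<lambda>p. p \<in> W)")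
  have vW: "(\<phi>\<^sub>0, \<phi>\<^sub>1) \<in> W" and "\<not> ?f w < ?f (\<phi>\<^sub>0, \<phi>\<^sub>1)"
    using am wW unfolding v is_arg_min_def by blast+
  then have vle: "?f (\<phi>\<^sub>0, \<phi>\<^sub>1) \<le> ?f w" by simp
  obtain q where q: "q \<in> per_l2" "dalembert_data q (\<phi>\<^sub>0, \<phi>\<^sub>1)" using W_dalembert[OF vW] by blast
  \<comment> \<open>Whatever data \<open>arg_min\<close> selects, their wave agrees with that of
    \<open>p\<close> inside the tube in the weighted norm.\<close>
  have "(l2n MQ (\<lambda>z. D q z - D p z))\<^sup>2 \<le> 0"
    using vle unfolding fw Jstar[OF q] square[OF q(1)] by simp
  then have "l2n MQ (\<lambda>z. D q z - D p z) = 0" by simp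
  then have "e q = e p"
    using l2n_reverse_triangle[OF Ds[OF q(1)] Ds[OF p]] by (simp add: tube_norm_def)
  then have J: "J T \<delta>\<^sub>0 chi y\<^sub>0 y\<^sub>1 \<gamma> = (e p)\<^sup>2"
    unfolding J_def v energy[OF q] by simp
  show "\<exists>p\<in>per_l2. J T \<delta>\<^sub>0 chi y\<^sub>0 y\<^sub>1 \<gamma> = 2 * ?l p - (e p)\<^sup>2"
    using p J ep by (intro bexI[of _ p]) auto
  show "2 * ?l q - (e q)\<^sup>2 \<le> J T \<delta>\<^sub>0 chi y\<^sub>0 y\<^sub>1 \<gamma>" if "q \<in> per_l2" for q
    using square[OF that] zero_le_power2[of "l2n MQ (\<lambda>z. D q z - D p z)"] unfolding J by linarith
qed

end

subsection \<open>Admissible curves\<close>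

lemma Linf_sq_int:
  assumes "f \<in> Linf {a<..<b}"
  shows "f \<in> sq_int (ivl a b)"
proof -
  have m: "f \<in> borel_measurable (ivl a b)"
    using assms by (simp add: Linf_def set_borel_measurable_lborel_on)
  obtain C where "AE x in ivl a b. \<bar>f x\<bar> \<le> C"
    using assms by (auto simp: Linf_def AE_lborel_on)
  then have "AE x in ivl a b. \<bar>f x\<bar> \<le> \<bar>C\<bar>" by eventually_elim simp
  then show ?thesis by (rule sq_int_bound[OF continuous_sq_int_ivl[OF continuous_on_const] m])
qed

lemma primitive_lipschitz:
  assumes g: "g \<in> sq_int (ivl a b)" and M: "AE x in ivl a b. \<bar>g x\<bar> \<le> M" "0 \<le> M"
  shows "\<bar>primitive a b g x - primitive a b g y\<bar> \<le> M * \<bar>x - y\<bar>"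
proof -
  have *: "\<bar>primitive a b g x - primitive a b g y\<bar> \<le> M * (x - y)" if xy: "y \<le> x" for x y
  proof -
    note gi = sq_int_imp_integrable[OF finite_measure_ivl g]
    have "primitive a b g x - primitive a b g y = (\<integral>s. (if s < x then g s else 0) - (if s < y then g s else 0) \<partial>ivl a b)"
      unfolding primitive_def by (rule Bochner_Integration.integral_diff[OF integrable_cut[OF gi] integrable_cut[OF gi], symmetric])
    also have "\<bar>\<dots>\<bar> \<le> (\<integral>s. M * indicator {y..<x} s \<partial>ivl a b)"
    proof (rule order_trans[OF integral_abs_bound], rule integral_mono_AE)
      show "integrable (ivl a b) (\<lambda>s. \<bar>(if s < x then g s else 0) - (if s < y then g s else 0)\<bar>)"
        by (intro integrable_abs Bochner_Integration.integrable_diff integrable_cut gi)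
      show "integrable (ivl a b) (\<lambda>s. M * indicator {y..<x} s)"
        by (intro sq_int_imp_integrable[OF finite_measure_ivl] sq_int_bounded[OF finite_measure_ivl, where B = M]
            borel_measurable_lborel_on) (use M(2) in \<open>auto simp: indicator_def\<close>)
      show "AE s in ivl a b. \<bar>(if s < x then g s else 0) - (if s < y then g s else 0)\<bar> \<le> M * indicator {y..<x} s"
        using M(1) by eventually_elim (use xy in \<open>auto simp: indicator_def\<close>)
    qed
    also have "\<dots> = (\<integral>s. indicator {a<..<b} s *\<^sub>R (M * indicator {y..<x} s) \<partial>lborel)"
      by (rule integral_restrict_space) simp
    also have "\<dots> = (\<integral>s. M * indicator ({a<..<b} \<inter> {y..<x}) s \<partial>lborel)"
      by (rule Bochner_Integration.integral_cong) (auto simp: indicator_def)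
    also have "\<dots> = M * measure lborel ({a<..<b} \<inter> {y..<x})" by simp
    also have "\<dots> \<le> M * measure lborel {y..<x}"
      using xy by (intro mult_left_mono measure_mono_fmeasurable M(2)) (auto simp: fmeasurable_def)
    finally show ?thesis using xy by simp
  qed
  show ?thesis using *[of x y] *[of y x] by (cases "x \<le> y") (auto simp: abs_minus_commute)
qed

lemma G_ad_sq_int:
  assumes "\<gamma> \<in> G_ad T \<delta>\<^sub>0 M"
  shows "\<gamma> \<in> sq_int (ivl 0 T)"
  using assms by (auto simp: G_ad_def intro: Linf_sq_int)

text \<open>The weak derivative bound makes the primitive Lipschitz on the whole line. Clamping it
  to [\<open>\<delta>\<^sub>0\<close>, \<open>1 - \<delta>\<^sub>0\<close>], an interval because
  \<open>\<delta>\<^sub>0 \<le> 1 / 2\<close>, keeps the Lipschitz constant and enforces the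
  constraint everywhere.\<close>

lemma G_ad_lipschitz:
  assumes T: "0 < T" and M: "0 < M" and \<delta>: "\<delta>\<^sub>0 \<le> 1 / 2" and \<gamma>: "\<gamma> \<in> G_ad T \<delta>\<^sub>0 M"
  shows "\<exists>c. (\<forall>s t. \<bar>c s - c t\<bar> \<le> M * \<bar>s - t\<bar>) \<and> (\<forall>t. \<delta>\<^sub>0 \<le> c t \<and> c t \<le> 1 - \<delta>\<^sub>0) \<and> (AE t in ivl 0 T. \<gamma> t = c t)"
proof -
  note s = G_ad_sq_int[OF \<gamma>]
  obtain g where g: "g \<in> Linf {0<..<T}" "has_weak_deriv 0 T \<gamma> g" "AE t in ivl 0 T. \<bar>g t\<bar> \<le> M"
    using \<gamma> by (auto simp: G_ad_def AE_lborel_on)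
  have b: "AE t in ivl 0 T. \<delta>\<^sub>0 \<le> \<gamma> t \<and> \<gamma> t \<le> 1 - \<delta>\<^sub>0"
    using \<gamma> by (auto simp: G_ad_def AE_lborel_on)
  note gs = Linf_sq_int[OF g(1)]
  obtain k where k: "AE t in ivl 0 T. \<gamma> t = k + primitive 0 T g t"
    using weak_deriv_imp_primitive[OF T s gs g(2)] by blast
  define c where "c t = max \<delta>\<^sub>0 (min (1 - \<delta>\<^sub>0) (k + primitive 0 T g t))" for t
  have "\<bar>c s - c t\<bar> \<le> M * \<bar>s - t\<bar>" for s t
  proof -
    have "\<bar>c s - c t\<bar> \<le> \<bar>primitive 0 T g s - primitive 0 T g t\<bar>" by (auto simp: c_def)
    also have "\<dots> \<le> M * \<bar>s - t\<bar>" by (rule primitive_lipschitz[OF gs g(3)]) (use M in simp)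
    finally show ?thesis .
  qed
  moreover have "\<delta>\<^sub>0 \<le> c t \<and> c t \<le> 1 - \<delta>\<^sub>0" for t using \<delta> by (auto simp: c_def)
  moreover have "AE t in ivl 0 T. \<gamma> t = c t"
    using k b by eventually_elim (auto simp: c_def)
  ultimately show ?thesis by blast
qed

text \<open>A dual form of |c'| \<le> M that involves no derivative of \<open>c\<close> and so
  passes to limits. The L^1 bound makes the pairing with -\<psi>' an L^2-bounded functional, Riesz
  supplies the derivative \<open>g\<close>, and testing \<open>g\<close> against indicators recovers
  the pointwise bound.\<close>

lemma weak_deriv_bounded:
  assumes M: "0 \<le> M" and c: "c \<in> sq_int (ivl a b)"
    and bnd: "\<And>\<psi>. \<psi> \<in> C1c a b \<Longrightarrow> \<bar>\<integral>x. c x * deriv \<psi> x \<partial>ivl a b\<bar> \<le> M * (\<integral>x. \<bar>\<psi> x\<bar> \<partial>ivl a b)"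
  shows "\<exists>g\<in>sq_int (ivl a b). has_weak_deriv a b c g \<and> (AE x in ivl a b. \<bar>g x\<bar> \<le> M)"
proof -
  let ?M = "ivl a b"
  have one: "(\<lambda>x. 1) \<in> sq_int ?M" by (rule continuous_sq_int_ivl[OF continuous_on_const])
  have abs: "(\<lambda>x. \<bar>f x\<bar>) \<in> sq_int ?M" "l2n ?M (\<lambda>x. \<bar>f x\<bar>) = l2n ?M f" if "f \<in> sq_int ?M" for f
  proof -
    show "(\<lambda>x. \<bar>f x\<bar>) \<in> sq_int ?M"
      by (rule sq_int_bound[OF that borel_measurable_abs[OF sq_int_measurable[OF that]]]) simp
  qed (simp add: l2n_def)
  define \<Gamma> where "\<Gamma> = (\<lambda>\<psi>. (\<psi>, - (\<integral>x. c x * deriv \<psi> x \<partial>?M))) ` C1c a b"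
  have "\<exists>g. g \<in> sq_int ?M \<and> (\<forall>(f, k)\<in>\<Gamma>. k = (\<integral>x. g x * f x \<partial>?M))"
  proof (rule riesz_representation[of ?M \<Gamma> "M * l2n ?M (\<lambda>x. 1)"])
    have "(\<lambda>x. 0) \<in> C1c a b"
    proof (rule C1c_I(1)[where \<psi>' = "\<lambda>x. 0" and c = "a + 1" and d = "b - 1"])
      show "continuous_on UNIV (\<lambda>x::real. 0::real)" by (rule continuous_on_const)
    qed auto
    then show "\<Gamma> \<noteq> {}" by (auto simp: \<Gamma>_def)
    show "f \<in> sq_int ?M" if "(f, k) \<in> \<Gamma>" for f k using that C1c_sq_int by (auto simp: \<Gamma>_def)
    show "(\<lambda>x. \<alpha> * f x + \<beta> * g x, \<alpha> * k + \<beta> * l) \<in> \<Gamma>" if "(f, k) \<in> \<Gamma>" "(g, l) \<in> \<Gamma>" for f k g l \<alpha> \<beta>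
    proof -
      have f: "f \<in> C1c a b" "k = - (\<integral>x. c x * deriv f x \<partial>?M)" and g: "g \<in> C1c a b" "l = - (\<integral>x. c x * deriv g x \<partial>?M)"
        using that by (auto simp: \<Gamma>_def)
      have "(\<lambda>x. c x * (\<alpha> * deriv f x + \<beta> * deriv g x)) = (\<lambda>x. \<alpha> * (c x * deriv f x) + \<beta> * (c x * deriv g x))"
        by (auto simp: algebra_simps)
      then have "\<alpha> * k + \<beta> * l = - (\<integral>x. c x * (\<alpha> * deriv f x + \<beta> * deriv g x) \<partial>?M)"
        using integrable_mult_sq_int[OF c C1c_deriv_sq_int[OF f(1)]] integrable_mult_sq_int[OF c C1c_deriv_sq_int[OF g(1)]] f(2) g(2)
        by simp
      then show ?thesis
        unfolding \<Gamma>_def by (intro image_eqI[of _ _ "\<lambda>x. \<alpha> * f x + \<beta> * g x"])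
          (simp_all only: C1c_lincomb[OF f(1) g(1)])
    qed
    show "\<bar>k\<bar> \<le> M * l2n ?M (\<lambda>x. 1) * l2n ?M f" if "(f, k) \<in> \<Gamma>" for f k
    proof -
      have f: "f \<in> C1c a b" "k = - (\<integral>x. c x * deriv f x \<partial>?M)" using that by (auto simp: \<Gamma>_def)
      note fs = C1c_sq_int[OF f(1)]
      have "\<bar>k\<bar> \<le> M * (\<integral>x. \<bar>f x\<bar> \<partial>?M)" using bnd[OF f(1)] f(2) by simp
      also have "(\<integral>x. \<bar>f x\<bar> \<partial>?M) \<le> l2n ?M (\<lambda>x. 1) * l2n ?M f"
        using l2n_Cauchy_Schwarz[OF one abs(1)[OF fs]] abs(2)[OF fs] by simp
      finally show ?thesis using M by (simp add: mult_left_mono mult.assoc)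
    qed
  qed (simp, blast)
  then obtain g where g: "g \<in> sq_int ?M" and rep: "\<forall>(f, k)\<in>\<Gamma>. k = (\<integral>x. g x * f x \<partial>?M)" by blast
  have rep': "- (\<integral>x. c x * deriv \<psi> x \<partial>?M) = (\<integral>x. g x * \<psi> x \<partial>?M)" if "\<psi> \<in> C1c a b" for \<psi>
    using rep that unfolding \<Gamma>_def by blast
  have wd: "has_weak_deriv a b c g"
    unfolding has_weak_deriv_ivl using rep' by fastforce
  \<comment> \<open>Density extends the inequality from test functions to all of L^2, in particular
    to indicators.\<close>
  have gf: "(\<integral>x. g x * f x \<partial>?M) \<le> M * (\<integral>x. \<bar>f x\<bar> \<partial>?M)" if f: "f \<in> sq_int ?M" for f
  proof -
    obtain d :: "nat \<Rightarrow> real \<Rightarrow> real" where d: "\<And>n. d n \<in> C1c a b" "\<And>n. d n \<in> sq_int ?M"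
      "(\<lambda>n. l2n ?M (\<lambda>x. d n x - f x)) \<longlonglongrightarrow> 0"
      using l2_dense_sequence[OF l2_dense_C1c f] by blast
    have "(\<lambda>n. l2n ?M (\<lambda>x. \<bar>d n x\<bar> - \<bar>f x\<bar>)) \<longlonglongrightarrow> 0"
    proof (rule Lim_null_comparison[OF _ d(3)])
      show "\<forall>\<^sub>F n in sequentially. norm (l2n ?M (\<lambda>x. \<bar>d n x\<bar> - \<bar>f x\<bar>)) \<le> l2n ?M (\<lambda>x. d n x - f x)"
      proof (rule always_eventually, rule allI)
        fix n
        have "l2n ?M (\<lambda>x. \<bar>d n x\<bar> - \<bar>f x\<bar>) \<le> l2n ?M (\<lambda>x. d n x - f x)"
          by (rule l2n_mono[OF sq_int_diff[OF d(2) f] sq_int_measurable[OF sq_int_diff[OF abs(1)[OF d(2)] abs(1)[OF f]]]])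
            (auto simp: abs_triangle_ineq3)
        then show "norm (l2n ?M (\<lambda>x. \<bar>d n x\<bar> - \<bar>f x\<bar>)) \<le> l2n ?M (\<lambda>x. d n x - f x)" by simp
      qed
    qed
    from integral_mult_tendsto[OF abs(1)[OF d(2)] abs(1)[OF f] one this]
    have r: "(\<lambda>n. M * (\<integral>x. \<bar>d n x\<bar> \<partial>?M)) \<longlonglongrightarrow> M * (\<integral>x. \<bar>f x\<bar> \<partial>?M)"
      by (intro tendsto_intros) simp
    have l: "(\<lambda>n. \<integral>x. d n x * g x \<partial>?M) \<longlonglongrightarrow> (\<integral>x. f x * g x \<partial>?M)"
      by (rule integral_mult_tendsto[OF d(2) f g d(3)])
    have "(\<integral>x. d n x * g x \<partial>?M) \<le> M * (\<integral>x. \<bar>d n x\<bar> \<partial>?M)" for n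
      using bnd[OF d(1)[of n]] rep'[OF d(1)[of n]] by (simp add: mult.commute abs_le_iff)
    then have "(\<integral>x. f x * g x \<partial>?M) \<le> M * (\<integral>x. \<bar>f x\<bar> \<partial>?M)"
      by (intro LIMSEQ_le[OF l r]) blast
    then show ?thesis by (simp add: mult.commute)
  qed
  \<comment> \<open>Testing with the indicator of {h > M} shows that h - M has nonpositive integral
    over a set where it is positive, so the set is null. It is applied to \<open>g\<close> and to
    \<open>- g\<close>.\<close>
  have upper: "AE x in ?M. h x \<le> M" if h: "h \<in> sq_int ?M" and hf: "\<And>f. f \<in> sq_int ?M \<Longrightarrow> (\<integral>x. h x * f x \<partial>?M) \<le> M * (\<integral>x. \<bar>f x\<bar> \<partial>?M)" for h
  proof -
    note [measurable] = sq_int_measurable[OF h]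
    let ?f = "\<lambda>x. if M < h x then 1 else 0 :: real"
    have f: "?f \<in> sq_int ?M" by (rule sq_int_bounded[OF finite_measure_ivl, where B = 1]) auto
    have i: "integrable ?M (\<lambda>x. h x * ?f x)" "integrable ?M ?f"
      by (rule integrable_mult_sq_int[OF h f], rule sq_int_imp_integrable[OF finite_measure_ivl f])
    have i': "integrable ?M (\<lambda>x. h x * ?f x - M * ?f x)"
      by (intro Bochner_Integration.integrable_diff integrable_mult_right i)
    have abs_f: "\<bar>?f x\<bar> = ?f x" for x by simp
    have "(\<integral>x. h x * ?f x - M * ?f x \<partial>?M) = (\<integral>x. h x * ?f x \<partial>?M) - M * (\<integral>x. ?f x \<partial>?M)"
      using Bochner_Integration.integral_diff[OF i(1) integrable_mult_right[OF i(2), of M]] by simp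
    also have "\<dots> \<le> 0" using hf[OF f] unfolding abs_f by simp
    finally have le: "(\<integral>x. h x * ?f x - M * ?f x \<partial>?M) \<le> 0" .
    have nn: "0 \<le> h x * ?f x - M * ?f x" for x by auto
    have "(\<integral>x. h x * ?f x - M * ?f x \<partial>?M) = 0" by (rule antisym[OF le integral_nonneg_AE]) (use nn in auto)
    then have "AE x in ?M. h x * ?f x - M * ?f x = 0"
      by (subst (asm) integral_nonneg_eq_0_iff_AE[OF i']) (use nn in auto)
    then show ?thesis by eventually_elim (auto split: if_splits)
  qed
  have u1: "AE x in ?M. g x \<le> M" by (rule upper[OF g gf])
  have u2: "AE x in ?M. - g x \<le> M"
  proof (rule upper[OF sq_int_uminus[OF g]])
    fix f assume f: "f \<in> sq_int ?M"
    show "(\<integral>x. - g x * f x \<partial>?M) \<le> M * (\<integral>x. \<bar>f x\<bar> \<partial>?M)"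
      using gf[OF sq_int_uminus[OF f]] by simp
  qed
  have "AE x in ?M. \<bar>g x\<bar> \<le> M" using u1 u2 by eventually_elim simp
  with g wd show ?thesis by blast
qed

lemma G_ad_weak_bound:
  assumes \<gamma>: "\<gamma> \<in> G_ad T \<delta>\<^sub>0 M" and c: "c \<in> borel_measurable (ivl 0 T)" "AE t in ivl 0 T. \<gamma> t = c t"
    and \<psi>: "\<psi> \<in> C1c 0 T"
  shows "\<bar>\<integral>t. c t * deriv \<psi> t \<partial>ivl 0 T\<bar> \<le> M * (\<integral>t. \<bar>\<psi> t\<bar> \<partial>ivl 0 T)"
proof -
  let ?M = "ivl 0 T"
  obtain g where g: "g \<in> Linf {0<..<T}" "has_weak_deriv 0 T \<gamma> g" "AE t in ?M. \<bar>g t\<bar> \<le> M"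
    using \<gamma> by (auto simp: G_ad_def AE_lborel_on)
  note gs = Linf_sq_int[OF g(1)] and \<psi>s = C1c_sq_int[OF \<psi>]
  have "(\<integral>t. c t * deriv \<psi> t \<partial>?M) = (\<integral>t. \<gamma> t * deriv \<psi> t \<partial>?M)"
  proof (rule integral_cong_AE)
    show "AE t in ?M. c t * deriv \<psi> t = \<gamma> t * deriv \<psi> t" using c(2) by eventually_elim simp
  qed (use c(1) sq_int_measurable[OF G_ad_sq_int[OF \<gamma>]] sq_int_measurable[OF C1c_deriv_sq_int[OF \<psi>]] in auto)
  also have "\<dots> = - (\<integral>t. g t * \<psi> t \<partial>?M)" using g(2) \<psi> unfolding has_weak_deriv_ivl by blast
  also have "\<bar>\<dots>\<bar> \<le> (\<integral>t. M * \<bar>\<psi> t\<bar> \<partial>?M)"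
    unfolding abs_minus_cancel
  proof (rule order_trans[OF integral_abs_bound], rule integral_mono_AE)
    show "integrable ?M (\<lambda>t. \<bar>g t * \<psi> t\<bar>)" by (intro integrable_abs integrable_mult_sq_int gs \<psi>s)
    show "integrable ?M (\<lambda>t. M * \<bar>\<psi> t\<bar>)"
      by (intro integrable_mult_right integrable_abs sq_int_imp_integrable[OF finite_measure_ivl \<psi>s])
    show "AE t in ?M. \<bar>g t * \<psi> t\<bar> \<le> M * \<bar>\<psi> t\<bar>"
      using g(3) by eventually_elim (simp add: abs_mult mult_right_mono)
  qed
  finally show ?thesis by simp
qed

lemma G_ad_I:
  assumes m: "c \<in> borel_measurable (ivl 0 T)" and b: "\<And>t. \<delta>\<^sub>0 \<le> c t \<and> c t \<le> 1 - \<delta>\<^sub>0" and M: "0 \<le> M"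
    and bnd: "\<And>\<psi>. \<psi> \<in> C1c 0 T \<Longrightarrow> \<bar>\<integral>t. c t * deriv \<psi> t \<partial>ivl 0 T\<bar> \<le> M * (\<integral>t. \<bar>\<psi> t\<bar> \<partial>ivl 0 T)"
  shows "c \<in> G_ad T \<delta>\<^sub>0 M"
proof -
  have cb: "\<bar>c t\<bar> \<le> 1 + \<bar>\<delta>\<^sub>0\<bar>" for t using b[of t] by linarith
  have cs: "c \<in> sq_int (ivl 0 T)" by (rule sq_int_bounded[OF finite_measure_ivl m cb])
  obtain g where g: "g \<in> sq_int (ivl 0 T)" "has_weak_deriv 0 T c g" "AE t in ivl 0 T. \<bar>g t\<bar> \<le> M"
    using weak_deriv_bounded[OF M cs bnd] by blast
  have gae: "AE t\<in>{0<..<T} in lborel. \<bar>g t\<bar> \<le> M" using g(3) by (simp add: AE_lborel_on)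
  have "g \<in> Linf {0<..<T}"
    using sq_int_measurable[OF g(1)] gae by (auto simp: Linf_def set_borel_measurable_lborel_on)
  moreover have "c \<in> Linf {0<..<T}"
    using m cb by (auto simp: Linf_def set_borel_measurable_lborel_on intro!: exI[of _ "1 + \<bar>\<delta>\<^sub>0\<bar>"])
  ultimately show ?thesis
    using g(2) gae b by (auto simp: G_ad_def)
qed

lemma G_ad_nonempty:
  assumes "\<delta>\<^sub>0 \<le> 1 / 2" "0 \<le> M" "0 \<le> T"
  shows "(\<lambda>t. 1 / 2) \<in> G_ad T \<delta>\<^sub>0 M"
proof (rule G_ad_I)
  fix \<psi> assume \<psi>: "\<psi> \<in> C1c 0 T"
  have "0 \<le> (\<integral>t. \<bar>\<psi> t\<bar> \<partial>ivl 0 T)" by simp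
  then show "\<bar>\<integral>t. 1 / 2 * deriv \<psi> t \<partial>ivl 0 T\<bar> \<le> M * (\<integral>t. \<bar>\<psi> t\<bar> \<partial>ivl 0 T)"
    using C1c_primitive(2)[OF \<psi> assms(3)] assms(2) by simp
qed (use assms in auto)

text \<open>For a fixed profile only the weight varies; it lies between 0 and 1, so the square of
  the unweighted wave dominates.\<close>

lemma tube_norm_tendsto:
  assumes c: "moving_cutoff T \<delta>\<^sub>0 \<delta> M chi c" and cn: "\<And>n. moving_cutoff T \<delta>\<^sub>0 \<delta> M chi (C n)"
    and lim: "\<And>t. t \<in> {0<..<T} \<Longrightarrow> (\<lambda>n. C n t) \<longlonglongrightarrow> c t" and p: "p \<in> per_l2"
  shows "(\<lambda>n. (tube_norm T chi (C n) p)\<^sup>2) \<longlonglongrightarrow> (tube_norm T chi c p)\<^sup>2"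
proof -
  interpret moving_cutoff T \<delta>\<^sub>0 \<delta> M chi c by fact
  note d = dalembert_sq_int_Q(1)[OF T_pos(2) p]
  have sq: "(tube_wave chi c' p z)\<^sup>2 = chi (fst z - c' (snd z)) * (dalembert p z)\<^sup>2" for c' z
    using chi_props(2) by (simp add: tube_wave_def power_mult_distrib)
  show ?thesis
    unfolding tube_norm_def l2n_power2
  proof (rule integral_dominated_convergence)
    show "(\<lambda>z. (tube_wave chi c p z)\<^sup>2) \<in> borel_measurable MQ"
      using sq_int_measurable[OF tube_wave_sq_int(1)[OF p]] by measurable
    show "(\<lambda>z. (tube_wave chi (C n) p z)\<^sup>2) \<in> borel_measurable MQ" for n
      using sq_int_measurable[OF moving_cutoff.tube_wave_sq_int(1)[OF cn p]] by measurable
    show "integrable MQ (\<lambda>z. (dalembert p z)\<^sup>2)" by (rule sq_int_integrable[OF d])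
    show "AE z in MQ. (\<lambda>n. (tube_wave chi (C n) p z)\<^sup>2) \<longlonglongrightarrow> (tube_wave chi c p z)\<^sup>2"
    proof (rule AE_I2)
      fix z assume "z \<in> space MQ"
      then have "snd z \<in> {0<..<T}" by (auto simp: Q_def)
      then have "(\<lambda>n. fst z - C n (snd z)) \<longlonglongrightarrow> fst z - c (snd z)" by (intro tendsto_intros lim)
      moreover have "isCont chi (fst z - c (snd z))"
        using chi_props(1) by (simp add: continuous_on_eq_continuous_at)
      ultimately have "(\<lambda>n. chi (fst z - C n (snd z))) \<longlonglongrightarrow> chi (fst z - c (snd z))"
        by (rule isCont_tendsto_compose[rotated])
      then show "(\<lambda>n. (tube_wave chi (C n) p z)\<^sup>2) \<longlonglongrightarrow> (tube_wave chi c p z)\<^sup>2"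
        unfolding sq by (intro tendsto_intros)
    qed
    show "AE z in MQ. norm ((tube_wave chi (C n) p z)\<^sup>2) \<le> (dalembert p z)\<^sup>2" for n
      by (rule AE_I2) (use chi_props(2,3) in \<open>simp add: sq mult_left_le_one_le\<close>)
  qed
qed

theorem proposition2:
  fixes T \<delta>\<^sub>0 \<delta> M :: real and chi y\<^sub>0 y\<^sub>1 :: "real \<Rightarrow> real"
  assumes "T \<ge> 2" and "0 < \<delta>\<^sub>0" and "\<delta>\<^sub>0 \<le> 1 / 2" and "0 < \<delta>" and "\<delta> < \<delta>\<^sub>0" and "M > 0"
    and "is_cutoff \<delta>\<^sub>0 \<delta> chi"
    and "y\<^sub>0 \<in> H10" and "y\<^sub>1 \<in> L2 Omega"
  shows "\<exists>\<gamma>\<in>G_ad T \<delta>\<^sub>0 M.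
    (\<forall>\<gamma>'\<in>G_ad T \<delta>\<^sub>0 M. J T \<delta>\<^sub>0 chi y\<^sub>0 y\<^sub>1 \<gamma> \<le> J T \<delta>\<^sub>0 chi y\<^sub>0 y\<^sub>1 \<gamma>') \<and>
    J T \<delta>\<^sub>0 chi y\<^sub>0 y\<^sub>1 \<gamma> = (INF \<gamma>'\<in>G_ad T \<delta>\<^sub>0 M. J T \<delta>\<^sub>0 chi y\<^sub>0 y\<^sub>1 \<gamma>')"
proof -
  let ?G = "G_ad T \<delta>\<^sub>0 M"
  let ?J = "J T \<delta>\<^sub>0 chi y\<^sub>0 y\<^sub>1"
  let ?l = "data_pairing y\<^sub>0 y\<^sub>1"
  let ?e = "tube_norm T chi"
  have T: "0 < T" using assms(1) by simp
  have y1: "y\<^sub>1 \<in> sq_int (ivl 0 1)" using assms(9) by (simp add: L2_Omega)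
  have mc: "moving_cutoff T \<delta>\<^sub>0 \<delta> M chi c"
    if "\<forall>s t. \<bar>c s - c t\<bar> \<le> M * \<bar>s - t\<bar>" "\<forall>t. \<delta>\<^sub>0 \<le> c t \<and> c t \<le> 1 - \<delta>\<^sub>0" for c
    by unfold_locales (use assms that in auto)
  have rep: "\<exists>c. moving_cutoff T \<delta>\<^sub>0 \<delta> M chi c \<and> (AE t in ivl 0 T. \<gamma> t = c t)" if \<gamma>: "\<gamma> \<in> ?G" for \<gamma>
  proof -
    obtain c where "\<forall>s t. \<bar>c s - c t\<bar> \<le> M * \<bar>s - t\<bar>" "\<forall>t. \<delta>\<^sub>0 \<le> c t \<and> c t \<le> 1 - \<delta>\<^sub>0" "AE t in ivl 0 T. \<gamma> t = c t"
      using G_ad_lipschitz[OF T assms(6,3) \<gamma>] by blast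
    with mc show ?thesis by blast
  qed
  have below: "2 * ?l p - (?e c p)\<^sup>2 \<le> ?J \<gamma>"
    if "\<gamma> \<in> ?G" "moving_cutoff T \<delta>\<^sub>0 \<delta> M chi c" "AE t in ivl 0 T. \<gamma> t = c t" "p \<in> per_l2" for \<gamma> c p
    by (rule moving_cutoff.J_eq_max(2)[OF that(2) sq_int_measurable[OF G_ad_sq_int[OF that(1)]] that(3) assms(8) y1 that(4)])
  \<comment> \<open>The zero profile is a competitor with value 0, so the infimum is over a set
    bounded below.\<close>
  have J0: "0 \<le> ?J \<gamma>" if \<gamma>: "\<gamma> \<in> ?G" for \<gamma>
  proof -
    obtain c where c: "moving_cutoff T \<delta>\<^sub>0 \<delta> M chi c" "AE t in ivl 0 T. \<gamma> t = c t" using rep[OF \<gamma>] by blast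
    have z: "(\<lambda>u. 0) \<in> per_l2" by (simp add: per_l2_def)
    have "?l (\<lambda>u. 0) = 0" "?e c (\<lambda>u. 0) = 0"
      by (simp_all add: data_pairing_def dalembert_def dalembert_flux_def tube_norm_def tube_wave_def [abs_def] split_beta)
    with below[OF \<gamma> c z] show ?thesis by simp
  qed
  have ne: "?G \<noteq> {}" using G_ad_nonempty[of \<delta>\<^sub>0 M T] assms T by auto
  have bdd: "bdd_below (?J ` ?G)" by (rule bdd_belowI2[OF J0])
  define m where "m = (INF \<gamma>\<in>?G. ?J \<gamma>)"
  have m_le: "m \<le> ?J \<gamma>" if "\<gamma> \<in> ?G" for \<gamma> unfolding m_def by (rule cINF_lower[OF bdd that])
  have "\<exists>\<gamma>\<in>?G. ?J \<gamma> < m + inverse (real (Suc n))" for n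
    by (rule cINF_less_iff[OF ne bdd, THEN iffD1]) (simp add: m_def[symmetric])
  \<comment> \<open>Each curve of the minimizing sequence is chosen together with its Lipschitz
    representative.\<close>
  then have "\<forall>n. \<exists>\<gamma>c. fst \<gamma>c \<in> ?G \<and> ?J (fst \<gamma>c) < m + inverse (real (Suc n)) \<and>
      moving_cutoff T \<delta>\<^sub>0 \<delta> M chi (snd \<gamma>c) \<and> (AE t in ivl 0 T. fst \<gamma>c t = snd \<gamma>c t)"
    using rep by (metis fst_conv snd_conv)
  then obtain S where S: "\<forall>n. fst (S n) \<in> ?G \<and> ?J (fst (S n)) < m + inverse (real (Suc n)) \<and>
      moving_cutoff T \<delta>\<^sub>0 \<delta> M chi (snd (S n)) \<and> (AE t in ivl 0 T. fst (S n) t = snd (S n) t)"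
    by (rule choice[THEN exE])
  define \<Gamma> where "\<Gamma> n = fst (S n)" for n
  define C where "C n = snd (S n)" for n
  have \<Gamma>: "\<Gamma> n \<in> ?G" "?J (\<Gamma> n) < m + inverse (real (Suc n))" and C: "moving_cutoff T \<delta>\<^sub>0 \<delta> M chi (C n)"
    and \<Gamma>C: "AE t in ivl 0 T. \<Gamma> n t = C n t" for n
    using S by (simp_all add: \<Gamma>_def C_def)
  have Clip: "\<bar>C n s - C n t\<bar> \<le> M * \<bar>s - t\<bar>" and Cin: "\<delta>\<^sub>0 \<le> C n t" "C n t \<le> 1 - \<delta>\<^sub>0" for n s t
    using moving_cutoff.lip[OF C] moving_cutoff.inside[OF C] by auto
  obtain g and k :: "nat \<Rightarrow> nat" where k: "strict_mono k"
    and gk: "\<And>\<epsilon>. 0 < \<epsilon> \<Longrightarrow> \<exists>N. \<forall>n x. n \<ge> N \<and> x \<in> {0..T} \<longrightarrow> norm (C (k n) x - g x) < \<epsilon>"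
  proof (rule Arzela_Ascoli[of "{0..T}" C 1])
    show "norm (C n x) \<le> 1" for n x using Cin[of n x] assms(2) by simp
    show "\<exists>d>0. \<forall>n y. y \<in> {0..T} \<and> norm (x - y) < d \<longrightarrow> norm (C n x - C n y) < \<epsilon>" if "0 < \<epsilon>" for x \<epsilon>
    proof (intro exI[of _ "\<epsilon> / M"] conjI allI impI)
      show "0 < \<epsilon> / M" using that assms(6) by simp
      fix n y assume y: "y \<in> {0..T} \<and> norm (x - y) < \<epsilon> / M"
      have "M * \<bar>x - y\<bar> < \<epsilon>" using y assms(6) by (simp add: field_simps)
      with Clip[of n x y] show "norm (C n x - C n y) < \<epsilon>" by simp
    qed
  qed auto
  \<comment> \<open>Arzela-Ascoli gives a limit on [0,T] only; freezing it outside by this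
    1-Lipschitz clamp yields a curve on the whole line with the same Lipschitz constant.\<close>
  define r where "r t = max 0 (min T t)" for t :: real
  have r: "r t \<in> {0..T}" "\<bar>r s - r t\<bar> \<le> \<bar>s - t\<bar>" for s t using T by (auto simp: r_def)
  define c where "c t = g (r t)" for t
  have limr: "(\<lambda>n. C (k n) (r t)) \<longlonglongrightarrow> c t" for t
  proof (rule LIMSEQ_I)
    fix \<epsilon> :: real assume "0 < \<epsilon>"
    from gk[OF this] r(1)[of t] show "\<exists>no. \<forall>n\<ge>no. norm (C (k n) (r t) - c t) < \<epsilon>"
      unfolding c_def by blast
  qed
  have clip: "\<forall>s t. \<bar>c s - c t\<bar> \<le> M * \<bar>s - t\<bar>"
  proof (intro allI)
    fix s t
    have "\<bar>C (k n) (r s) - C (k n) (r t)\<bar> \<le> M * \<bar>s - t\<bar>" for n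
      using order_trans[OF Clip[of "k n" "r s" "r t"] mult_left_mono[OF r(2)[of s t]]] assms(6) by simp
    moreover have "(\<lambda>n. \<bar>C (k n) (r s) - C (k n) (r t)\<bar>) \<longlonglongrightarrow> \<bar>c s - c t\<bar>"
      by (intro tendsto_intros limr)
    ultimately show "\<bar>c s - c t\<bar> \<le> M * \<bar>s - t\<bar>" by (intro LIMSEQ_le_const2) auto
  qed
  have cin: "\<forall>t. \<delta>\<^sub>0 \<le> c t \<and> c t \<le> 1 - \<delta>\<^sub>0"
    using LIMSEQ_le_const[OF limr] LIMSEQ_le_const2[OF limr] Cin by blast
  have c: "moving_cutoff T \<delta>\<^sub>0 \<delta> M chi c" by (rule mc[OF clip cin])
  have lim: "(\<lambda>n. C (k n) t) \<longlonglongrightarrow> c t" if "t \<in> {0<..<T}" for t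
  proof -
    have "r t = t" using that by (simp add: r_def)
    with limr[of t] show ?thesis by simp
  qed
  have cont: "continuous_on UNIV d" if "moving_cutoff T \<delta>\<^sub>0 \<delta> M chi d" for d
    by (rule moving_cutoff.c_continuous[OF that])
  have meas: "d \<in> borel_measurable (ivl 0 T)" if "moving_cutoff T \<delta>\<^sub>0 \<delta> M chi d" for d
    by (rule borel_measurable_lborel_on[OF borel_measurable_continuous_onI[OF cont[OF that]]])
  \<comment> \<open>Membership needs a weak derivative of the limit, which the convergence of curves
    does not provide directly; the dual inequality holds along the sequence and passes to the
    limit.\<close>
  have cG: "c \<in> ?G"
  proof (rule G_ad_I[OF meas[OF c]])
    show "\<delta>\<^sub>0 \<le> c t \<and> c t \<le> 1 - \<delta>\<^sub>0" for t using cin by blast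
    fix \<psi> assume \<psi>: "\<psi> \<in> C1c 0 T"
    note ds = C1c_deriv_sq_int[OF \<psi>]
    have "(\<lambda>n. \<integral>t. C (k n) t * deriv \<psi> t \<partial>ivl 0 T) \<longlonglongrightarrow> (\<integral>t. c t * deriv \<psi> t \<partial>ivl 0 T)"
    proof (rule integral_mult_tendsto[OF _ _ ds])
      show "C (k n) \<in> sq_int (ivl 0 T)" for n
        by (rule continuous_sq_int_ivl[OF continuous_on_subset[OF cont[OF C]]]) simp
      show "c \<in> sq_int (ivl 0 T)"
        by (rule continuous_sq_int_ivl[OF continuous_on_subset[OF cont[OF c]]]) simp
      show "(\<lambda>n. l2n (ivl 0 T) (\<lambda>x. C (k n) x - c x)) \<longlonglongrightarrow> 0"
      proof (rule l2n_dominated[OF continuous_sq_int_ivl[OF continuous_on_const[of _ 1]] meas[OF C] meas[OF c]])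
        show "AE t in ivl 0 T. (\<lambda>n. C (k n) t) \<longlonglongrightarrow> c t" by (rule AE_I2) (use lim in simp)
        show "AE t in ivl 0 T. \<bar>C (k n) t - c t\<bar> \<le> \<bar>1\<bar>" for n
        proof (rule AE_I2)
          fix t
          show "\<bar>C (k n) t - c t\<bar> \<le> \<bar>1\<bar>" using Cin[of "k n" t] cin[rule_format, of t] assms(2) by linarith
        qed
      qed
    qed
    then have "(\<lambda>n. \<bar>\<integral>t. C (k n) t * deriv \<psi> t \<partial>ivl 0 T\<bar>) \<longlonglongrightarrow> \<bar>\<integral>t. c t * deriv \<psi> t \<partial>ivl 0 T\<bar>"
      by (rule tendsto_rabs)
    then show "\<bar>\<integral>t. c t * deriv \<psi> t \<partial>ivl 0 T\<bar> \<le> M * (\<integral>t. \<bar>\<psi> t\<bar> \<partial>ivl 0 T)"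
      by (rule LIMSEQ_le_const2) (use G_ad_weak_bound[OF \<Gamma>(1) meas[OF C] \<Gamma>C \<psi>] in blast)
  qed (use assms(6) in simp)
  \<comment> \<open>The maximizing profile of the limit curve, kept fixed as a competitor for every
    curve of the sequence.\<close>
  obtain p where p: "p \<in> per_l2" "?J c = 2 * ?l p - (?e c p)\<^sup>2"
    using moving_cutoff.J_eq_max(1)[OF c meas[OF c] _ assms(8) y1] by auto
  have "?J c \<le> m"
  proof (rule LIMSEQ_le)
    show "(\<lambda>n. 2 * ?l p - (?e (C (k n)) p)\<^sup>2) \<longlonglongrightarrow> ?J c"
      unfolding p(2) by (intro tendsto_intros tube_norm_tendsto[OF c C lim p(1)])
    have "(\<lambda>n. m + inverse (real (Suc n))) \<longlonglongrightarrow> m + 0"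
      by (intro tendsto_intros LIMSEQ_inverse_real_of_nat)
    then show "(\<lambda>n. m + inverse (real (Suc n))) \<longlonglongrightarrow> m" by simp
    have "2 * ?l p - (?e (C (k n)) p)\<^sup>2 \<le> m + inverse (real (Suc n))" for n
    proof -
      have "2 * ?l p - (?e (C (k n)) p)\<^sup>2 \<le> ?J (\<Gamma> (k n))" by (rule below[OF \<Gamma>(1) C \<Gamma>C p(1)])
      also have "\<dots> \<le> m + inverse (real (Suc (k n)))" by (rule less_imp_le[OF \<Gamma>(2)])
      \<comment> \<open>A strictly increasing index sequence satisfies k n \<ge> n.\<close>
      also have "\<dots> \<le> m + inverse (real (Suc n))"
        using seq_suble[OF k, of n] by (intro add_left_mono le_imp_inverse_le) auto
      finally show ?thesis .
    qed
    then show "\<exists>N. \<forall>n\<ge>N. 2 * ?l p - (?e (C (k n)) p)\<^sup>2 \<le> m + inverse (real (Suc n))" by blast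
  qed
  with m_le have "\<forall>\<gamma>'\<in>?G. ?J c \<le> ?J \<gamma>'" "?J c = m" using cG by (auto intro: order_trans antisym)
  then show ?thesis using cG unfolding m_def by blast
qed

end
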